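(* Let $X\subseteq\mathbb{R}^n$ be open, $U$ an open neighborhood of $X\times\{0\}$ in $\mathbb{R}^{n+1}$, and $U_+=U\cap\{t>0\}$. Let $$L=\frac{\partial}{\partial t}+\sum_{j=1}^n a_j(x,t)\frac{\partial}{\partial x_j}$$ with complex-valued coefficients $a_j$ that are $C^\infty$ on $(X\times\{0\})\cup U_+$, and write $a=(a_1,\dots,a_n)$. Suppose $f\in C^1(U_+)$ satisfies, as $t\to0^+$, $|f(x,t)|=O(t^{-N})$ for some $N$ and $$|Lf(x,t)|=O(t^k),\qquad k=1,2,\dots,$$ uniformly on compact subsets of $X$. Let $l\ge 0$ be an integer and assume $$\partial_t^j a(x,0)=0\qquad\text{for all } j<l \text{ and all } x\in X,$$ and that $$\langle \partial_t^l \operatorname{Im} a(x_0,0),\xi^0\rangle>0\quad\text{for some } x_0\in X,\ \xi^0\in\mathbb{R}^n.$$ Then $(x_0,\xi^0)\notin WF(bf)$.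
   Context: $(x,t)$, $x\in\mathbb{R}^n$, $t\in\mathbb{R}$, are the coordinates of $\mathbb{R}^{n+1}$; smoothness on $(X\times\{0\})\cup U_+$ means smoothness up to the boundary $t=0$. The trace is $bf=\lim_{t\to0^+}f(\cdot,t)$, the limit being in $\mathcal{D}'(X)$; it exists under the stated hypotheses. $WF$ denotes the $C^\infty$ wave front set. No local integrability of $L$ is assumed. *)

theory Defs
  imports "HOL-Analysis.Analysis"
begin

section \<open>Smooth functions\<close>

text \<open>
  Derivatives are taken within the set \<open>S\<close>. They agree with the usual ones on an open \<open>S\<close>,
  and on a set that is relatively open in a closed half-space, where they are unique and
  one-sided at the boundary. For such an \<open>S\<close>, smoothness on \<open>S\<close> is smoothness up to the
  boundary. For other sets (isolated points, say) \<open>frechet_derivative\<close> is an arbitrary choice.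
\<close>

definition dir_deriv ::
  "'a::real_normed_vector set \<Rightarrow> 'a \<Rightarrow> ('a \<Rightarrow> 'b::real_normed_vector) \<Rightarrow> 'a \<Rightarrow> 'b" where
  "dir_deriv S v f = (\<lambda>p. frechet_derivative f (at p within S) v)"

primrec Ck_on ::
  "nat \<Rightarrow> 'a::euclidean_space set \<Rightarrow> ('a \<Rightarrow> 'b::real_normed_vector) \<Rightarrow> bool" where
  "Ck_on 0 S f \<longleftrightarrow> continuous_on S f"
| "Ck_on (Suc k) S f \<longleftrightarrow> f differentiable_on S \<and> (\<forall>v\<in>Basis. Ck_on k S (dir_deriv S v f))"

definition smooth_on :: "'a::euclidean_space set \<Rightarrow> ('a \<Rightarrow> 'b::real_normed_vector) \<Rightarrow> bool" where
  "smooth_on S f \<longleftrightarrow> (\<forall>k. Ck_on k S f)"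


section \<open>Test functions, distributions, wave front sets\<close>

definition test_functions :: "'a::euclidean_space set \<Rightarrow> ('a \<Rightarrow> complex) set" where
  "test_functions X =
    {\<phi>. smooth_on UNIV \<phi> \<and> compact (closure {x. \<phi> x \<noteq> 0}) \<and> closure {x. \<phi> x \<noteq> 0} \<subseteq> X}"

text \<open>
  Functionals are total on all functions, but only their values on \<open>test_functions X\<close> matter.
  Iterated partial derivatives are indexed by lists of basis vectors instead of multi-indices;
  this only repeats each mixed partial finitely often.
\<close>

definition distribution :: "'a::euclidean_space set \<Rightarrow> (('a \<Rightarrow> complex) \<Rightarrow> complex) \<Rightarrow> bool" where
  "distribution X u \<longleftrightarrow>
    (\<forall>\<phi>\<in>test_functions X. \<forall>\<psi>\<in>test_functions X. u (\<lambda>x. \<phi> x + \<psi> x) = u \<phi> + u \<psi>) \<and>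
    (\<forall>\<phi>\<in>test_functions X. \<forall>c. u (\<lambda>x. c * \<phi> x) = c * u \<phi>) \<and>
    (\<forall>K. compact K \<and> K \<subseteq> X \<longrightarrow>
      (\<exists>C m. \<forall>\<phi>\<in>test_functions X. closure {x. \<phi> x \<noteq> 0} \<subseteq> K \<longrightarrow>
        norm (u \<phi>) \<le> C * (\<Sum>vs | set vs \<subseteq> Basis \<and> length vs \<le> m.
                            (SUP x. norm (foldr (dir_deriv UNIV) vs \<phi> x)))))"

text \<open>The Fourier transform of the compactly supported distribution \<open>\<phi> u\<close>.\<close>

definition localized_fourier ::
  "(('a::euclidean_space \<Rightarrow> complex) \<Rightarrow> complex) \<Rightarrow> ('a \<Rightarrow> complex) \<Rightarrow> 'a \<Rightarrow> complex" where
  "localized_fourier u \<phi> \<xi> = u (\<lambda>x. \<phi> x * exp (- (\<i> * of_real (x \<bullet> \<xi>))))"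

definition open_cone :: "'a::real_normed_vector set \<Rightarrow> bool" where
  "open_cone \<Gamma> \<longleftrightarrow> open \<Gamma> \<and> (\<forall>\<xi>\<in>\<Gamma>. \<forall>r>0. r *\<^sub>R \<xi> \<in> \<Gamma>)"

definition rapidly_decreasing_on :: "'a::real_normed_vector set \<Rightarrow> ('a \<Rightarrow> complex) \<Rightarrow> bool" where
  "rapidly_decreasing_on \<Gamma> g \<longleftrightarrow> (\<forall>m::nat. \<exists>C. \<forall>\<xi>\<in>\<Gamma>. norm (g \<xi>) \<le> C / (1 + norm \<xi>) ^ m)"

definition wave_front_set ::
  "'a::euclidean_space set \<Rightarrow> (('a \<Rightarrow> complex) \<Rightarrow> complex) \<Rightarrow> ('a \<times> 'a) set" where
  "wave_front_set X u = {(x, \<xi>). x \<in> X \<and> \<xi> \<noteq> 0 \<and>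
    (\<forall>\<phi>\<in>test_functions X. \<phi> x \<noteq> 0 \<longrightarrow>
      \<not> (\<exists>\<Gamma>. open_cone \<Gamma> \<and> \<xi> \<in> \<Gamma> \<and> rapidly_decreasing_on \<Gamma> (localized_fourier u \<phi>)))}"


section \<open>The vector field and the boundary trace\<close>

definition upper_part :: "('a \<times> real) set \<Rightarrow> ('a \<times> real) set" where
  "upper_part U = {p \<in> U. snd p > 0}"

definition vector_field_L ::
  "((real^'n) \<times> real) set \<Rightarrow> ((real^'n) \<times> real \<Rightarrow> complex^'n) \<Rightarrow>
   ((real^'n) \<times> real \<Rightarrow> complex) \<Rightarrow> (real^'n) \<times> real \<Rightarrow> complex" where
  "vector_field_L \<Omega> a f p =
    dir_deriv \<Omega> (0, 1) f p + (\<Sum>j\<in>UNIV. a p $ j * dir_deriv \<Omega> (axis j 1, 0) f p)"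

text \<open>
  \<open>g(x, t) = O(h(t))\<close> as \<open>t \<rightarrow> 0+\<close>, uniformly for \<open>x\<close> in compact subsets of \<open>X\<close>. If \<open>U\<close> is a
  neighborhood of \<open>X \<times> {0}\<close>, then for small \<open>t > 0\<close> only values of \<open>g\<close> on \<open>upper_part U\<close> enter;
  the same holds for the integrals in the trace below.
\<close>

definition bigo_locally_uniformly ::
  "'a::topological_space set \<Rightarrow> ('a \<times> real \<Rightarrow> complex) \<Rightarrow> (real \<Rightarrow> real) \<Rightarrow> bool" where
  "bigo_locally_uniformly X g h \<longleftrightarrow>
    (\<forall>K. compact K \<and> K \<subseteq> X \<longrightarrow>
      (\<exists>C. \<forall>\<^sub>F t in at_right 0. \<forall>x\<in>K. norm (g (x, t)) \<le> C * h t))"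

definition boundary_trace ::
  "('a::euclidean_space \<times> real \<Rightarrow> complex) \<Rightarrow> ('a \<Rightarrow> complex) \<Rightarrow> complex" where
  "boundary_trace f \<phi> = Lim (at_right 0) (\<lambda>t. LINT x|lborel. f (x, t) * \<phi> x)"

text \<open>The limit defining \<open>boundary_trace f\<close> exists in the space of distributions on \<open>X\<close>.\<close>

definition has_boundary_trace ::
  "'a::euclidean_space set \<Rightarrow> ('a \<times> real \<Rightarrow> complex) \<Rightarrow> bool" where
  "has_boundary_trace X f \<longleftrightarrow> distribution X (boundary_trace f) \<and>
    (\<forall>\<phi>\<in>test_functions X.
      ((\<lambda>t. LINT x|lborel. f (x, t) * \<phi> x) \<longlongrightarrow> boundary_trace f \<phi>) (at_right 0))"

end

theory Submission
  imports Defs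
begin

text \<open>
  The proof pairs \<open>f\<close> with functions that are adapted to \<open>L\<close> and follows the pairing from a fixed
  \<open>T > 0\<close> down to \<open>t = 0\<close>. Let \<open>\<psi>\<close> be smooth with compact support in \<open>x\<close>, let \<open>E\<close> be a \<open>C\<^sup>1\<close> function, and
  put \<open>I(t) = \<integral> f(x,t) \<psi>(x,t) E(x,t) dx\<close>. Integration by parts in \<open>x\<close> gives
  \<open>I' = \<integral> (L f) \<psi> E + \<integral> f (L' \<psi>) E + \<integral> f \<psi> (L E)\<close> with \<open>L' \<psi> = \<partial>\<^sub>t \<psi> + \<Sum>\<^sub>j \<partial>\<^sub>j (a\<^sub>j \<psi>)\<close>. If the first and
  the last integral are bounded, then the derivative of a pairing is, up to a bounded term, a pairing
  of the same kind. So a bound \<open>O(t\<^sup>-\<^sup>q)\<close> that holds for every \<open>\<psi>\<close> improves by integration to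
  \<open>O(t\<^sup>1\<^sup>-\<^sup>q)\<close> for every \<open>\<psi>\<close>, at the price of one more derivative of \<open>\<psi>\<close>; after finitely many rounds
  the pairing is bounded up to \<open>t = 0\<close>. This is \<open>pairing_gain\<close>, and both halves of the theorem are
  instances of it.

  For the existence of the trace take \<open>E = 1\<close>. The bound to start from is the growth condition on \<open>f\<close>.
  The conclusion is that pairings are bounded by finitely many derivatives of \<open>\<psi>\<close>. As this also applies
  to \<open>L' \<psi>\<close>, the derivative \<open>I'\<close> is bounded, so \<open>I\<close> has a limit at \<open>0\<close> (\<open>smooth_pairing\<close>,
  \<open>has_trace\<close>).

  For the wave front set take \<open>E = exp (-i \<xi> \<cdot> Z)\<close>, where the components of \<open>Z(x,t) = x + O(t)\<close> are
  polynomials in \<open>t\<close> that solve \<open>L Z = 0\<close> up to a high power of \<open>t\<close>. Since \<open>a\<close> vanishes to order \<open>l\<close>, the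
  recursion for the coefficients gives \<open>Z = x - t\<^sup>l\<^sup>+\<^sup>1/(l+1)! \<partial>\<^sub>t\<^sup>l a(x,0) + O(t\<^sup>l\<^sup>+\<^sup>2)\<close>. The positivity
  assumption then yields \<open>\<bar>E\<bar> \<le> exp (-c t\<^sup>l\<^sup>+\<^sup>1 \<bar>\<xi>\<bar>)\<close> for \<open>x\<close> near \<open>x\<^sub>0\<close>, \<open>\<xi>\<close> in a cone around \<open>\<xi>\<^sub>0\<close> and
  small \<open>t\<close>. Such an exponential trades powers of \<open>t\<close> for decay in \<open>\<xi>\<close>: the product \<open>f E\<close> is
  \<open>O(t\<^sup>-\<^sup>m (1 + \<bar>\<xi>\<bar>)\<^sup>-\<^sup>r)\<close> with \<open>m = N + (l+1) r\<close>. Now \<open>pairing_gain\<close> removes the power of \<open>t\<close> and keeps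
  the decay in \<open>\<xi>\<close> (\<open>fourier_decay\<close>). At \<open>t = 0\<close> the function \<open>E\<close> is \<open>exp (-i x \<cdot> \<xi>)\<close>, and the limit of the
  pairing is the Fourier transform of \<open>\<phi> bf\<close> (\<open>oscillation_pairing_tendsto\<close>); as \<open>r\<close> is arbitrary, it
  is rapidly decreasing on the cone.
\<close>

section \<open>Calculus of functions with derivatives within a set\<close>

text \<open>
  The condition under which a derivative within \<open>S\<close> is unique. It holds for open sets and also for the
  one-sided neighborhood of \<open>t = 0\<close> on which the coefficients are smooth, so that one calculus serves
  both.
\<close>

definition unique_deriv_set :: "'a::euclidean_space set \<Rightarrow> bool" where
  "unique_deriv_set S \<longleftrightarrow>
    (\<forall>x\<in>S. \<forall>i\<in>Basis. \<forall>e>0. \<exists>d. 0 < \<bar>d\<bar> \<and> \<bar>d\<bar> < e \<and> x + d *\<^sub>R i \<in> S)"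

lemma unique_deriv_set_open:
  assumes "open S" shows "unique_deriv_set S"
  unfolding unique_deriv_set_def
proof (intro ballI allI impI)
  fix x i :: 'a and e :: real
  assume x: "x \<in> S" and i: "i \<in> Basis" and e: "e > 0"
  obtain d where d: "d > 0" "ball x d \<subseteq> S" using assms x by (meson openE)
  have "x + (min d e / 2) *\<^sub>R i \<in> ball x d"
    using d e i by (simp add: dist_norm)
  then show "\<exists>d. 0 < \<bar>d\<bar> \<and> \<bar>d\<bar> < e \<and> x + d *\<^sub>R i \<in> S"
    using d e by (intro exI[of _ "min d e / 2"]) auto
qed

lemma dir_deriv_eqI:
  assumes "unique_deriv_set S" "x \<in> S" "(f has_derivative f') (at x within S)"
  shows "dir_deriv S v f x = f' v"
proof -
  have "f differentiable (at x within S)" using assms(3) differentiable_def by blast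
  then have "(f has_derivative frechet_derivative f (at x within S)) (at x within S)"
    using frechet_derivative_works by blast
  then have "frechet_derivative f (at x within S) = f'"
    by (rule frechet_derivative_unique_within[OF _ assms(3)])
      (use assms(1,2) in \<open>auto simp: unique_deriv_set_def\<close>)
  then show ?thesis by (simp add: dir_deriv_def)
qed

lemma has_derivative_dir_deriv:
  assumes "f differentiable_on S" "x \<in> S"
  shows "(f has_derivative (\<lambda>v. dir_deriv S v f x)) (at x within S)"
  using assms unfolding dir_deriv_def differentiable_on_def
  by (simp add: frechet_derivative_works[symmetric])

lemma dir_deriv_cong:
  assumes "\<And>x. x \<in> S \<Longrightarrow> f x = g x" "x \<in> S"
  shows "dir_deriv S v f x = dir_deriv S v g x"
proof -
  have "(f has_derivative f') (at x within S) = (g has_derivative f') (at x within S)" for f'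
    using assms by (auto intro: has_derivative_transform[rotated 2])
  then show ?thesis unfolding dir_deriv_def frechet_derivative_def by simp
qed

lemma Ck_on_cong:
  assumes "\<And>x. x \<in> S \<Longrightarrow> f x = g x"
  shows "Ck_on k S f = Ck_on k S g"
  using assms
proof (induction k arbitrary: f g)
  case 0
  then show ?case by (auto cong: continuous_on_cong)
next
  case (Suc k)
  have "f differentiable_on S \<longleftrightarrow> g differentiable_on S"
    using Suc.prems by (auto simp: differentiable_on_def intro: differentiable_transform_within[where d = 1])
  moreover have "Ck_on k S (dir_deriv S v f) = Ck_on k S (dir_deriv S v g)" for v
    by (intro Suc.IH dir_deriv_cong Suc.prems)
  ultimately show ?case by simp
qed

lemma Ck_on_SucD: "Ck_on (Suc k) S f \<Longrightarrow> Ck_on k S f"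
proof (induction k arbitrary: f)
  case 0
  then show ?case by (auto simp: differentiable_imp_continuous_on)
next
  case (Suc k)
  have "f differentiable_on S" "\<And>v. v \<in> Basis \<Longrightarrow> Ck_on (Suc k) S (dir_deriv S v f)"
    using Suc.prems unfolding Ck_on.simps(2)[of "Suc k"] by blast+
  then show ?case by (subst Ck_on.simps(2)) (use Suc.IH in blast)
qed

lemma Ck_on_mono: "Ck_on k S f \<Longrightarrow> j \<le> k \<Longrightarrow> Ck_on j S f"
proof (induction k)
  case (Suc k) then show ?case by (metis Ck_on_SucD le_Suc_eq)
qed simp

lemma Ck_on_imp_continuous_on: "Ck_on k S f \<Longrightarrow> continuous_on S f"
  using Ck_on_mono[of k S f 0] by simp

lemma Ck_on_const:
  fixes c :: "'b::real_normed_vector"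
  shows "unique_deriv_set S \<Longrightarrow> Ck_on k S (\<lambda>x. c)"
proof (induction k arbitrary: c)
  case (Suc k)
  have "Ck_on k S (dir_deriv S v (\<lambda>x. c)) = Ck_on k S (\<lambda>x. 0::'b)" for v
    by (rule Ck_on_cong, rule dir_deriv_eqI[OF Suc.prems, where f' = "\<lambda>_. 0"]) auto
  then show ?case using Suc by simp
qed simp

lemma dir_deriv_add:
  assumes "unique_deriv_set S" "f differentiable_on S" "g differentiable_on S" "x \<in> S"
  shows "dir_deriv S v (\<lambda>x. f x + g x) x = dir_deriv S v f x + dir_deriv S v g x"
  by (rule dir_deriv_eqI[OF assms(1,4)])
    (intro has_derivative_add has_derivative_dir_deriv assms)

lemma dir_deriv_mult:
  fixes f g :: "_ \<Rightarrow> 'b::real_normed_algebra"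
  assumes "unique_deriv_set S" "f differentiable_on S" "g differentiable_on S" "x \<in> S"
  shows "dir_deriv S v (\<lambda>x. f x * g x) x = f x * dir_deriv S v g x + dir_deriv S v f x * g x"
  by (rule dir_deriv_eqI[OF assms(1,4)])
    (intro has_derivative_mult has_derivative_dir_deriv assms)

lemma dir_deriv_sum:
  assumes "unique_deriv_set S" "\<And>i. i \<in> I \<Longrightarrow> f i differentiable_on S" "x \<in> S"
  shows "dir_deriv S v (\<lambda>x. \<Sum>i\<in>I. f i x) x = (\<Sum>i\<in>I. dir_deriv S v (f i) x)"
  by (rule dir_deriv_eqI[OF assms(1,3)])
    (intro has_derivative_sum has_derivative_dir_deriv assms)

lemma dir_deriv_linear:
  assumes "unique_deriv_set S" "f differentiable_on S" "x \<in> S" "bounded_linear h"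
  shows "dir_deriv S v (\<lambda>x. h (f x)) x = h (dir_deriv S v f x)"
  by (rule dir_deriv_eqI[OF assms(1,3)])
    (intro bounded_linear.has_derivative[OF assms(4)] has_derivative_dir_deriv assms)

lemma Ck_on_add:
  assumes "unique_deriv_set S" "Ck_on k S f" "Ck_on k S g"
  shows "Ck_on k S (\<lambda>x. f x + g x)"
  using assms(2,3)
proof (induction k arbitrary: f g)
  case (Suc k)
  then have d: "f differentiable_on S" "g differentiable_on S" by auto
  have "Ck_on k S (dir_deriv S v (\<lambda>x. f x + g x))
      = Ck_on k S (\<lambda>x. dir_deriv S v f x + dir_deriv S v g x)" for v
    by (intro Ck_on_cong dir_deriv_add assms d)
  then show ?case using Suc by (auto simp: differentiable_on_add)
qed (auto intro: continuous_intros)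

lemma Ck_on_mult:
  fixes f g :: "_ \<Rightarrow> 'b::real_normed_algebra"
  assumes "unique_deriv_set S" "Ck_on k S f" "Ck_on k S g"
  shows "Ck_on k S (\<lambda>x. f x * g x)"
  using assms(2,3)
proof (induction k arbitrary: f g)
  case (Suc k)
  then have d: "f differentiable_on S" "g differentiable_on S" by auto
  have "Ck_on k S (dir_deriv S v (\<lambda>x. f x * g x))
      = Ck_on k S (\<lambda>x. f x * dir_deriv S v g x + dir_deriv S v f x * g x)" for v
    by (intro Ck_on_cong dir_deriv_mult assms d)
  moreover have "Ck_on k S f" "Ck_on k S g"
    using Suc.prems by (auto intro!: Ck_on_SucD simp del: Ck_on.simps)
  ultimately show ?case using Suc d
    by (auto simp: differentiable_on_mult intro!: Ck_on_add assms)
qed (auto intro: continuous_intros)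

lemma Ck_on_sum:
  assumes "unique_deriv_set S" "\<And>i. i \<in> I \<Longrightarrow> Ck_on k S (f i)"
  shows "Ck_on k S (\<lambda>x. \<Sum>i\<in>I. f i x)"
proof (cases "finite I")
  case True
  then show ?thesis using assms(2)
    by (induction I rule: finite_induct) (auto intro: Ck_on_const Ck_on_add assms(1))
qed (simp add: Ck_on_const assms(1))

lemma Ck_on_power:
  fixes f :: "_ \<Rightarrow> 'b::real_normed_algebra_1"
  assumes "unique_deriv_set S" "Ck_on k S f"
  shows "Ck_on k S (\<lambda>x. f x ^ i)"
  by (induction i) (auto intro: Ck_on_const Ck_on_mult assms)

lemma Ck_on_linear:
  assumes "unique_deriv_set S" "bounded_linear h" "Ck_on k S f"
  shows "Ck_on k S (\<lambda>x. h (f x))"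
  using assms(3)
proof (induction k arbitrary: f)
  case 0
  then show ?case by (simp add: bounded_linear.continuous_on[OF assms(2)])
next
  case (Suc k)
  then have d: "f differentiable_on S" by auto
  have "Ck_on k S (dir_deriv S v (\<lambda>x. h (f x))) = Ck_on k S (\<lambda>x. h (dir_deriv S v f x))" for v
    by (intro Ck_on_cong dir_deriv_linear assms d)
  moreover have "(\<lambda>x. h (f x)) differentiable_on S"
    using d bounded_linear.has_derivative[OF assms(2)]
    unfolding differentiable_on_def differentiable_def by blast
  ultimately show ?case using Suc by auto
qed

lemma dir_deriv_compose_linear:
  assumes "unique_deriv_set T" "bounded_linear A" "A ` T \<subseteq> S" "f differentiable_on S" "x \<in> T"
  shows "((\<lambda>x. f (A x)) has_derivative (\<lambda>v. dir_deriv S (A v) f (A x))) (at x within T)"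
    and "dir_deriv T v (\<lambda>x. f (A x)) x = dir_deriv S (A v) f (A x)"
proof -
  have "(f has_derivative (\<lambda>v. dir_deriv S v f (A x))) (at (A x) within A ` T)"
    by (rule has_derivative_subset[OF has_derivative_dir_deriv]) (use assms in auto)
  then show *: "((\<lambda>x. f (A x)) has_derivative (\<lambda>v. dir_deriv S (A v) f (A x))) (at x within T)"
    using has_derivative_in_compose[OF bounded_linear_imp_has_derivative[OF assms(2)], of f _ x T]
    by simp
  show "dir_deriv T v (\<lambda>x. f (A x)) x = dir_deriv S (A v) f (A x)"
    by (rule dir_deriv_eqI[OF assms(1,5) *])
qed

text \<open>
  The condition on \<open>A\<close> is met by the projection to \<open>x\<close> and by the embedding of \<open>t = 0\<close>. It is needed
  because \<open>Ck_on\<close> speaks of derivatives along basis vectors only.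
\<close>

lemma Ck_on_compose_linear:
  fixes f :: "'a::euclidean_space \<Rightarrow> 'b::real_normed_vector"
  assumes "unique_deriv_set T" "bounded_linear A" "A ` T \<subseteq> S"
    and A: "\<And>v. v \<in> Basis \<Longrightarrow> A v \<in> Basis \<or> A v = 0"
    and "Ck_on k S f"
  shows "Ck_on k T (\<lambda>x. f (A x))"
  using assms(5)
proof (induction k arbitrary: f)
  case 0
  then show ?case
    using continuous_on_compose2[OF _ linear_continuous_on[OF assms(2)] assms(3), of f] by simp
next
  case (Suc k)
  then have d: "f differentiable_on S" by auto
  have diff: "(\<lambda>x. f (A x)) differentiable_on T"
    using dir_deriv_compose_linear(1)[OF assms(1-3) d]
    unfolding differentiable_on_def differentiable_def by blast
  have "Ck_on k T (dir_deriv T v (\<lambda>x. f (A x)))" if v: "v \<in> Basis" for v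
  proof -
    have eq: "Ck_on k T (dir_deriv T v (\<lambda>x. f (A x))) = Ck_on k T (\<lambda>x. dir_deriv S (A v) f (A x))"
      by (intro Ck_on_cong dir_deriv_compose_linear(2) assms d)
    show ?thesis
    proof (cases "A v = 0")
      case True
      have "Ck_on k T (\<lambda>x. dir_deriv S (A v) f (A x)) = Ck_on k T (\<lambda>x. 0::'b)"
      proof (rule Ck_on_cong)
        fix x assume "x \<in> T"
        then have "A x \<in> S" using assms(3) by auto
        then show "dir_deriv S (A v) f (A x) = 0"
          using has_derivative_dir_deriv[OF d] True
          by (metis bounded_linear.linear has_derivative_bounded_linear linear_0)
      qed
      then show ?thesis using eq Ck_on_const[OF assms(1)] by metis
    next
      case False
      then show ?thesis using eq A[OF v] Suc by auto
    qed
  qed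
  then show ?case using diff by simp
qed

lemma Ck_on_subset:
  assumes "unique_deriv_set T" "T \<subseteq> S" "Ck_on k S f"
  shows "Ck_on k T f"
proof (rule Ck_on_compose_linear[where A = "\<lambda>x. x" and S = S])
  show "(\<lambda>x. x) ` T \<subseteq> S" using assms by simp
qed (use assms(1,3) bounded_linear_ident in auto)

lemma dir_deriv_open_subset:
  assumes "open T" "T \<subseteq> S" "x \<in> T"
  shows "dir_deriv T v f x = dir_deriv S v f x"
proof -
  have "at x within S = at x" by (rule at_within_open_subset[OF assms(3,1,2)])
  moreover have "at x within T = at x" by (rule at_within_open[OF assms(3,1)])
  ultimately show ?thesis by (simp add: dir_deriv_def)
qed

lemma dir_deriv_locally_zero:
  fixes V :: "'a::euclidean_space set"
  assumes "open V" "closed C" "\<And>p. p \<in> V \<Longrightarrow> p \<notin> C \<Longrightarrow> f p = 0" "p \<in> V" "p \<notin> C"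
  shows "dir_deriv V v f p = 0"
proof -
  have o: "open (V - C)" using assms by (simp add: open_Diff)
  have "dir_deriv V v f p = dir_deriv (V - C) v f p"
    by (rule dir_deriv_open_subset[symmetric]) (use assms(4,5) o in auto)
  also have "\<dots> = dir_deriv (V - C) v (\<lambda>_. 0) p"
    by (rule dir_deriv_cong) (use assms(3,4,5) in auto)
  also have "\<dots> = 0"
    by (rule dir_deriv_eqI[OF unique_deriv_set_open[OF o], where f' = "\<lambda>_. 0"]) (use assms(4,5) in auto)
  finally show ?thesis .
qed

lemma has_derivative_exp_dir_deriv:
  fixes h :: "'a::euclidean_space \<Rightarrow> complex"
  assumes "h differentiable_on S" "x \<in> S"
  shows "((\<lambda>x. exp (h x)) has_derivative (\<lambda>v. exp (h x) * dir_deriv S v h x)) (at x within S)"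
  using has_derivative_compose[OF has_derivative_dir_deriv[OF assms]
      DERIV_exp[unfolded has_field_derivative_def]] by simp

lemma dir_deriv_exp:
  fixes h :: "'a::euclidean_space \<Rightarrow> complex"
  assumes "unique_deriv_set S" "h differentiable_on S" "x \<in> S"
  shows "dir_deriv S v (\<lambda>x. exp (h x)) x = exp (h x) * dir_deriv S v h x"
  by (rule dir_deriv_eqI[OF assms(1,3) has_derivative_exp_dir_deriv[OF assms(2,3)]])

lemma Ck_on_exp:
  fixes g :: "'a::euclidean_space \<Rightarrow> complex"
  assumes "unique_deriv_set S" "Ck_on k S g"
  shows "Ck_on k S (\<lambda>x. exp (g x))"
  using assms(2)
proof (induction k)
  case 0 then show ?case by (auto intro: continuous_intros)
next
  case (Suc k)
  then have d: "g differentiable_on S" by auto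
  have "Ck_on k S (dir_deriv S v (\<lambda>x. exp (g x)))
      = Ck_on k S (\<lambda>x. exp (g x) * dir_deriv S v g x)" for v
    by (intro Ck_on_cong dir_deriv_exp assms(1) d)
  moreover have "Ck_on k S (\<lambda>x. exp (g x))" using Suc Ck_on_SucD by blast
  moreover have "(\<lambda>x. exp (g x)) differentiable_on S"
    using has_derivative_exp_dir_deriv[OF d] unfolding differentiable_on_def differentiable_def by blast
  ultimately show ?case using Suc.prems by (auto intro: Ck_on_mult assms(1))
qed

text \<open>
  A bound for all derivatives of order at most \<open>k\<close> on \<open>Q\<close>. The set \<open>V\<close> on which the derivatives are taken
  is open, while \<open>Q\<close> may accumulate at its boundary: later \<open>V\<close> lies in \<open>t > 0\<close> and \<open>Q = K \<times> {0<..T}\<close>.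
\<close>

section \<open>Uniform bounds for derivatives\<close>

primrec derivs_le ::
  "nat \<Rightarrow> 'a::euclidean_space set \<Rightarrow> 'a set \<Rightarrow> ('a \<Rightarrow> 'b::real_normed_vector) \<Rightarrow> real \<Rightarrow> bool" where
  "derivs_le 0 V Q f B \<longleftrightarrow> (\<forall>p\<in>Q. norm (f p) \<le> B)"
| "derivs_le (Suc k) V Q f B \<longleftrightarrow>
    (\<forall>p\<in>Q. norm (f p) \<le> B) \<and> (\<forall>v\<in>Basis. derivs_le k V Q (dir_deriv V v f) B)"

lemma derivs_le_cong:
  assumes "Q \<subseteq> V" "\<And>x. x \<in> V \<Longrightarrow> f x = g x"
  shows "derivs_le k V Q f B = derivs_le k V Q g B"
  using assms(2)
proof (induction k arbitrary: f g)
  case 0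
  then show ?case using assms(1) by (auto simp: subset_iff)
next
  case (Suc k)
  have "derivs_le k V Q (dir_deriv V v f) B = derivs_le k V Q (dir_deriv V v g) B" for v
    by (intro Suc.IH dir_deriv_cong Suc.prems)
  moreover have "(\<forall>p\<in>Q. norm (f p) \<le> B) \<longleftrightarrow> (\<forall>p\<in>Q. norm (g p) \<le> B)"
    using assms(1) Suc.prems by (auto simp: subset_iff)
  ultimately show ?case by simp
qed

lemma derivs_le_bound: "derivs_le k V Q f B \<Longrightarrow> p \<in> Q \<Longrightarrow> norm (f p) \<le> B"
  by (cases k) auto

lemma derivs_le_SucD: "derivs_le (Suc k) V Q f B \<Longrightarrow> derivs_le k V Q f B"
proof (induction k arbitrary: f)
  case (Suc k)
  have "\<forall>p\<in>Q. norm (f p) \<le> B" "\<And>v. v \<in> Basis \<Longrightarrow> derivs_le (Suc k) V Q (dir_deriv V v f) B"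
    using Suc.prems unfolding derivs_le.simps(2)[of "Suc k"] by blast+
  then show ?case by (subst derivs_le.simps(2)) (use Suc.IH in blast)
qed simp

lemma derivs_le_mono: "derivs_le k V Q f A \<Longrightarrow> A \<le> B \<Longrightarrow> derivs_le k V Q f B"
  by (induction k arbitrary: f) (auto intro: order_trans)

lemma derivs_le_add:
  assumes "open V" "Q \<subseteq> V" "Ck_on k V f" "Ck_on k V g" "derivs_le k V Q f A" "derivs_le k V Q g B"
  shows "derivs_le k V Q (\<lambda>x. f x + g x) (A + B)"
  using assms(3-6)
proof (induction k arbitrary: f g)
  case 0
  then show ?case by (auto intro: norm_triangle_mono)
next
  case (Suc k)
  then have d: "f differentiable_on V" "g differentiable_on V" by auto
  have "derivs_le k V Q (dir_deriv V v (\<lambda>x. f x + g x)) (A + B)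
      = derivs_le k V Q (\<lambda>x. dir_deriv V v f x + dir_deriv V v g x) (A + B)" for v
    by (intro derivs_le_cong dir_deriv_add unique_deriv_set_open assms d)
  then show ?case using Suc by (auto intro: norm_triangle_mono)
qed

lemma derivs_le_mult:
  fixes f g :: "'a::euclidean_space \<Rightarrow> 'b::real_normed_algebra"
  assumes "open V" "Q \<subseteq> V" "0 \<le> A" "0 \<le> B"
    and "Ck_on k V f" "Ck_on k V g" "derivs_le k V Q f A" "derivs_le k V Q g B"
  shows "derivs_le k V Q (\<lambda>x. f x * g x) (2 ^ k * A * B)"
  using assms(5-8)
proof (induction k arbitrary: f g)
  case 0
  have "norm (f p * g p) \<le> A * B" if "p \<in> Q" for p
    using 0 that assms(3)
    by (intro order_trans[OF norm_mult_ineq] mult_mono) auto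
  then show ?case by simp
next
  case (Suc k)
  then have d: "f differentiable_on V" "g differentiable_on V" by auto
  note u = unique_deriv_set_open[OF assms(1)]
  have "norm (f p * g p) \<le> 2 ^ Suc k * A * B" if "p \<in> Q" for p
  proof -
    have "norm (f p * g p) \<le> A * B"
      using Suc.prems that assms(3) by (intro order_trans[OF norm_mult_ineq] mult_mono) auto
    also have "\<dots> \<le> 2 ^ Suc k * (A * B)"
      using mult_right_mono[of 1 "2 ^ Suc k" "A * B"] assms(3,4) one_le_power[of "2::real" "Suc k"] by simp
    finally show ?thesis by (simp add: mult.assoc)
  qed
  moreover have "derivs_le k V Q (dir_deriv V v (\<lambda>x. f x * g x)) (2 ^ Suc k * A * B)"
    if v: "v \<in> Basis" for v
  proof -
    have "derivs_le k V Q (dir_deriv V v (\<lambda>x. f x * g x)) (2 ^ Suc k * A * B)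
      = derivs_le k V Q (\<lambda>x. f x * dir_deriv V v g x + dir_deriv V v f x * g x) (2 ^ Suc k * A * B)"
      by (intro derivs_le_cong dir_deriv_mult u assms d)
    moreover have "derivs_le k V Q (\<lambda>x. f x * dir_deriv V v g x + dir_deriv V v f x * g x)
        (2 ^ k * A * B + 2 ^ k * A * B)"
      using Suc.prems v
      by (intro derivs_le_add assms Suc.IH Ck_on_mult u)
        (auto intro: Ck_on_SucD[of k] derivs_le_SucD[of k] simp del: Ck_on.simps derivs_le.simps
          dest: Ck_on.simps(2)[THEN iffD1] derivs_le.simps(2)[THEN iffD1])
    ultimately show ?thesis by (simp add: ac_simps)
  qed
  ultimately show ?case by simp
qed

lemma derivs_le_sum:
  fixes f :: "'i \<Rightarrow> 'a::euclidean_space \<Rightarrow> 'b::real_normed_vector"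
  assumes "open V" "Q \<subseteq> V" "finite I" "\<And>i. i \<in> I \<Longrightarrow> Ck_on k V (f i)"
    "\<And>i. i \<in> I \<Longrightarrow> derivs_le k V Q (f i) (B i)"
  shows "derivs_le k V Q (\<lambda>x. \<Sum>i\<in>I. f i x) (\<Sum>i\<in>I. B i)"
  using assms(3-5)
proof (induction I rule: finite_induct)
  case empty
  have "derivs_le k V Q (\<lambda>x. 0::'b) 0"
  proof (induction k)
    case (Suc k)
    have "derivs_le k V Q (dir_deriv V v (\<lambda>x. 0::'b)) 0 = derivs_le k V Q (\<lambda>x. 0::'b) 0" for v
      by (rule derivs_le_cong[OF assms(2)],
          rule dir_deriv_eqI[OF unique_deriv_set_open[OF assms(1)], where f' = "\<lambda>_. 0"]) auto
    then show ?case using Suc by simp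
  qed simp
  then show ?case by simp
next
  case (insert i I)
  then show ?case
    by (simp, intro derivs_le_add assms(1,2) Ck_on_sum unique_deriv_set_open) auto
qed

text \<open>
  Smoothness up to the boundary enters here: the derivatives within \<open>S\<close> are continuous on the compact
  set \<open>Q'\<close>, and on \<open>V\<close> they are the derivatives within \<open>V\<close>.
\<close>

lemma derivs_le_compact:
  assumes "open V" "V \<subseteq> S" "Q \<subseteq> V" "compact Q'" "Q \<subseteq> Q'" "Q' \<subseteq> S" "Ck_on k S f"
  shows "\<exists>B\<ge>0. derivs_le k V Q f B"
  using assms(7)
proof (induction k arbitrary: f)
  case 0
  then have "bounded (f ` Q')"
    using assms(4,6) by (meson compact_continuous_image compact_imp_bounded continuous_on_subset Ck_on.simps(1))
  then obtain B where "\<And>p. p \<in> Q' \<Longrightarrow> norm (f p) \<le> B" unfolding bounded_iff by auto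
  then have "derivs_le 0 V Q f (max B 0)" using assms(5) by (auto simp: le_max_iff_disj)
  then show ?case by (intro exI[of _ "max B 0"]) auto
next
  case (Suc k)
  obtain B where B: "B \<ge> 0" "derivs_le k V Q f B" using Suc Ck_on_SucD by blast
  have "\<exists>B\<ge>0. derivs_le k V Q (dir_deriv V v f) B" if "v \<in> Basis" for v
  proof -
    have "\<exists>B\<ge>0. derivs_le k V Q (dir_deriv S v f) B" using Suc that by auto
    moreover have "derivs_le k V Q (dir_deriv S v f) B = derivs_le k V Q (dir_deriv V v f) B" for B
      by (rule derivs_le_cong[OF assms(3)]) (metis dir_deriv_open_subset assms(1,2))
    ultimately show ?thesis by simp
  qed
  then obtain C where C: "\<And>v. v \<in> Basis \<Longrightarrow> C v \<ge> 0" "\<And>v. v \<in> Basis \<Longrightarrow> derivs_le k V Q (dir_deriv V v f) (C v)"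
    by metis
  let ?B = "B + (\<Sum>v\<in>Basis. C v)"
  have "C v \<le> ?B" if "v \<in> Basis" for v
    using C(1) B(1) that member_le_sum[of v Basis C] by fastforce
  moreover have "B \<le> ?B" using C(1) by (simp add: sum_nonneg)
  moreover have "\<forall>p\<in>Q. norm (f p) \<le> B" using derivs_le_bound[OF B(2)] by blast
  ultimately have "derivs_le (Suc k) V Q f ?B"
    using C(2) by (auto intro: derivs_le_mono order_trans)
  then show ?case using B(1) C(1) by (intro exI[of _ ?B]) (simp add: sum_nonneg)
qed

section \<open>Integrals over time slices\<close>

definition slice_integral ::
  "'a::euclidean_space set \<Rightarrow> ('a \<times> real \<Rightarrow> complex) \<Rightarrow> real \<Rightarrow> complex" where
  "slice_integral K g t = (LINT x:K|lborel. g (x, t))"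

text \<open>
  The functions to be integrated live on an open set \<open>V\<close> and vanish off \<open>K\<close>; extension by zero makes
  them continuous, or differentiable, in all of space. Functions are total, so without this their values
  off \<open>V\<close> would be arbitrary.
\<close>

definition extend0 :: "'a set \<Rightarrow> ('a \<times> real \<Rightarrow> complex) \<Rightarrow> 'a \<times> real \<Rightarrow> complex" where
  "extend0 K g p = (if fst p \<in> K then g p else 0)"

lemma slice_integral_extend0: "slice_integral K g t = (LINT x|lborel. extend0 K g (x, t))"
  unfolding slice_integral_def set_lebesgue_integral_def extend0_def
  by (rule Bochner_Integration.integral_cong) auto

lemma lborel_integral_eq_cbox:
  fixes h :: "'a::euclidean_space \<Rightarrow> complex"
  assumes "continuous_on UNIV h" "\<And>x. x \<notin> cbox c d \<Longrightarrow> h x = 0"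
  shows "integrable lborel h" "(LINT x|lborel. h x) = integral (cbox c d) h"
proof -
  have eq: "(\<lambda>x. indicator (cbox c d) x *\<^sub>R h x) = h"
    using assms(2) by (auto simp: indicator_def)
  show i: "integrable lborel h"
    using borel_integrable_compact[OF compact_cbox continuous_on_subset[OF assms(1)], of c d] eq by simp
  have "set_integrable lborel (cbox c d) h"
    unfolding set_integrable_def eq by (rule i)
  from set_borel_integral_eq_integral(2)[OF this]
  show "(LINT x|lborel. h x) = integral (cbox c d) h"
    unfolding set_lebesgue_integral_def eq .
qed

lemma slice_integral_norm_le:
  assumes "compact K" "\<And>x. x \<in> K \<Longrightarrow> norm (g (x, t)) \<le> B" "0 \<le> B"
  shows "norm (slice_integral K g t) \<le> B * measure lborel K"
proof -
  have fin: "emeasure lborel K < \<infinity>" by (rule emeasure_bounded_finite[OF compact_imp_bounded[OF assms(1)]])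
  have "norm (slice_integral K g t) \<le> (LINT x|lborel. norm (indicator K x *\<^sub>R g (x, t)))"
    unfolding slice_integral_def set_lebesgue_integral_def by (rule integral_norm_bound)
  also have "\<dots> \<le> (LINT x|lborel. B * indicator K x)"
    using assms fin borel_compact[OF assms(1)]
    by (intro integral_mono') (auto simp: indicator_def intro!: integrable_real_indicator[of K, unfolded indicator_def] integrable_mult_right)
  also have "\<dots> = B * measure lborel K" using assms(1) by simp
  finally show ?thesis .
qed

context
  fixes V :: "('a::euclidean_space \<times> real) set" and K :: "'a set" and T0 :: real
  assumes V: "open V" and K: "compact K" and KV: "K \<times> {0<..<T0} \<subseteq> V"
begin

lemma continuous_on_extend0:
  assumes "continuous_on V g" "\<And>p. p \<in> V \<Longrightarrow> fst p \<notin> K \<Longrightarrow> g p = 0"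
  shows "continuous_on (UNIV \<times> {0<..<T0}) (extend0 K g)"
proof -
  have "closed (K \<times> (UNIV::real set))" using K by (simp add: closed_Times compact_imp_closed)
  then have o: "open (- (K \<times> (UNIV::real set)))" by (rule open_Compl)
  have 1: "continuous_on V (extend0 K g)"
    using assms(1) by (rule continuous_on_cong[THEN iffD1, rotated -1])
      (use assms(2) in \<open>auto simp: extend0_def\<close>)
  have "continuous_on (- (K \<times> (UNIV::real set))) (\<lambda>_. 0::complex)" by simp
  then have 2: "continuous_on (- (K \<times> (UNIV::real set))) (extend0 K g)"
    by (rule continuous_on_cong[THEN iffD1, rotated -1])
      (auto simp: extend0_def)
  have "continuous_on (V \<union> - (K \<times> (UNIV::real set))) (extend0 K g)"
    by (rule continuous_on_open_Un[OF V o 1 2])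
  then show ?thesis by (rule continuous_on_subset) (use KV in auto)
qed

lemma has_derivative_extend0:
  assumes "g differentiable_on V" "\<And>p. p \<in> V \<Longrightarrow> fst p \<notin> K \<Longrightarrow> g p = 0"
    and p: "p \<in> UNIV \<times> {0<..<T0}"
  shows "(extend0 K g has_derivative (\<lambda>v. extend0 K (dir_deriv V v g) p)) (at p)"
proof (cases "fst p \<in> K")
  case True
  then have pV: "p \<in> V" using p KV by (cases p) auto
  have "(g has_derivative (\<lambda>v. dir_deriv V v g p)) (at p)"
    using has_derivative_dir_deriv[OF assms(1) pV] at_within_open[OF pV V] by simp
  then have "(extend0 K g has_derivative (\<lambda>v. dir_deriv V v g p)) (at p)"
    by (rule has_derivative_transform_within_open[OF _ V pV])
      (use assms(2) in \<open>auto simp: extend0_def\<close>)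
  then show ?thesis using True by (simp add: extend0_def)
next
  case False
  have "closed (K \<times> (UNIV::real set))" using K by (simp add: closed_Times compact_imp_closed)
  then have o: "open (- (K \<times> (UNIV::real set)))" by (rule open_Compl)
  have "((\<lambda>_. 0::complex) has_derivative (\<lambda>v. 0)) (at p)" by simp
  then have "(extend0 K g has_derivative (\<lambda>v. 0)) (at p)"
    by (rule has_derivative_transform_within_open[OF _ o])
      (use False in \<open>auto simp: extend0_def mem_Times_iff\<close>)
  then show ?thesis using False by (simp add: extend0_def)
qed

lemma extend0_deriv_scale:
  assumes "g differentiable_on V" "\<And>p. p \<in> V \<Longrightarrow> fst p \<notin> K \<Longrightarrow> g p = 0"
    and p: "p \<in> UNIV \<times> {0<..<T0}"
  shows "extend0 K (dir_deriv V (r *\<^sub>R v) g) p = r *\<^sub>R extend0 K (dir_deriv V v g) p"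
  using linear_scale[OF has_derivative_linear[OF has_derivative_extend0[OF assms]]] .

lemma dir_deriv_support:
  assumes "\<And>p. p \<in> V \<Longrightarrow> fst p \<notin> K \<Longrightarrow> g p = 0" "p \<in> V" "fst p \<notin> K"
  shows "dir_deriv V v g p = (0::complex)"
proof (rule dir_deriv_locally_zero[OF V])
  show "closed (K \<times> (UNIV::real set))" using K by (simp add: closed_Times compact_imp_closed)
qed (use assms in \<open>auto simp: mem_Times_iff\<close>)

lemma slice_integral_eq_cbox:
  assumes "continuous_on V g" "\<And>p. p \<in> V \<Longrightarrow> fst p \<notin> K \<Longrightarrow> g p = 0" "t \<in> {0<..<T0}" "K \<subseteq> cbox c d"
  shows "integrable lborel (\<lambda>x. extend0 K g (x, t))"
    and "slice_integral K g t = integral (cbox c d) (\<lambda>x. extend0 K g (x, t))"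
proof -
  have c: "continuous_on UNIV (\<lambda>x. extend0 K g (x, t))"
    by (rule continuous_on_compose2[OF continuous_on_extend0[OF assms(1,2)]])
      (use assms(3) in \<open>auto intro!: continuous_intros\<close>)
  have z: "extend0 K g (x, t) = 0" if "x \<notin> cbox c d" for x
    using that assms(4) by (auto simp: extend0_def)
  show "integrable lborel (\<lambda>x. extend0 K g (x, t))"
    by (rule lborel_integral_eq_cbox[OF c z])
  show "slice_integral K g t = integral (cbox c d) (\<lambda>x. extend0 K g (x, t))"
    unfolding slice_integral_extend0 by (rule lborel_integral_eq_cbox[OF c z])
qed

lemma slice_integral_add:
  assumes "continuous_on V g" "\<And>p. p \<in> V \<Longrightarrow> fst p \<notin> K \<Longrightarrow> g p = 0"
    "continuous_on V h" "\<And>p. p \<in> V \<Longrightarrow> fst p \<notin> K \<Longrightarrow> h p = 0" "t \<in> {0<..<T0}"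
  shows "slice_integral K (\<lambda>p. g p + h p) t = slice_integral K g t + slice_integral K h t"
proof -
  obtain c d where cd: "K \<subseteq> cbox c d" using bounded_subset_cbox_symmetric[OF compact_imp_bounded[OF K]] by metis
  have "(\<lambda>x. extend0 K (\<lambda>p. g p + h p) (x, t)) = (\<lambda>x. extend0 K g (x, t) + extend0 K h (x, t))"
    by (auto simp: extend0_def)
  then show ?thesis unfolding slice_integral_extend0
    using Bochner_Integration.integral_add[OF slice_integral_eq_cbox(1)[OF assms(1,2,5) cd] slice_integral_eq_cbox(1)[OF assms(3-5) cd]]
    by simp
qed

lemma slice_integral_sum:
  assumes "\<And>i. i \<in> I \<Longrightarrow> continuous_on V (g i)"
    "\<And>p i. i \<in> I \<Longrightarrow> p \<in> V \<Longrightarrow> fst p \<notin> K \<Longrightarrow> g i p = 0" "t \<in> {0<..<T0}"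
  shows "slice_integral K (\<lambda>p. \<Sum>i\<in>I. g i p) t = (\<Sum>i\<in>I. slice_integral K (g i) t)"
proof -
  obtain c d where cd: "K \<subseteq> cbox c d" using bounded_subset_cbox_symmetric[OF compact_imp_bounded[OF K]] by metis
  have "(\<lambda>x. extend0 K (\<lambda>p. \<Sum>i\<in>I. g i p) (x, t)) = (\<lambda>x. \<Sum>i\<in>I. extend0 K (g i) (x, t))"
    by (auto simp: extend0_def)
  then show ?thesis unfolding slice_integral_extend0
    using Bochner_Integration.integral_sum[of I lborel "\<lambda>i x. extend0 K (g i) (x, t)"]
      slice_integral_eq_cbox(1)[OF assms(1,2) assms(3) cd]
    by simp
qed

lemma slice_integral_cong:
  assumes "\<And>p. p \<in> V \<Longrightarrow> g p = h p" "t \<in> {0<..<T0}"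
  shows "slice_integral K g t = slice_integral K h t"
proof -
  have "extend0 K g (x, t) = extend0 K h (x, t)" for x
    using assms(1)[OF subsetD[OF KV, of "(x, t)"]] assms(2) by (auto simp: extend0_def)
  then show ?thesis unfolding slice_integral_extend0 by simp
qed

lemma slice_integral_has_derivative:
  assumes "Ck_on 1 V g" "\<And>p. p \<in> V \<Longrightarrow> fst p \<notin> K \<Longrightarrow> g p = 0" "t \<in> {0<..<T0}"
  shows "(slice_integral K g has_vector_derivative slice_integral K (dir_deriv V (0, 1) g) t) (at t)"
proof -
  obtain c d where cd: "K \<subseteq> cbox c d" using bounded_subset_cbox_symmetric[OF compact_imp_bounded[OF K]] by metis
  have d: "g differentiable_on V" and dc: "continuous_on V (dir_deriv V (0, 1) g)"
    and gc: "continuous_on V g"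
    using assms(1) Ck_on_imp_continuous_on[OF assms(1)]
    by (auto simp: Basis_prod_def)
  note ds = dir_deriv_support[OF assms(2)]
  have v: "((\<lambda>s. extend0 K g (x, s)) has_vector_derivative extend0 K (dir_deriv V (0, 1) g) (x, t)) (at t within {0<..<T0})"
    if "t \<in> {0<..<T0}" for x t
  proof -
    have p: "(x, t) \<in> UNIV \<times> {0<..<T0}" using that by simp
    have "((\<lambda>s. (x, s)) has_derivative (\<lambda>s. (0, s))) (at t within {0<..<T0})"
      by (auto intro!: derivative_eq_intros)
    from has_derivative_compose[OF this has_derivative_extend0[OF d assms(2) p]]
    have "((\<lambda>s. extend0 K g (x, s)) has_derivative (\<lambda>s. extend0 K (dir_deriv V (0, s) g) (x, t))) (at t within {0<..<T0})" by simp
    moreover have "extend0 K (dir_deriv V (0, s) g) (x, t) = s *\<^sub>R extend0 K (dir_deriv V (0, 1) g) (x, t)" for s :: real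
      using extend0_deriv_scale[OF d assms(2) p, of s "(0,1)"] by simp
    then have "(\<lambda>s. extend0 K (dir_deriv V (0, s) g) (x, t)) = (\<lambda>s. s *\<^sub>R extend0 K (dir_deriv V (0, 1) g) (x, t))"
      by (intro ext)
    ultimately show ?thesis unfolding has_vector_derivative_def by simp
  qed
  have I: "(\<lambda>x. extend0 K g (x, s)) integrable_on cbox c d" if "s \<in> {0<..<T0}" for s
    by (rule integrable_continuous, rule continuous_on_compose2[OF continuous_on_extend0[OF gc assms(2)]])
      (use that in \<open>auto intro!: continuous_intros\<close>)
  have C: "continuous_on ({0<..<T0} \<times> cbox c d) (\<lambda>(s, x). extend0 K (dir_deriv V (0, 1) g) (x, s))"
    unfolding case_prod_beta
    by (rule continuous_on_compose2[OF continuous_on_extend0[OF dc ds]])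
      (auto intro!: continuous_intros)
  have "((\<lambda>s. integral (cbox c d) (\<lambda>x. extend0 K g (x, s))) has_vector_derivative
      integral (cbox c d) (\<lambda>x. extend0 K (dir_deriv V (0, 1) g) (x, t))) (at t within {0<..<T0})"
    by (rule leibniz_rule_vector_derivative[where f = "\<lambda>s x. extend0 K g (x, s)" and
       fx = "\<lambda>s x. extend0 K (dir_deriv V (0, 1) g) (x, s)"]) (use v I C assms(3) in auto)
  then have "((\<lambda>s. integral (cbox c d) (\<lambda>x. extend0 K g (x, s))) has_vector_derivative
      slice_integral K (dir_deriv V (0, 1) g) t) (at t)"
    using slice_integral_eq_cbox(2)[OF dc ds assms(3) cd] at_within_open[OF assms(3)] by simp
  then show ?thesis
    by (rule has_vector_derivative_transform_within_open[where S = "{0<..<T0}"])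
      (use assms(3) slice_integral_eq_cbox(2)[OF gc assms(2) _ cd] in auto)
qed

text \<open>
  Integration by parts in \<open>x\<close>. By translation invariance the integral of \<open>g (x + s b, t)\<close> does not depend on
  \<open>s\<close>; its derivative at \<open>s = 0\<close> is the integral in question.
\<close>

lemma slice_integral_dir_deriv_zero:
  assumes "Ck_on 1 V g" "\<And>p. p \<in> V \<Longrightarrow> fst p \<notin> K \<Longrightarrow> g p = 0" "t \<in> {0<..<T0}" "b \<in> Basis"
  shows "slice_integral K (dir_deriv V (b, 0) g) t = 0"
proof -
  have d: "g differentiable_on V" and dc: "continuous_on V (dir_deriv V (b, 0) g)"
    and gc: "continuous_on V g"
    using assms(1,4) Ck_on_imp_continuous_on[OF assms(1)]
    by (auto simp: Basis_prod_def)
  note ds = dir_deriv_support[OF assms(2)]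
  \<comment> \<open>A box that contains all translates of the support with \<open>\<bar>s\<bar> \<le> 1\<close>.\<close>
  let ?K = "(\<lambda>(x, s). x - s *\<^sub>R b) ` (K \<times> {-1..1})"
  have "compact ?K" unfolding case_prod_beta
    by (intro compact_continuous_image continuous_intros compact_Times K) auto
  then obtain c d' where cd: "?K \<subseteq> cbox c d'" using bounded_subset_cbox_symmetric[OF compact_imp_bounded] by metis
  have KK: "K \<subseteq> ?K" by (auto intro!: image_eqI[where x = "(_, 0)"])
  let ?h = "\<lambda>s x. extend0 K g (x + s *\<^sub>R b, t)"
  have c0: "continuous_on UNIV (?h s)" for s
    by (rule continuous_on_compose2[OF continuous_on_extend0[OF gc assms(2)]])
      (use assms(3) in \<open>auto intro!: continuous_intros\<close>)
  have z: "?h s x = 0" if "x \<notin> cbox c d'" "s \<in> {-1<..<1}" for s x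
  proof -
    have "x + s *\<^sub>R b \<notin> K"
    proof
      assume "x + s *\<^sub>R b \<in> K"
      then have "(\<lambda>(x, s). x - s *\<^sub>R b) (x + s *\<^sub>R b, s) \<in> ?K" using that(2) by (intro imageI) auto
      then show False using cd that(1) by auto
    qed
    then show ?thesis by (simp add: extend0_def)
  qed
  have const: "integral (cbox c d') (?h s) = integral (cbox c d') (?h 0)" if "s \<in> {-1<..<1}" for s
  proof -
    have "(LINT x|lborel. ?h 0 x) = (LINT x|distr lborel borel ((+) (s *\<^sub>R b)). ?h 0 x)"
      by (simp add: lborel_distr_plus)
    also have "\<dots> = (LINT x|lborel. ?h 0 (s *\<^sub>R b + x))"
      by (rule integral_distr) (use borel_measurable_continuous_onI[OF c0[of 0]] in auto)
    also have "\<dots> = (LINT x|lborel. ?h s x)" by (simp add: add.commute)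
    finally have "(LINT x|lborel. ?h s x) = (LINT x|lborel. ?h 0 x)" by simp
    moreover have "(LINT x|lborel. ?h s x) = integral (cbox c d') (?h s)"
      by (rule lborel_integral_eq_cbox(2)[OF c0 z]) (use that in auto)
    moreover have "(LINT x|lborel. ?h 0 x) = integral (cbox c d') (?h 0)"
      by (rule lborel_integral_eq_cbox(2)[OF c0 z]) auto
    ultimately show ?thesis by simp
  qed
  let ?fx = "\<lambda>s x. extend0 K (dir_deriv V (b, 0) g) (x + s *\<^sub>R b, t)"
  have v: "((\<lambda>s. ?h s x) has_vector_derivative ?fx s x) (at s within {-1<..<1})" for x s
  proof -
    have p: "(x + s *\<^sub>R b, t) \<in> UNIV \<times> {0<..<T0}" using assms(3) by simp
    have "((\<lambda>s. (x + s *\<^sub>R b, t)) has_derivative (\<lambda>r. (r *\<^sub>R b, 0))) (at s within {-1<..<1})"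
      by (auto intro!: derivative_eq_intros)
    from has_derivative_compose[OF this has_derivative_extend0[OF d assms(2) p]]
    have "((\<lambda>s. ?h s x) has_derivative (\<lambda>r. extend0 K (dir_deriv V (r *\<^sub>R b, 0) g) (x + s *\<^sub>R b, t))) (at s within {-1<..<1})" by simp
    moreover have "extend0 K (dir_deriv V (r *\<^sub>R b, 0) g) (x + s *\<^sub>R b, t) = r *\<^sub>R ?fx s x" for r :: real
      using extend0_deriv_scale[OF d assms(2) p, of r "(b,0)"] by simp
    ultimately show ?thesis by (simp add: has_vector_derivative_def)
  qed
  have I: "?h s integrable_on cbox c d'" for s
    by (rule integrable_continuous, rule continuous_on_subset[OF c0]) auto
  have C: "continuous_on ({-1<..<1} \<times> cbox c d') (\<lambda>(s, x). ?fx s x)"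
    unfolding case_prod_beta
    by (rule continuous_on_compose2[OF continuous_on_extend0[OF dc ds]])
      (use assms(3) in \<open>auto intro!: continuous_intros\<close>)
  have "((\<lambda>s. integral (cbox c d') (?h s)) has_vector_derivative
      integral (cbox c d') (?fx 0)) (at 0 within {-1<..<1})"
    by (rule leibniz_rule_vector_derivative[where f = ?h and fx = ?fx]) (use v I C in auto)
  then have "((\<lambda>s. integral (cbox c d') (?h s)) has_vector_derivative
      integral (cbox c d') (?fx 0)) (at 0)"
    using at_within_open[of "0::real" "{-1<..<1}"] by simp
  moreover have "((\<lambda>s. integral (cbox c d') (?h s)) has_vector_derivative 0) (at 0)"
    by (rule has_vector_derivative_transform_within_open[OF has_vector_derivative_const[of "integral (cbox c d') (?h 0)"], where S = "{-1<..<1}"])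
      (use const in auto)
  ultimately have "integral (cbox c d') (?fx 0) = 0" by (rule vector_derivative_unique_at)
  then show ?thesis using slice_integral_eq_cbox(2)[OF dc ds assms(3) subset_trans[OF KK cd]] by simp
qed

end

section \<open>The transport identity and the gain of powers of time\<close>

text \<open>
  The negative of the formal transpose of \<open>L\<close>.
\<close>

definition transport_adjoint ::
  "((real^'n) \<times> real) set \<Rightarrow> ((real^'n) \<times> real \<Rightarrow> complex^'n) \<Rightarrow>
   ((real^'n) \<times> real \<Rightarrow> complex) \<Rightarrow> (real^'n) \<times> real \<Rightarrow> complex" where
  "transport_adjoint V a \<psi> p =
    dir_deriv V (0, 1) \<psi> p + (\<Sum>j\<in>UNIV. dir_deriv V (axis j 1, 0) (\<lambda>q. a q $ j * \<psi> q) p)"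

lemma axis_in_Basis: "(axis j 1 :: real^'n) \<in> Basis"
  by (simp add: axis_in_Basis_iff)

lemma space_direction_in_Basis [simp]: "(axis j 1 :: real^'n, 0::real) \<in> Basis"
  and time_direction_in_Basis [simp]: "(0 :: real^'n, 1::real) \<in> Basis"
  by (auto simp: Basis_prod_def axis_in_Basis)

lemma Ck_on_1I:
  assumes "Ck_on 1 V f" shows "f differentiable_on V" "continuous_on V f"
    "v \<in> Basis \<Longrightarrow> continuous_on V (dir_deriv V v f)"
  using assms Ck_on_imp_continuous_on[OF assms] by auto

text \<open>
  This is \<open>\<partial>\<^sub>t(f \<psi> E)\<close> written as \<open>(L f) \<psi> E + f (L' \<psi>) E + f \<psi> (L E)\<close> minus a divergence in \<open>x\<close>, which
  disappears on integration over a slice.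
\<close>

lemma transport_leibniz:
  fixes V :: "((real^'n) \<times> real) set"
  assumes V: "open V" and p: "p \<in> V"
    and d: "f differentiable_on V" "\<psi> differentiable_on V" "E differentiable_on V"
      "\<And>j. (\<lambda>q. a q $ j) differentiable_on V"
  shows "dir_deriv V (0, 1) (\<lambda>q. f q * \<psi> q * E q) p =
      vector_field_L V a f p * \<psi> p * E p + f p * transport_adjoint V a \<psi> p * E p
      + f p * \<psi> p * vector_field_L V a E p
      - (\<Sum>j\<in>UNIV. dir_deriv V (axis j 1, 0) (\<lambda>q. a q $ j * \<psi> q * (f q * E q)) p)"
proof -
  note u = unique_deriv_set_open[OF V]
  have fp: "(\<lambda>q. f q * \<psi> q) differentiable_on V" by (intro differentiable_on_mult d)
  have fE: "(\<lambda>q. f q * E q) differentiable_on V" by (intro differentiable_on_mult d)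
  have ap: "(\<lambda>q. a q $ j * \<psi> q) differentiable_on V" for j by (intro differentiable_on_mult d)
  define G where "G j = dir_deriv V (axis j 1, 0) (\<lambda>q. a q $ j * \<psi> q) p" for j
  have 1: "dir_deriv V (0, 1) (\<lambda>q. f q * \<psi> q * E q) p = f p * \<psi> p * dir_deriv V (0, 1) E p
      + (f p * dir_deriv V (0, 1) \<psi> p + dir_deriv V (0, 1) f p * \<psi> p) * E p"
    by (simp only: dir_deriv_mult[OF u fp d(3) p] dir_deriv_mult[OF u d(1,2) p])
  have 2: "dir_deriv V (axis j 1, 0) (\<lambda>q. a q $ j * \<psi> q * (f q * E q)) p =
      a p $ j * \<psi> p * (f p * dir_deriv V (axis j 1, 0) E p + dir_deriv V (axis j 1, 0) f p * E p)
      + G j * (f p * E p)" for j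
    by (simp only: dir_deriv_mult[OF u ap fE p] dir_deriv_mult[OF u d(1,3) p] G_def)
  show ?thesis
    unfolding vector_field_L_def transport_adjoint_def G_def[symmetric] 1 2
    by (simp add: algebra_simps sum.distrib sum_distrib_left)
qed

lemma vector_field_L_const:
  fixes V :: "((real^'n) \<times> real) set"
  assumes "open V" "p \<in> V"
  shows "vector_field_L V a (\<lambda>_. c) p = 0"
proof -
  have "dir_deriv V v (\<lambda>_. c) p = 0" for v
    by (rule dir_deriv_eqI[OF unique_deriv_set_open[OF assms(1)] assms(2), where f' = "\<lambda>_. 0"]) simp
  then show ?thesis by (simp add: vector_field_L_def)
qed

lemma transport_adjoint_Ck_on:
  fixes V :: "((real^'n) \<times> real) set"
  assumes V: "open V" and a: "\<And>j. Ck_on (Suc k) V (\<lambda>q. a q $ j)" and \<psi>: "Ck_on (Suc k) V \<psi>"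
  shows "Ck_on k V (transport_adjoint V a \<psi>)"
proof -
  note u = unique_deriv_set_open[OF V]
  have "Ck_on (Suc k) V (\<lambda>q. a q $ j * \<psi> q)" for j by (intro Ck_on_mult u a \<psi>)
  then have "Ck_on k V (\<lambda>p. dir_deriv V (0, 1) \<psi> p +
      (\<Sum>j\<in>UNIV. dir_deriv V (axis j 1, 0) (\<lambda>q. a q $ j * \<psi> q) p))"
    using \<psi> by (intro Ck_on_add Ck_on_sum u) auto
  then show ?thesis unfolding transport_adjoint_def[abs_def] .
qed

lemma transport_adjoint_derivs_le:
  fixes V :: "((real^'n) \<times> real) set"
  assumes V: "open V" "Q \<subseteq> V"
    and a: "\<And>j. Ck_on (Suc k) V (\<lambda>q. a q $ j)" and \<psi>: "Ck_on (Suc k) V \<psi>"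
    and A: "\<And>j. derivs_le (Suc k) V Q (\<lambda>q. a q $ j) A" "0 \<le> A"
    and B: "derivs_le (Suc k) V Q \<psi> B" "0 \<le> B"
  shows "derivs_le k V Q (transport_adjoint V a \<psi>) ((1 + of_nat CARD('n) * 2 ^ Suc k * A) * B)"
proof -
  note u = unique_deriv_set_open[OF V(1)]
  have c: "Ck_on (Suc k) V (\<lambda>q. a q $ j * \<psi> q)" for j by (intro Ck_on_mult u a \<psi>)
  have b: "derivs_le (Suc k) V Q (\<lambda>q. a q $ j * \<psi> q) (2 ^ Suc k * A * B)" for j
    by (intro derivs_le_mult V A B a \<psi>)
  have "derivs_le k V Q (\<lambda>p. dir_deriv V (0, 1) \<psi> p +
      (\<Sum>j\<in>UNIV. dir_deriv V (axis j 1, 0) (\<lambda>q. a q $ j * \<psi> q) p))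
      (B + (\<Sum>j\<in>(UNIV::'n set). 2 ^ Suc k * A * B))"
    using \<psi> c B(1) b
    by (intro derivs_le_add derivs_le_sum Ck_on_sum u V finite_class.finite_UNIV)
      (simp_all del: power_Suc)
  moreover have "B + (\<Sum>j\<in>(UNIV::'n set). 2 ^ Suc k * A * B) = (1 + of_nat CARD('n) * 2 ^ Suc k * A) * B"
    by (simp add: algebra_simps)
  ultimately show ?thesis unfolding transport_adjoint_def[abs_def] by simp
qed

text \<open>
  Integration from \<open>T\<close> down to \<open>t\<close> gains one power of \<open>t\<close>, or reaches boundedness. The value \<open>q = 1\<close>, where a logarithm would
  appear, is excluded: below, \<open>q\<close> runs through half-integers, and the last step starts at \<open>q = 1/2\<close>.
\<close>

lemma integrate_power_bound:
  fixes H H' :: "real \<Rightarrow> complex"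
  assumes T: "0 < T" "T \<le> 1" and D: "0 \<le> D" and q: "q = 1/2 \<or> q \<ge> 3/2"
    and deriv: "\<And>s. s \<in> {0<..T} \<Longrightarrow> (H has_vector_derivative H' s) (at s)"
    and bd: "\<And>s. s \<in> {0<..T} \<Longrightarrow> norm (H' s) \<le> D * s powr (- q)"
    and HT: "norm (H T) \<le> D" and t: "t \<in> {0<..T}"
  shows "norm (H t) \<le> 3 * D * t powr (- max (q - 1) 0)"
proof -
  define \<phi> where "\<phi> s = D / (1 - q) * s powr (1 - q)" for s :: real
  have q1: "q \<noteq> 1" using q by auto
  have d\<phi>: "(\<phi> has_real_derivative D * s powr (- q)) (at s)" if "s > 0" for s
  proof -
    have "((\<lambda>s. s powr (1 - q)) has_real_derivative (1 - q) * s powr (1 - q - 1)) (at s)"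
      using that by (rule has_real_derivative_powr)
    from DERIV_cmult[OF this, of "D / (1 - q)"] show ?thesis
      unfolding \<phi>_def[abs_def] using q1 by simp
  qed
  have "norm (H T - H t) \<le> \<phi> T - \<phi> t"
  proof (cases "t = T")
    case False
    then have tT: "t < T" using t by auto
    show ?thesis
    proof (rule differentiable_bound_general[OF tT])
      have "continuous (at s within {t..T}) H" if "s \<in> {t..T}" for s
        using deriv[of s] that t
        by (auto intro: has_vector_derivative_continuous has_vector_derivative_at_within)
      then show "continuous_on {t..T} H" using continuous_on_eq_continuous_within by blast
      have "continuous (at s within {t..T}) \<phi>" if "s \<in> {t..T}" for s
        using d\<phi>[of s] that t by (auto intro: DERIV_isCont continuous_at_imp_continuous_at_within)
      then show "continuous_on {t..T} \<phi>" using continuous_on_eq_continuous_within by blast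
      show "(H has_vector_derivative H' s) (at s)" if "t < s" "s < T" for s
        using deriv that t by auto
      show "(\<phi> has_vector_derivative D * s powr (- q)) (at s)" if "t < s" "s < T" for s
        using d\<phi>[of s] that t by (auto simp: has_real_derivative_iff_has_vector_derivative)
      show "norm (H' s) \<le> D * s powr (- q)" if "t < s" "s < T" for s
        using bd that t by auto
    qed
  qed simp
  then have H: "norm (H t) \<le> D + (\<phi> T - \<phi> t)"
    using HT norm_triangle_ineq4[of "H T" "H T - H t"] by simp
  show ?thesis
  proof (cases "q = 1/2")
    case True
    have "T powr (1/2) \<le> 1" using T by (simp add: powr_le1)
    then have "D * T powr (1/2) \<le> D" "0 \<le> D * t powr (1/2)"
      using D by (simp_all add: mult_left_le)
    moreover have e: "1 - q = 1/2" using True by simp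
    have "\<phi> s = 2 * D * s powr (1/2)" for s unfolding \<phi>_def e by simp
    ultimately have "\<phi> T - \<phi> t \<le> 2 * D"
      by simp
    then show ?thesis using H True t by simp
  next
    case False
    then have q2: "q \<ge> 3/2" using q by auto
    have "t powr (1 - q) \<ge> 1" using t T q2 powr_mono'[of "1 - q" 0 t] by auto
    then have 1: "D \<le> D * t powr (1 - q)" using D by (simp add: mult_le_cancel_left1)
    have "\<phi> T \<le> 0" using D q2 by (simp add: \<phi>_def divide_nonneg_neg mult_nonpos_nonneg)
    moreover have "- \<phi> t \<le> 2 * D * t powr (1 - q)"
    proof -
      have "- \<phi> t = D / (q - 1) * t powr (1 - q)" using q1 by (simp add: \<phi>_def field_simps)
      moreover have "D / (q - 1) \<le> 2 * D" using q2 D by (simp add: field_simps mult_left_mono)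
      ultimately show ?thesis by (metis mult_right_mono powr_ge_zero)
    qed
    ultimately show ?thesis using H 1 q2 by (simp add: max_def)
  qed
qed

text \<open>
  The slab \<open>K \<times> (0, T]\<close> ends strictly before \<open>T0\<close>, so that pairings are differentiable at \<open>T\<close> from both
  sides.
\<close>

locale transport_problem =
  fixes V :: "((real^'n) \<times> real) set" and K :: "(real^'n) set" and T0 T :: real
    and a :: "(real^'n) \<times> real \<Rightarrow> complex^'n" and f :: "(real^'n) \<times> real \<Rightarrow> complex"
  assumes V: "open V" and K: "compact K" and KV: "K \<times> {0<..<T0} \<subseteq> V"
    and T: "0 < T" "T < T0" "T \<le> 1"
    and a: "\<And>j k. Ck_on k V (\<lambda>q. a q $ j)"
    and a_bounded: "\<And>k. \<exists>A\<ge>0. \<forall>j. derivs_le k V (K \<times> {0<..T}) (\<lambda>q. a q $ j) A"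
    and f: "Ck_on 1 V f"
begin

lemma Q: "K \<times> {0<..T} \<subseteq> V"
  using KV T by auto

definition supported :: "((real^'n) \<times> real \<Rightarrow> complex) \<Rightarrow> bool" where
  "supported \<psi> \<longleftrightarrow> (\<forall>p\<in>V. fst p \<notin> K \<longrightarrow> \<psi> p = 0)"

lemma supported_transport_adjoint:
  assumes "supported \<psi>" shows "supported (transport_adjoint V a \<psi>)"
  unfolding supported_def transport_adjoint_def
  using assms dir_deriv_support[OF V K KV, of \<psi>] dir_deriv_support[OF V K KV, of "\<lambda>q. a q $ _ * \<psi> q"]
  by (auto simp: supported_def)

lemma pairing_has_derivative:
  assumes \<psi>: "Ck_on 1 V \<psi>" "supported \<psi>" and E: "Ck_on 1 V E" and t: "t \<in> {0<..<T0}"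
  shows "(slice_integral K (\<lambda>p. f p * \<psi> p * E p) has_vector_derivative
      slice_integral K (\<lambda>p. vector_field_L V a f p * \<psi> p * E p) t
      + slice_integral K (\<lambda>p. f p * transport_adjoint V a \<psi> p * E p) t
      + slice_integral K (\<lambda>p. f p * \<psi> p * vector_field_L V a E p) t) (at t)"
proof -
  note u = unique_deriv_set_open[OF V]
  note c = Ck_on_1I[OF f] Ck_on_1I[OF \<psi>(1)] Ck_on_1I[OF E] Ck_on_1I[OF a]
  have s: "\<psi> p = 0" if "p \<in> V" "fst p \<notin> K" for p using \<psi>(2) that by (auto simp: supported_def)
  have s': "transport_adjoint V a \<psi> p = 0" if "p \<in> V" "fst p \<notin> K" for p
    using supported_transport_adjoint[OF \<psi>(2)] that by (auto simp: supported_def)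
  have cL: "continuous_on V (vector_field_L V a g)" if "Ck_on 1 V g" for g
    unfolding vector_field_L_def[abs_def] using Ck_on_1I(3)[OF that] Ck_on_imp_continuous_on[OF a]
    by (intro continuous_on_add continuous_on_sum continuous_on_mult) auto
  have cA: "continuous_on V (transport_adjoint V a \<psi>)"
    using transport_adjoint_Ck_on[OF V, of 0 a \<psi>] a \<psi> by auto
  let ?R = "\<lambda>j. dir_deriv V (axis j 1, 0) (\<lambda>q. a q $ j * \<psi> q * (f q * E q))"
  have R1: "Ck_on 1 V (\<lambda>q. a q $ j * \<psi> q * (f q * E q))" for j
    by (intro Ck_on_mult u a \<psi> f E)
  have R0: "slice_integral K (?R j) t = 0" for j
    by (rule slice_integral_dir_deriv_zero[OF V K KV R1 _ t]) (auto simp: s axis_in_Basis)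
  have Rc: "continuous_on V (?R j)" for j using R1[of j] by (auto simp del: One_nat_def simp: One_nat_def[symmetric] intro: Ck_on_1I)
  have Rs: "?R j p = 0" if "p \<in> V" "fst p \<notin> K" for j p
    by (rule dir_deriv_support[OF V K KV _ that]) (simp add: s)
  let ?D = "dir_deriv V (0, 1) (\<lambda>p. f p * \<psi> p * E p)"
  have D1: "Ck_on 1 V (\<lambda>p. f p * \<psi> p * E p)" by (intro Ck_on_mult u \<psi> f E)
  have Ds: "?D p = 0" if "p \<in> V" "fst p \<notin> K" for p
    by (rule dir_deriv_support[OF V K KV _ that]) (simp add: s)
  have Dc: "continuous_on V ?D" by (rule Ck_on_1I(3)[OF D1]) simp
  let ?A = "\<lambda>p. vector_field_L V a f p * \<psi> p * E p"
  let ?B = "\<lambda>p. f p * transport_adjoint V a \<psi> p * E p"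
  let ?C = "\<lambda>p. f p * \<psi> p * vector_field_L V a E p"
  have ci: "continuous_on V ?A" "continuous_on V ?B" "continuous_on V ?C"
    "continuous_on V (\<lambda>p. ?A p + ?B p)"
    by (auto intro!: continuous_intros cL f E cA c)
  have "slice_integral K (\<lambda>p. ?D p + (\<Sum>j\<in>UNIV. ?R j p)) t
      = slice_integral K (\<lambda>p. ?A p + ?B p + ?C p) t"
    by (rule slice_integral_cong[OF V K KV _ t])
       (simp add: transport_leibniz[OF V _ c(1) c(4) c(7) c(10)])
  moreover have "slice_integral K (\<lambda>p. ?D p + (\<Sum>j\<in>UNIV. ?R j p)) t = slice_integral K ?D t"
    using R0
    by (subst slice_integral_add[OF V K KV Dc Ds _ _ t]) 
      (auto intro!: continuous_intros Rc simp: Rs slice_integral_sum[OF V K KV Rc Rs t])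
  moreover have "slice_integral K (\<lambda>p. ?A p + ?B p + ?C p) t
     = slice_integral K ?A t + slice_integral K ?B t + slice_integral K ?C t"
    by (subst slice_integral_add[OF V K KV ci(4) _ ci(3) _ t])
      (auto simp: s s' slice_integral_add[OF V K KV ci(1) _ ci(2) _ t])
  moreover have "(slice_integral K (\<lambda>p. f p * \<psi> p * E p) has_vector_derivative slice_integral K ?D t) (at t)"
    by (rule slice_integral_has_derivative[OF V K KV D1 _ t]) (simp add: s)
  ultimately show ?thesis by simp
qed

text \<open>
  The induction on the number \<open>k\<close> of derivatives of \<open>\<psi>\<close> proves the bound \<open>O(t\<^sup>-\<^sup>q)\<close> with \<open>q = m - k + 1/2\<close> for
  all \<open>\<psi>\<close> at once; in the step it is applied to \<open>L' \<psi>\<close>. The index \<open>i\<close> is the frequency in the application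
  to the wave front set, and all constants are independent of it: the dependence sits in the weight
  \<open>w i\<close>, which every step preserves. The last step, from \<open>q = 1/2\<close>, gives boundedness. The
  exponent \<open>m + 1/2\<close> instead of \<open>m\<close> in the assumption avoids \<open>q = 1\<close>.
\<close>

lemma pairing_gain:
  fixes E :: "'i \<Rightarrow> (real^'n) \<times> real \<Rightarrow> complex" and w :: "'i \<Rightarrow> real"
  assumes E: "\<And>i. i \<in> I \<Longrightarrow> Ck_on 1 V (E i)" and w: "\<And>i. i \<in> I \<Longrightarrow> 0 \<le> w i"
    and C0: "0 \<le> C0"
    and fE: "\<And>i p. i \<in> I \<Longrightarrow> p \<in> K \<times> {0<..T} \<Longrightarrow> norm (f p * E i p) \<le> C0 * w i * snd p powr (- (m + 1/2))"
    and LfE: "\<And>i p. i \<in> I \<Longrightarrow> p \<in> K \<times> {0<..T} \<Longrightarrow> norm (vector_field_L V a f p * E i p) \<le> C0 * w i"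
    and fLE: "\<And>i p. i \<in> I \<Longrightarrow> p \<in> K \<times> {0<..T} \<Longrightarrow> norm (f p * vector_field_L V a (E i) p) \<le> C0 * w i"
  shows "\<exists>C\<ge>0. \<forall>i\<in>I. \<forall>\<psi> B. \<forall>t\<in>{0<..T}. Ck_on (Suc m) V \<psi> \<longrightarrow> supported \<psi> \<longrightarrow> 0 \<le> B \<longrightarrow>
    derivs_le (Suc m) V (K \<times> {0<..T}) \<psi> B \<longrightarrow>
    norm (slice_integral K (\<lambda>p. f p * \<psi> p * E i p) t) \<le> C * w i * B"
proof -
  let ?Q = "K \<times> {0<..T}"
  let ?\<mu> = "measure lborel K"
  define P where "P k q \<longleftrightarrow> (\<exists>C\<ge>0. \<forall>i\<in>I. \<forall>\<psi> B. \<forall>t\<in>{0<..T}. Ck_on k V \<psi> \<longrightarrow> supported \<psi> \<longrightarrow> 0 \<le> B \<longrightarrow>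
    derivs_le k V ?Q \<psi> B \<longrightarrow>
    norm (slice_integral K (\<lambda>p. f p * \<psi> p * E i p) t) \<le> C * w i * B * t powr (- q))" for k q
  have base: "P 0 (m + 1/2)"
    unfolding P_def
  proof (intro exI[of _ "C0 * ?\<mu>"] conjI ballI allI impI)
    fix i B t and \<psi> :: "(real^'n) \<times> real \<Rightarrow> complex" assume i: "i \<in> I" and t: "t \<in> {0<..T}" and B: "0 \<le> B" "derivs_le 0 V ?Q \<psi> B"
    have "norm (f (x, t) * \<psi> (x, t) * E i (x, t)) \<le> C0 * w i * t powr (- (m + 1/2)) * B" if "x \<in> K" for x
    proof -
      have "norm (f (x, t) * \<psi> (x, t) * E i (x, t)) = norm (f (x, t) * E i (x, t)) * norm (\<psi> (x, t))"
        by (simp add: norm_mult)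
      also have "\<dots> \<le> (C0 * w i * t powr (- (m + 1/2))) * B"
        using fE[OF i, of "(x, t)"] B derivs_le_bound[OF B(2), of "(x, t)"] that t C0 w[OF i]
        by (intro mult_mono) auto
      finally show ?thesis .
    qed
    from slice_integral_norm_le[OF K, of "\<lambda>p. f p * \<psi> p * E i p", OF this]
    show "norm (slice_integral K (\<lambda>p. f p * \<psi> p * E i p) t) \<le> C0 * ?\<mu> * w i * B * t powr (- (m + 1/2))"
      using C0 w[OF i] B by (simp add: ac_simps)
  qed (use C0 in simp)
  have step: "P (Suc k) (max (q - 1) 0)" if P: "P k q" and q: "q = 1/2 \<or> q \<ge> 3/2" for k q
  proof -
    obtain C where C: "C \<ge> 0" and CP: "\<And>i \<psi> B t. \<lbrakk>i \<in> I; t \<in> {0<..T}; Ck_on k V \<psi>; supported \<psi>; 0 \<le> B;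
      derivs_le k V ?Q \<psi> B\<rbrakk> \<Longrightarrow> 
      norm (slice_integral K (\<lambda>p. f p * \<psi> p * E i p) t) \<le> C * w i * B * t powr (- q)"
      using P unfolding P_def by blast
    obtain A where A: "A \<ge> 0" "\<And>j. derivs_le (Suc k) V ?Q (\<lambda>q. a q $ j) A" using a_bounded by metis
    \<comment> \<open>The operator \<open>L'\<close> multiplies bounds for derivatives by \<open>M\<close>.\<close>
    define M where "M = 1 + of_nat CARD('n) * 2 ^ Suc k * A"
    have M: "M \<ge> 0" using A by (simp add: M_def)
    \<comment> \<open>The three terms control the value at \<open>T\<close>, the pairing with \<open>L' \<psi>\<close>, and the integrals with \<open>L f\<close> and \<open>L E\<close>.\<close>
    define D where "D = C * T powr (- q) + C * M + 2 * C0 * ?\<mu>"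
    have D: "D \<ge> 0" using C M C0 by (simp add: D_def)
    show ?thesis unfolding P_def
    proof (intro exI[of _ "3 * D"] conjI ballI allI impI)
      fix i B t and \<psi> :: "(real^'n) \<times> real \<Rightarrow> complex" assume i: "i \<in> I" and t: "t \<in> {0<..T}" and \<psi>: "Ck_on (Suc k) V \<psi>" "supported \<psi>"
        and B: "0 \<le> B" "derivs_le (Suc k) V ?Q \<psi> B"
      let ?L = "\<lambda>t. slice_integral K (\<lambda>p. vector_field_L V a f p * \<psi> p * E i p) t"
      let ?M = "\<lambda>t. slice_integral K (\<lambda>p. f p * transport_adjoint V a \<psi> p * E i p) t"
      let ?N = "\<lambda>t. slice_integral K (\<lambda>p. f p * \<psi> p * vector_field_L V a (E i) p) t"
      have \<psi>1: "Ck_on 1 V \<psi>" using \<psi>(1) Ck_on_mono by (metis One_nat_def Suc_le_mono le0)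
      have "norm (slice_integral K (\<lambda>p. f p * \<psi> p * E i p) t)
          \<le> 3 * (D * w i * B) * t powr (- max (q - 1) 0)"
      proof (rule integrate_power_bound[where H' = "\<lambda>s. ?L s + ?M s + ?N s" and T = T])
        show "0 < T" "T \<le> 1" using T by auto
        show "0 \<le> D * w i * B" using D w[OF i] B by simp
        show "q = 1/2 \<or> 3/2 \<le> q" by (rule q)
        show "t \<in> {0<..T}" by (rule t)
        show "(slice_integral K (\<lambda>p. f p * \<psi> p * E i p) has_vector_derivative ?L s + ?M s + ?N s) (at s)"
          if "s \<in> {0<..T}" for s
          by (rule pairing_has_derivative[OF \<psi>1 \<psi>(2) E[OF i]]) (use that T in auto)
        have "norm (slice_integral K (\<lambda>p. f p * \<psi> p * E i p) T) \<le> C * w i * B * T powr (- q)"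
          using CP[OF i _ Ck_on_SucD[OF \<psi>(1)] \<psi>(2) B(1) derivs_le_SucD[OF B(2)], of T] T by auto
        also have "\<dots> = (C * T powr (- q)) * (w i * B)" by simp
        also have "\<dots> \<le> D * (w i * B)"
          using C M C0 B w[OF i] by (intro mult_right_mono) (auto simp: D_def)
        finally show "norm (slice_integral K (\<lambda>p. f p * \<psi> p * E i p) T) \<le> D * w i * B" by simp
        fix s assume s: "s \<in> {0<..T}"
        have b\<psi>: "norm (\<psi> (x, s)) \<le> B" if "x \<in> K" for x
          using derivs_le_bound[OF B(2), of "(x, s)"] that s by auto
        have wB: "0 \<le> w i * B" using w[OF i] B by simp
        have 1: "norm (?L s) \<le> C0 * w i * B * ?\<mu>"
        proof (rule slice_integral_norm_le[OF K])
          fix x assume x: "x \<in> K"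
          have "norm (vector_field_L V a f (x, s) * \<psi> (x, s) * E i (x, s))
            = norm (vector_field_L V a f (x, s) * E i (x, s)) * norm (\<psi> (x, s))" by (simp add: norm_mult)
          also have "\<dots> \<le> (C0 * w i) * B"
            by (intro mult_mono LfE i b\<psi> x) (use x s C0 w[OF i] B in auto)
          finally show "norm (vector_field_L V a f (x, s) * \<psi> (x, s) * E i (x, s)) \<le> C0 * w i * B" .
        qed (use C0 w[OF i] B in simp)
        have 2: "norm (?N s) \<le> C0 * w i * B * ?\<mu>"
        proof (rule slice_integral_norm_le[OF K])
          fix x assume x: "x \<in> K"
          have "norm (f (x, s) * \<psi> (x, s) * vector_field_L V a (E i) (x, s))
            = norm (f (x, s) * vector_field_L V a (E i) (x, s)) * norm (\<psi> (x, s))" by (simp add: norm_mult)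
          also have "\<dots> \<le> (C0 * w i) * B"
            by (intro mult_mono fLE i b\<psi> x) (use x s C0 w[OF i] B in auto)
          finally show "norm (f (x, s) * \<psi> (x, s) * vector_field_L V a (E i) (x, s)) \<le> C0 * w i * B" .
        qed (use C0 w[OF i] B in simp)
        have 3: "norm (?M s) \<le> C * w i * (M * B) * s powr (- q)"
        proof (rule CP[OF i s])
          show "derivs_le k V ?Q (transport_adjoint V a \<psi>) (M * B)"
            unfolding M_def by (rule transport_adjoint_derivs_le[OF V Q a \<psi>(1) A(2,1) B(2,1)])
        qed (use M B \<psi> a in \<open>auto intro!: transport_adjoint_Ck_on[OF V] supported_transport_adjoint
              simp del: Ck_on.simps\<close>)
        have s1: "s powr (- q) \<ge> 1" using s T q powr_mono'[of "- q" 0 s] by auto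
        have "norm (?L s + ?M s + ?N s) \<le> norm (?L s) + norm (?M s) + norm (?N s)"
          by (intro norm_triangle_mono order_refl)
        also have "\<dots> \<le> (C * M * s powr (- q) + 2 * C0 * ?\<mu> * 1) * (w i * B)"
          using 1 2 3 by (simp add: algebra_simps)
        also have "\<dots> \<le> (C * M * s powr (- q) + 2 * C0 * ?\<mu> * s powr (- q)) * (w i * B)"
          using s1 C0 wB by (intro mult_right_mono add_left_mono mult_left_mono) auto
        also have "\<dots> = (C * M + 2 * C0 * ?\<mu>) * s powr (- q) * (w i * B)" by (simp add: algebra_simps)
        also have "\<dots> \<le> D * s powr (- q) * (w i * B)"
          using C wB by (intro mult_right_mono) (auto simp: D_def)
        finally show "norm (?L s + ?M s + ?N s) \<le> D * w i * B * s powr (- q)" by (simp add: ac_simps)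
      qed
      then show "norm (slice_integral K (\<lambda>p. f p * \<psi> p * E i p) t) \<le> 3 * D * w i * B * t powr - max (q - 1) 0"
        by (simp add: ac_simps)
    qed (use D in simp)
  qed
  have "P k (m - k + 1/2)" if "k \<le> m" for k
    using that
  proof (induction k)
    case 0 then show ?case using base by simp
  next
    case (Suc k)
    have "P (Suc k) (max (m - k + 1/2 - 1) 0)"
      by (rule step) (use Suc in auto)
    moreover have "max (real (m - k) + 1/2 - 1) 0 = real (m - Suc k) + 1/2"
      using Suc.prems by (auto simp: of_nat_diff max_def)
    ultimately show ?case by simp
  qed
  from step[OF this[of m]] have "P (Suc m) 0" by simp
  then show ?thesis unfolding P_def
  proof (elim exE conjE, intro exI conjI ballI allI impI)
    fix C i B t and \<psi> :: "(real^'n) \<times> real \<Rightarrow> complex" assume *: "\<forall>i\<in>I. \<forall>\<psi> B. \<forall>t\<in>{0<..T}. Ck_on (Suc m) V \<psi> \<longrightarrow> supported \<psi> \<longrightarrow> 0 \<le> B \<longrightarrow>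
      derivs_le (Suc m) V ?Q \<psi> B \<longrightarrow>
      norm (slice_integral K (\<lambda>p. f p * \<psi> p * E i p) t) \<le> C * w i * B * t powr (- 0)"
      and "i \<in> I" "t \<in> {0<..T}" "Ck_on (Suc m) V \<psi>" "supported \<psi>" "0 \<le> B" "derivs_le (Suc m) V ?Q \<psi> B"
    then show "norm (slice_integral K (\<lambda>p. f p * \<psi> p * E i p) t) \<le> C * w i * B"
      using *[rule_format, of i t \<psi> B] by simp
  qed
qed

end

section \<open>The boundary trace\<close>

lemma bounded_derivative_imp_convergent_at_right:
  fixes H :: "real \<Rightarrow> complex"
  assumes T: "0 < T" and deriv: "\<And>s. s \<in> {0<..T} \<Longrightarrow> (H has_vector_derivative H' s) (at s)"
    and bd: "\<And>s. s \<in> {0<..T} \<Longrightarrow> norm (H' s) \<le> D"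
  shows "\<exists>l. (H \<longlongrightarrow> l) (at_right 0)"
proof -
  have D: "D \<ge> 0" using bd[of T] T norm_ge_zero[of "H' T"] by (auto intro: order_trans simp del: norm_ge_zero)
  have ineq: "norm (H t - H s) \<le> D * (t - s)" if "s \<in> {0<..T}" "t \<in> {0<..T}" "s < t" for s t
  proof -
    have "norm (H t - H s) \<le> D * t - D * s"
    proof (rule differentiable_bound_general[where f' = H' and \<phi>' = "\<lambda>_. D", OF that(3)])
      have "continuous (at r within {s..t}) H" if "r \<in> {s..t}" for r
        using deriv[of r] that \<open>s \<in> _\<close> \<open>t \<in> _\<close>
        by (auto intro: has_vector_derivative_continuous has_vector_derivative_at_within)
      then show "continuous_on {s..t} H" using continuous_on_eq_continuous_within by blast
      show "continuous_on {s..t} ((*) D)" by (intro continuous_intros)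
      show "((*) D has_vector_derivative D) (at r)" for r
        by (auto intro!: derivative_eq_intros simp: has_real_derivative_iff_has_vector_derivative[symmetric])
    qed (use deriv bd that in auto)
    then show ?thesis by (simp add: algebra_simps)
  qed
  have "D-lipschitz_on {0<..T} H"
  proof (rule lipschitz_onI[OF _ D])
    fix s t assume *: "s \<in> {0<..T}" "t \<in> {0<..T}"
    show "dist (H s) (H t) \<le> D * dist s t"
      using ineq[OF *] ineq[OF *(2,1)] 
      by (cases s t rule: linorder_cases) (auto simp: dist_norm norm_minus_commute abs_if)
  qed
  then have "uniformly_continuous_on {0<..T} H" by (rule lipschitz_on_uniformly_continuous)
  moreover have "0 \<in> closure {0<..T}" using T by (subst closure_greaterThanAtMost) auto
  ultimately obtain l where "(H \<longlongrightarrow> l) (at 0 within {0<..T})"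
    by (rule uniformly_continuous_on_extension_at_closure)
  moreover have "at 0 within {0<..T} = at_right 0"
    by (rule at_within_nhd[of _ "{..<T}"]) (use T in auto)
  ultimately show ?thesis by auto
qed

lemma compact_tube:
  fixes U :: "('a::euclidean_space \<times> real) set"
  assumes "open U" "compact K" "K \<times> {0} \<subseteq> U"
  shows "\<exists>T>0. K \<times> {0..<T} \<subseteq> U"
proof -
  have "compact (K \<times> {0::real})" using assms(2) by (simp add: compact_Times)
  from compact_subset_open_imp_ball_epsilon_subset[OF this assms(1,3)]
  obtain e where e: "e > 0" "(\<Union>x\<in>K \<times> {0}. ball x e) \<subseteq> U" by auto
  have "(x, t) \<in> U" if "x \<in> K" "t \<in> {0..<e}" for x t
    using that e(2) by (intro subsetD[OF e(2)]) (auto intro!: bexI[of _ x] simp: dist_Pair_Pair dist_real_def)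
  then show ?thesis using e(1) by auto
qed

lemma zero_off_closure_support:
  assumes "x \<notin> closure {x. \<phi> x \<noteq> 0}" shows "\<phi> x = 0"
  using assms closure_subset[of "{x. \<phi> x \<noteq> 0}"] by auto

lemma smooth_on_foldr_dir_deriv:
  assumes "smooth_on S \<phi>" "set vs \<subseteq> Basis"
  shows "smooth_on S (foldr (dir_deriv S) vs \<phi>)"
  using assms(2)
proof (induction vs)
  case (Cons v vs)
  then have "Ck_on (Suc k) S (foldr (dir_deriv S) vs \<phi>)" for k by (auto simp: smooth_on_def)
  then show ?case using Cons.prems by (auto simp: smooth_on_def)
qed (use assms in simp)

lemma foldr_dir_deriv_support:
  assumes "x \<notin> closure {x. \<phi> x \<noteq> 0}"
  shows "foldr (dir_deriv UNIV) vs \<phi> (x::'a::euclidean_space) = 0"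
  using assms
proof (induction vs arbitrary: x)
  case Nil
  then show ?case using closure_subset[of "{x. \<phi> x \<noteq> 0}"] by auto
next
  case (Cons v vs)
  show ?case unfolding foldr.simps o_def
    by (rule dir_deriv_locally_zero[OF open_UNIV closed_closure]) (use Cons in auto)
qed

lemma test_function_deriv_le_SUP:
  assumes "\<phi> \<in> test_functions X" "set vs \<subseteq> Basis"
  shows "norm (foldr (dir_deriv UNIV) vs \<phi> x) \<le> (SUP x. norm (foldr (dir_deriv UNIV) vs \<phi> x))"
proof (rule cSUP_upper)
  let ?g = "foldr (dir_deriv UNIV) vs \<phi>" and ?K = "closure {x. \<phi> x \<noteq> 0}"
  have s: "smooth_on UNIV \<phi>" and K: "compact ?K" using assms(1) by (auto simp: test_functions_def)
  have "Ck_on 0 UNIV ?g" using smooth_on_foldr_dir_deriv[OF s assms(2)] by (simp add: smooth_on_def)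
  then have "bounded (?g ` ?K)"
    using compact_continuous_image[OF continuous_on_subset[of UNIV ?g] K] by (simp add: compact_imp_bounded)
  then obtain B where B: "\<And>x. x \<in> ?K \<Longrightarrow> norm (?g x) \<le> B" by (auto simp: bounded_iff)
  have "norm (?g x) \<le> max B 0" for x
    using B[of x] foldr_dir_deriv_support[of x \<phi> vs] by (cases "x \<in> ?K") auto
  then show "bdd_above (range (\<lambda>x. norm (?g x)))" by (auto intro!: bdd_aboveI)
qed simp

text \<open>
  The seminorms that \<open>distribution\<close> uses to express continuity.
\<close>

definition test_seminorm :: "nat \<Rightarrow> ('a::euclidean_space \<Rightarrow> complex) \<Rightarrow> real" where
  "test_seminorm m \<phi> = (\<Sum>vs | set vs \<subseteq> Basis \<and> length vs \<le> m.
      (SUP x. norm (foldr (dir_deriv UNIV) vs \<phi> x)))"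

lemma deriv_le_test_seminorm:
  assumes "\<phi> \<in> test_functions X" "set vs \<subseteq> Basis" "length vs \<le> m"
  shows "norm (foldr (dir_deriv UNIV) vs \<phi> x) \<le> test_seminorm m \<phi>"
proof -
  let ?I = "{vs::'a list. set vs \<subseteq> Basis \<and> length vs \<le> m}"
  have fin: "finite ?I" by (rule finite_lists_length_le) simp
  have "0 \<le> (SUP x. norm (foldr (dir_deriv UNIV) us \<phi> x))" if "us \<in> ?I" for us
    using test_function_deriv_le_SUP[OF assms(1), of us 0] that norm_ge_zero order_trans by blast
  then have "(SUP x. norm (foldr (dir_deriv UNIV) vs \<phi> x)) \<le> test_seminorm m \<phi>"
    unfolding test_seminorm_def
    using assms(2,3) fin by (intro member_le_sum) auto
  then show ?thesis using test_function_deriv_le_SUP[OF assms(1,2), of x] by simp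
qed

lemma bounded_linear_fst_Basis:
  "v \<in> Basis \<Longrightarrow> fst v \<in> Basis \<or> fst (v :: 'a::euclidean_space \<times> real) = 0"
  by (auto simp: Basis_prod_def)

lemma Ck_on_fst:
  assumes "unique_deriv_set V" "fst ` V \<subseteq> S" "Ck_on k S g"
  shows "Ck_on k (V :: ('a::euclidean_space \<times> real) set) (\<lambda>p. g (fst p))"
  by (rule Ck_on_compose_linear[OF assms(1) bounded_linear_fst assms(2) bounded_linear_fst_Basis assms(3)])

text \<open>
  Derivatives of \<open>\<phi>(x)\<close> as a function of \<open>(x, t)\<close> are derivatives of \<open>\<phi>\<close>, or zero as soon as one of them
  is taken in \<open>t\<close>.
\<close>

lemma derivs_le_fst:
  fixes \<phi> :: "'a::euclidean_space \<Rightarrow> complex" and V :: "('a \<times> real) set"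
  assumes V: "open V" "Q \<subseteq> V" and "Ck_on k UNIV \<phi>" and B: "0 \<le> B"
    and "\<And>vs x. set vs \<subseteq> Basis \<Longrightarrow> length vs \<le> k \<Longrightarrow> norm (foldr (dir_deriv UNIV) vs \<phi> x) \<le> B"
  shows "derivs_le k V Q (\<lambda>p. \<phi> (fst p)) B"
  using assms(3,5)
proof (induction k arbitrary: \<phi>)
  case 0
  from 0(2)[of "[]"] show ?case by simp
next
  case (Suc k)
  have zero: "derivs_le j V Q (\<lambda>p. 0::complex) B" for j
    using derivs_le_sum[OF V, of "{}" j] B by (auto intro: derivs_le_mono)
  have d: "\<phi> differentiable_on UNIV" using Suc.prems(1) by simp
  have "derivs_le k V Q (dir_deriv V v (\<lambda>p. \<phi> (fst p))) B" if v: "v \<in> Basis" for v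
  proof -
    have eq: "derivs_le k V Q (dir_deriv V v (\<lambda>p. \<phi> (fst p))) B
        = derivs_le k V Q (\<lambda>p. dir_deriv UNIV (fst v) \<phi> (fst p)) B"
      by (intro derivs_le_cong V dir_deriv_compose_linear(2) unique_deriv_set_open bounded_linear_fst d) auto
    show ?thesis
    proof (cases "fst v = 0")
      case True
      then have "dir_deriv UNIV (fst v) \<phi> (fst p) = 0" for p :: "'a \<times> real"
        using linear_0[OF has_derivative_linear[OF has_derivative_dir_deriv[OF d UNIV_I, of "fst p"]]] by simp
      then show ?thesis using eq zero by simp
    next
      case False
      then have b: "fst v \<in> Basis" using bounded_linear_fst_Basis[OF v] by auto
      have "derivs_le k V Q (\<lambda>p. dir_deriv UNIV (fst v) \<phi> (fst p)) B"
      proof (rule Suc.IH)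
        show "Ck_on k UNIV (dir_deriv UNIV (fst v) \<phi>)" using Suc.prems(1) b by simp
        fix vs and x :: 'a assume "set vs \<subseteq> (Basis::'a set)" "length vs \<le> k"
        then show "norm (foldr (dir_deriv UNIV) vs (dir_deriv UNIV (fst v) \<phi>) x) \<le> B"
          using Suc.prems(2)[of "vs @ [fst v]" x] b by simp
      qed
      then show ?thesis using eq by simp
    qed
  qed
  moreover have "norm (\<phi> x) \<le> B" for x using Suc.prems(2)[of "[]" x] by simp
  ultimately show ?case by simp
qed

locale boundary_problem =
  fixes X :: "(real^'n) set" and U :: "((real^'n) \<times> real) set"
    and a :: "(real^'n) \<times> real \<Rightarrow> complex^'n" and f :: "(real^'n) \<times> real \<Rightarrow> complex" and N :: nat
  assumes X: "open X" and U: "open U" and XU: "X \<times> {0} \<subseteq> U"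
    and a: "smooth_on (X \<times> {0} \<union> upper_part U) a"
    and f: "Ck_on 1 (upper_part U) f"
    and f_growth: "bigo_locally_uniformly X f (\<lambda>t. 1 / t ^ N)"
    and Lf_flat: "\<And>k::nat. k \<ge> 1 \<Longrightarrow> bigo_locally_uniformly X (vector_field_L (upper_part U) a f) (\<lambda>t. t ^ k)"
begin

text \<open>
  \<open>S\<close> carries the smoothness of \<open>a\<close> up to \<open>t = 0\<close>. The open set \<open>V\<close> is where the transport identity is
  used; it is cut down to points above \<open>X\<close> because the coefficients of \<open>Z\<close> are functions on \<open>X\<close>.
\<close>

definition S where "S = X \<times> {0} \<union> upper_part U"
definition V where "V = upper_part U \<inter> X \<times> UNIV"

lemma open_upper: "open (upper_part U)"
proof -
  have "upper_part U = U \<inter> snd -` {0<..}" by (auto simp: upper_part_def)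
  then show ?thesis using U by (simp add: open_Int open_vimage_snd)
qed

lemma open_V: "open V"
  unfolding V_def by (intro open_Int open_upper open_Times X open_UNIV)

lemma V_subset: "V \<subseteq> upper_part U" "V \<subseteq> S" "V \<subseteq> X \<times> UNIV"
  by (auto simp: V_def S_def)

lemma unique_V: "unique_deriv_set V"
  by (rule unique_deriv_set_open[OF open_V])

lemma unique_X: "unique_deriv_set X"
  by (rule unique_deriv_set_open[OF X])

lemma unique_S: "unique_deriv_set S"
  unfolding unique_deriv_set_def
proof (intro ballI allI impI)
  fix p i :: "(real^'n) \<times> real" and e :: real
  assume p: "p \<in> S" and i: "i \<in> Basis" and e: "e > 0"
  show "\<exists>d. 0 < \<bar>d\<bar> \<and> \<bar>d\<bar> < e \<and> p + d *\<^sub>R i \<in> S"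
  proof (cases "p \<in> upper_part U")
    case True
    then show ?thesis using unique_deriv_set_open[OF open_upper] i e
      unfolding unique_deriv_set_def S_def by blast
  next
    case False
    then obtain x where x: "p = (x, 0)" "x \<in> X" using p by (auto simp: S_def)
    consider b where "i = (b, 0)" "b \<in> Basis" | "i = (0, 1)" using i by (auto simp: Basis_prod_def)
    then show ?thesis
    proof cases
      case 1
      then show ?thesis using unique_X x e unfolding unique_deriv_set_def S_def by fastforce
    next
      case 2
      obtain T where T: "T > 0" "{x} \<times> {0..<T} \<subseteq> U" using compact_tube[OF U, of "{x}"] XU x by auto
      then have "(x, min T e / 2) \<in> U" using e by (intro subsetD[OF T(2)]) auto
      then have "p + (min T e / 2) *\<^sub>R i \<in> S"
        using 2 x e T by (auto simp: S_def upper_part_def)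
      then show ?thesis using T e by (intro exI[of _ "min T e / 2"]) auto
    qed
  qed
qed

lemma a_component: "Ck_on k S (\<lambda>p. a p $ j)"
  by (rule Ck_on_linear[OF unique_S bounded_linear_vec_nth]) (use a in \<open>simp add: smooth_on_def S_def\<close>)

lemma vector_field_L_V: "p \<in> V \<Longrightarrow> vector_field_L (upper_part U) a g p = vector_field_L V a g p"
  unfolding vector_field_L_def by (simp add: dir_deriv_open_subset[OF open_V V_subset(1), symmetric])

text \<open>
  The order \<open>k\<close> to which \<open>L f\<close> vanishes has to be fixed before the height \<open>T1\<close> and the constant are chosen. The
  slab may still be made lower afterwards, which \<open>fourier_decay\<close> uses.
\<close>

lemma local_bounds:
  assumes K: "compact K" "K \<subseteq> X" and k: "k \<ge> 1"
  obtains T0 T1 C where "0 < T1" "0 \<le> C"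
    "\<And>T. T \<in> {0<..T1} \<Longrightarrow> transport_problem V K T0 T a f"
    "\<And>p. p \<in> K \<times> {0<..T1} \<Longrightarrow> norm (f p) \<le> C / snd p ^ N"
    "\<And>p. p \<in> K \<times> {0<..T1} \<Longrightarrow> norm (vector_field_L V a f p) \<le> C * snd p ^ k"
    "T1 \<le> 1" "K \<times> {0<..T1} \<subseteq> V"
proof -
  obtain C1 where C1: "\<forall>\<^sub>F t in at_right 0. \<forall>x\<in>K. norm (f (x, t)) \<le> C1 * (1 / t ^ N)"
    using f_growth K unfolding bigo_locally_uniformly_def by blast
  obtain C2 where C2: "\<forall>\<^sub>F t in at_right 0. \<forall>x\<in>K. norm (vector_field_L (upper_part U) a f (x, t)) \<le> C2 * t ^ k"
    using Lf_flat[OF k] K unfolding bigo_locally_uniformly_def by blast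
  obtain b where b: "b > 0" "\<And>t x. 0 < t \<Longrightarrow> t < b \<Longrightarrow> x \<in> K \<Longrightarrow>
      norm (f (x, t)) \<le> C1 * (1 / t ^ N) \<and> norm (vector_field_L (upper_part U) a f (x, t)) \<le> C2 * t ^ k"
    using eventually_conj[OF C1 C2] unfolding eventually_at_right_field by auto
  have "K \<times> {0} \<subseteq> U" using K XU by auto
  from compact_tube[OF U K(1) this] obtain T0 where T0: "T0 > 0" "K \<times> {0..<T0} \<subseteq> U" by auto
  have KV: "K \<times> {0<..<T0} \<subseteq> V" using T0 K by (auto simp: V_def upper_part_def subset_iff)
  have KS: "K \<times> {0..<T0} \<subseteq> S" using T0 K by (auto simp: S_def upper_part_def subset_iff order_le_less)
  define T1 where "T1 = min 1 (min b T0 / 2)"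
  define C where "C = max 0 (max C1 C2)"
  have T1: "0 < T1" "T1 < b" "T1 < T0" "T1 \<le> 1" using b(1) T0(1) by (auto simp: T1_def)
  have Q: "K \<times> {0<..T1} \<subseteq> V" using KV T1 by auto
  show ?thesis
  proof (rule that[of T1 C T0])
    show "transport_problem V K T0 T a f" if T: "T \<in> {0<..T1}" for T
    proof
      show "\<exists>A\<ge>0. \<forall>j. derivs_le k V (K \<times> {0<..T}) (\<lambda>q. a q $ j) A" for k
      proof -
        have Q: "K \<times> {0<..T} \<subseteq> V" using KV T T1 by auto
        have "\<exists>B\<ge>0. derivs_le k V (K \<times> {0<..T}) (\<lambda>q. a q $ j) B" for j
        proof (rule derivs_le_compact[OF open_V V_subset(2) Q, of "K \<times> {0..T}"])
          show "K \<times> {0..T} \<subseteq> S" using KS T T1 by auto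
        qed (use K a_component in \<open>auto intro: compact_Times\<close>)
        then obtain A where A: "\<And>j. A j \<ge> 0" "\<And>j. derivs_le k V (K \<times> {0<..T}) (\<lambda>q. a q $ j) (A j)"
          by metis
        have "derivs_le k V (K \<times> {0<..T}) (\<lambda>q. a q $ j) (\<Sum>j\<in>UNIV. A j)" for j
          by (rule derivs_le_mono[OF A(2)]) (use A(1) in \<open>auto intro: member_le_sum\<close>)
        then show ?thesis using A(1) by (intro exI[of _ "\<Sum>j\<in>UNIV. A j"]) (auto intro: sum_nonneg)
      qed
      show "Ck_on k V (\<lambda>q. a q $ j)" for j k
        by (rule Ck_on_subset[OF unique_V V_subset(2) a_component])
      show "Ck_on 1 V f" by (rule Ck_on_subset[OF unique_V V_subset(1) f])
    qed (use open_V K KV T T1 in auto)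
    fix p assume p: "p \<in> K \<times> {0<..T1}"
    then obtain x t where xt: "p = (x, t)" "x \<in> K" "0 < t" "t < b" using T1 by (cases p) auto
    have "norm (f p) \<le> C1 * (1 / t ^ N)" using b(2)[OF xt(3,4,2)] xt(1) by simp
    also have "\<dots> \<le> C * (1 / t ^ N)" by (intro mult_right_mono) (use xt in \<open>auto simp: C_def\<close>)
    finally show "norm (f p) \<le> C / snd p ^ N" using xt by simp
    have "norm (vector_field_L V a f p) \<le> C2 * t ^ k"
      using b(2)[OF xt(3,4,2)] xt(1) vector_field_L_V[OF subsetD[OF Q p], of f] by simp
    also have "\<dots> \<le> C * t ^ k" by (intro mult_right_mono) (use xt in \<open>auto simp: C_def\<close>)
    finally show "norm (vector_field_L V a f p) \<le> C * snd p ^ k" using xt by simp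
  qed (use T1 Q in \<open>auto simp: C_def\<close>)
qed

text \<open>
  The case \<open>E = 1\<close> of \<open>pairing_gain\<close>, started from the growth of \<open>f\<close>.
\<close>

lemma plain_pairing_bounded:
  assumes K: "compact K" "K \<subseteq> X"
  obtains T0 T C D where "transport_problem V K T0 T a f" "0 \<le> C"
    "\<And>p. p \<in> K \<times> {0<..T} \<Longrightarrow> norm (vector_field_L V a f p) \<le> D"
    "\<And>p. p \<in> K \<times> {0<..T} \<Longrightarrow> norm (f p) \<le> D / snd p ^ N"
    "K \<times> {0<..T} \<subseteq> V" "0 < T" "0 \<le> D"
    "\<And>\<psi> B t. t \<in> {0<..T} \<Longrightarrow> Ck_on (Suc N) V \<psi> \<Longrightarrow> (\<And>p. p \<in> V \<Longrightarrow> fst p \<notin> K \<Longrightarrow> \<psi> p = 0) \<Longrightarrow> 0 \<le> B \<Longrightarrow>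
      derivs_le (Suc N) V (K \<times> {0<..T}) \<psi> B \<Longrightarrow> norm (slice_integral K (\<lambda>p. f p * \<psi> p) t) \<le> C * B"
proof -
  obtain T0 T C where T: "0 < T" "0 \<le> C" and tp: "transport_problem V K T0 T a f"
    and fb: "\<And>p. p \<in> K \<times> {0<..T} \<Longrightarrow> norm (f p) \<le> C / snd p ^ N"
    and Lfb: "\<And>p. p \<in> K \<times> {0<..T} \<Longrightarrow> norm (vector_field_L V a f p) \<le> C * snd p ^ 1"
    and T1: "T \<le> 1" and Q: "K \<times> {0<..T} \<subseteq> V"
    by (rule local_bounds[OF K order_refl]) (metis greaterThanAtMost_iff order_refl)
  interpret tp: transport_problem V K T0 T a f by (rule tp)
  have Lfb': "norm (vector_field_L V a f p) \<le> C" if "p \<in> K \<times> {0<..T}" for p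
  proof -
    have "C * snd p ^ 1 \<le> C * 1" using that \<open>0 \<le> C\<close> T1 by (intro mult_left_mono) auto
    then show ?thesis using Lfb[OF that] by simp
  qed
  note 1 = vector_field_L_const[OF open_V, of _ a 1]
  have "\<exists>C'\<ge>0. \<forall>i\<in>{()}. \<forall>\<psi> B. \<forall>t\<in>{0<..T}. Ck_on (Suc N) V \<psi> \<longrightarrow> tp.supported \<psi> \<longrightarrow> 0 \<le> B \<longrightarrow>
    derivs_le (Suc N) V (K \<times> {0<..T}) \<psi> B \<longrightarrow>
    norm (slice_integral K (\<lambda>p. f p * \<psi> p * 1) t) \<le> C' * 1 * B"
  proof (rule tp.pairing_gain[where ?C0.0 = C])
    fix p :: "(real^'n) \<times> real" assume p: "p \<in> K \<times> {0<..T}"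
    then obtain t where t: "snd p = t" "0 < t" "t \<le> 1" using T1 by auto
    have "1 / t ^ N = t powr (- real N)" using t by (simp add: powr_minus powr_realpow divide_inverse)
    also have "\<dots> \<le> t powr (- (N + 1/2))" using t by (intro powr_mono') auto
    finally have "C * (1 / t ^ N) \<le> C * t powr (- (N + 1/2))" using T(2) by (rule mult_left_mono)
    then show "norm (f p * 1) \<le> C * 1 * snd p powr (- (N + 1/2))"
      using fb[OF p] t by simp
    show "norm (vector_field_L V a f p * 1) \<le> C * 1" using Lfb'[OF p] by simp
    show "norm (f p * vector_field_L V a (\<lambda>_. 1) p) \<le> C * 1" using 1[of p] Q p T by auto
  qed (use T in \<open>auto intro: Ck_on_const unique_V simp del: Ck_on.simps\<close>)
  then obtain C' where C': "C' \<ge> 0" "\<And>\<psi> B t. t \<in> {0<..T} \<Longrightarrow> Ck_on (Suc N) V \<psi> \<Longrightarrow> tp.supported \<psi> \<Longrightarrow> 0 \<le> B \<Longrightarrow>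
    derivs_le (Suc N) V (K \<times> {0<..T}) \<psi> B \<Longrightarrow> norm (slice_integral K (\<lambda>p. f p * \<psi> p) t) \<le> C' * B"
    by auto
  show ?thesis
    by (rule that[OF tp C'(1) Lfb' fb Q T C'(2)]) (auto simp: tp.supported_def)
qed

text \<open>
  Convergence follows from boundedness applied to \<open>L' \<psi>\<close>: the derivative of the pairing is then
  bounded.
\<close>

lemma smooth_pairing:
  assumes K: "compact K" "K \<subseteq> X" and \<psi>: "smooth_on (X \<times> UNIV) \<psi>"
    "\<And>p. fst p \<in> X \<Longrightarrow> fst p \<notin> K \<Longrightarrow> \<psi> p = 0"
  shows "\<exists>D T. 0 < T \<and> (\<forall>t\<in>{0<..T}. norm (slice_integral K (\<lambda>p. f p * \<psi> p) t) \<le> D)"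
    and "\<exists>l. (slice_integral K (\<lambda>p. f p * \<psi> p) \<longlongrightarrow> l) (at_right 0)"
proof -
  obtain T0 T C D where tp: "transport_problem V K T0 T a f" and C: "0 \<le> C"
    and Lf: "\<And>p. p \<in> K \<times> {0<..T} \<Longrightarrow> norm (vector_field_L V a f p) \<le> D"
    and Q: "K \<times> {0<..T} \<subseteq> V" and T: "0 < T" and D: "0 \<le> D"
    and bd: "\<And>\<psi> B t. t \<in> {0<..T} \<Longrightarrow> Ck_on (Suc N) V \<psi> \<Longrightarrow> (\<And>p. p \<in> V \<Longrightarrow> fst p \<notin> K \<Longrightarrow> \<psi> p = 0) \<Longrightarrow> 0 \<le> B \<Longrightarrow>
      derivs_le (Suc N) V (K \<times> {0<..T}) \<psi> B \<Longrightarrow> norm (slice_integral K (\<lambda>p. f p * \<psi> p) t) \<le> C * B"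
    by (rule plain_pairing_bounded[OF K]) blast
  interpret tp: transport_problem V K T0 T a f by (rule tp)
  have \<psi>C: "Ck_on k V \<psi>" for k
    by (rule Ck_on_subset[OF unique_V V_subset(3)]) (use \<psi>(1) in \<open>simp add: smooth_on_def\<close>)
  have sup: "tp.supported \<psi>" using \<psi>(2) V_subset(3) by (auto simp: tp.supported_def)
  have "K \<times> {0<..T} \<subseteq> K \<times> {0..T}" "K \<times> {0..T} \<subseteq> X \<times> UNIV" using K by auto
  then obtain B where B: "B \<ge> 0" "derivs_le (Suc (Suc N)) V (K \<times> {0<..T}) \<psi> B"
    using derivs_le_compact[OF open_V V_subset(3) Q, of "K \<times> {0..T}" "Suc (Suc N)" \<psi>] \<psi>(1) K
    by (auto simp: smooth_on_def compact_Times simp del: Ck_on.simps derivs_le.simps)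
  show "\<exists>D T. 0 < T \<and> (\<forall>t\<in>{0<..T}. norm (slice_integral K (\<lambda>p. f p * \<psi> p) t) \<le> D)"
    using bd[OF _ \<psi>C _ B(1) derivs_le_SucD[OF B(2)]] sup T unfolding tp.supported_def by blast
  obtain A where A: "A \<ge> 0" "\<And>j. derivs_le (Suc (Suc N)) V (K \<times> {0<..T}) (\<lambda>q. a q $ j) A"
    using tp.a_bounded by metis
  let ?M = "1 + of_nat CARD('n) * 2 ^ Suc (Suc N) * A"
  let ?L = "\<lambda>t. slice_integral K (\<lambda>p. vector_field_L V a f p * \<psi> p * 1) t"
  let ?A = "\<lambda>t. slice_integral K (\<lambda>p. f p * transport_adjoint V a \<psi> p * 1) t"
  let ?N = "\<lambda>t. slice_integral K (\<lambda>p. f p * \<psi> p * vector_field_L V a (\<lambda>_. 1) p) t"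
  note 1 = vector_field_L_const[OF open_V, of _ a 1]
  show "\<exists>l. (slice_integral K (\<lambda>p. f p * \<psi> p) \<longlongrightarrow> l) (at_right 0)"
  proof (rule bounded_derivative_imp_convergent_at_right[OF T])
    fix s assume s: "s \<in> {0<..T}"
    show "(slice_integral K (\<lambda>p. f p * \<psi> p) has_vector_derivative ?L s + ?A s + ?N s) (at s)"
      using tp.pairing_has_derivative[OF \<psi>C sup Ck_on_const[OF unique_V, of 1 1], of s] s tp.T by simp
    have "norm (?A s) \<le> C * (?M * B)"
    proof -
      have "derivs_le (Suc N) V (K \<times> {0<..T}) (transport_adjoint V a \<psi>) (?M * B)"
        by (rule transport_adjoint_derivs_le[OF open_V Q tp.a \<psi>C A(2,1) B(2,1)])
      then show ?thesis
        using bd[OF s transport_adjoint_Ck_on[OF open_V tp.a \<psi>C]] tp.supported_transport_adjoint[OF sup] A B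
        by (simp add: tp.supported_def)
    qed
    moreover have "norm (?L s) \<le> (D * B) * measure lborel K"
    proof (rule slice_integral_norm_le[OF K(1)])
      fix x assume x: "x \<in> K"
      then have "norm (\<psi> (x, s)) \<le> B" using derivs_le_bound[OF B(2), of "(x, s)"] s by auto
      then show "norm (vector_field_L V a f (x, s) * \<psi> (x, s) * 1) \<le> D * B"
        using Lf[of "(x, s)"] x s D by (auto simp: norm_mult intro!: mult_mono)
    qed (use D B in simp)
    moreover have "(x, s) \<in> V" if "x \<in> K" for x using Q s that by auto
    then have "?N s = 0"
      using 1 slice_integral_norm_le[OF K(1), of "\<lambda>p. f p * \<psi> p * vector_field_L V a (\<lambda>_. 1) p" s 0] by auto
    ultimately show "norm (?L s + ?A s + ?N s) \<le> (D * B) * measure lborel K + C * (?M * B)"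
      using norm_triangle_mono by auto
  qed
qed

lemma test_function_smooth_fst:
  assumes "\<phi> \<in> test_functions X"
  shows "smooth_on (X \<times> (UNIV::real set)) (\<lambda>p. \<phi> (fst p))"
  unfolding smooth_on_def
proof (intro allI, rule Ck_on_fst[where S = UNIV])
  show "unique_deriv_set (X \<times> (UNIV::real set))"
    by (intro unique_deriv_set_open open_Times X open_UNIV)
  show "Ck_on k UNIV \<phi>" for k using assms by (simp add: test_functions_def smooth_on_def)
qed simp

lemma slice_integral_test:
  assumes "closure {x. \<phi> x \<noteq> 0} \<subseteq> K"
  shows "slice_integral K (\<lambda>p. f p * \<phi> (fst p)) t = (LINT x|lborel. f (x, t) * \<phi> x)"
proof -
  have "\<phi> x = 0" if "x \<notin> K" for x
    by (rule zero_off_closure_support) (use that assms in auto)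
  then show ?thesis unfolding slice_integral_def set_lebesgue_integral_def
    by (intro Bochner_Integration.integral_cong) (auto simp: indicator_def)
qed

lemma trace_tendsto:
  assumes \<phi>: "\<phi> \<in> test_functions X"
  shows "((\<lambda>t. LINT x|lborel. f (x, t) * \<phi> x) \<longlongrightarrow> boundary_trace f \<phi>) (at_right 0)"
proof -
  let ?K = "closure {x. \<phi> x \<noteq> 0}"
  have K: "compact ?K" "?K \<subseteq> X" using \<phi> by (auto simp: test_functions_def)
  have "\<exists>l. (slice_integral ?K (\<lambda>p. f p * \<phi> (fst p)) \<longlongrightarrow> l) (at_right 0)"
    by (rule smooth_pairing(2)[OF K test_function_smooth_fst[OF \<phi>]]) (rule zero_off_closure_support)
  then obtain l where "(slice_integral ?K (\<lambda>p. f p * \<phi> (fst p)) \<longlongrightarrow> l) (at_right 0)" ..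
  then have "((\<lambda>t. LINT x|lborel. f (x, t) * \<phi> x) \<longlongrightarrow> l) (at_right 0)"
    unfolding slice_integral_test[OF order_refl, of \<phi>] by simp
  moreover from this have "boundary_trace f \<phi> = l"
    unfolding boundary_trace_def by (intro tendsto_Lim) auto
  ultimately show ?thesis by simp
qed

lemma trace_bound:
  assumes K: "compact K" "K \<subseteq> X"
  shows "\<exists>C m. \<forall>\<phi>\<in>test_functions X. closure {x. \<phi> x \<noteq> 0} \<subseteq> K \<longrightarrow>
    norm (boundary_trace f \<phi>) \<le> C * test_seminorm m \<phi>"
proof -
  obtain T0 T C D where C: "0 \<le> C" and T: "0 < T" and Q: "K \<times> {0<..T} \<subseteq> V"
    and bd: "\<And>\<psi> B t. t \<in> {0<..T} \<Longrightarrow> Ck_on (Suc N) V \<psi> \<Longrightarrow> (\<And>p. p \<in> V \<Longrightarrow> fst p \<notin> K \<Longrightarrow> \<psi> p = 0) \<Longrightarrow> 0 \<le> B \<Longrightarrow>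
      derivs_le (Suc N) V (K \<times> {0<..T}) \<psi> B \<Longrightarrow> norm (slice_integral K (\<lambda>p. f p * \<psi> p) t) \<le> C * B"
    by (rule plain_pairing_bounded[OF K]) blast
  have "norm (boundary_trace f \<phi>) \<le> C * test_seminorm (Suc N) \<phi>"
    if \<phi>: "\<phi> \<in> test_functions X" and s: "closure {x. \<phi> x \<noteq> 0} \<subseteq> K" for \<phi>
  proof -
    have sm: "Ck_on k UNIV \<phi>" for k using \<phi> by (simp add: test_functions_def smooth_on_def)
    have B: "0 \<le> test_seminorm (Suc N) \<phi>"
      using deriv_le_test_seminorm[OF \<phi>, of "[]" "Suc N" 0] norm_ge_zero order_trans by (metis empty_set empty_subsetI list.size(3) zero_le)
    have "norm (LINT x|lborel. f (x, t) * \<phi> x) \<le> C * test_seminorm (Suc N) \<phi>" if t: "t \<in> {0<..T}" for t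
    proof -
      have "norm (slice_integral K (\<lambda>p. f p * \<phi> (fst p)) t) \<le> C * test_seminorm (Suc N) \<phi>"
      proof (rule bd[OF t _ _ B])
        show "Ck_on (Suc N) V (\<lambda>p. \<phi> (fst p))" by (rule Ck_on_fst[OF unique_V subset_UNIV sm])
        show "derivs_le (Suc N) V (K \<times> {0<..T}) (\<lambda>p. \<phi> (fst p)) (test_seminorm (Suc N) \<phi>)"
          by (rule derivs_le_fst[OF open_V Q sm B]) (rule deriv_le_test_seminorm[OF \<phi>])
        show "\<phi> (fst p) = 0" if "fst p \<notin> K" for p :: "(real^'n) \<times> real"
          by (rule zero_off_closure_support) (use that s in auto)
      qed
      then show ?thesis by (simp add: slice_integral_test[OF s])
    qed
    then have "\<forall>\<^sub>F t in at_right 0. norm (LINT x|lborel. f (x, t) * \<phi> x) \<le> C * test_seminorm (Suc N) \<phi>"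
      using T unfolding eventually_at_right_field by (intro exI[of _ T]) auto
    then show ?thesis
      by (intro tendsto_upperbound[OF tendsto_norm[OF trace_tendsto[OF \<phi>]]]) auto
  qed
  then show ?thesis by blast
qed

lemma trace_add:
  assumes \<phi>: "\<phi> \<in> test_functions X" and \<psi>: "\<psi> \<in> test_functions X"
  shows "boundary_trace f (\<lambda>x. \<phi> x + \<psi> x) = boundary_trace f \<phi> + boundary_trace f \<psi>"
proof -
  let ?K1 = "closure {x. \<phi> x \<noteq> 0}" and ?K2 = "closure {x. \<psi> x \<noteq> 0}"
  let ?K = "?K1 \<union> ?K2"
  have K: "compact ?K" "?K \<subseteq> X" using \<phi> \<psi> by (auto simp: test_functions_def)
  obtain T0 T C D where tp: "transport_problem V ?K T0 T a f" and T: "0 < T"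
    by (rule plain_pairing_bounded[OF K]) blast
  interpret tp: transport_problem V ?K T0 T a f by (rule tp)
  have c: "continuous_on V (\<lambda>p. f p * \<eta> (fst p))" if "\<eta> \<in> test_functions X" for \<eta>
  proof -
    have "Ck_on 0 UNIV \<eta>" using that by (simp add: test_functions_def smooth_on_def del: Ck_on.simps)
    then have "continuous_on V (\<lambda>p. \<eta> (fst p))"
      by (rule Ck_on_imp_continuous_on[OF Ck_on_fst[OF unique_V subset_UNIV]])
    then show ?thesis by (rule continuous_on_mult[OF Ck_on_1I(2)[OF tp.f]])
  qed
  have z1: "f p * \<phi> (fst p) = 0" if "p \<in> V" "fst p \<notin> ?K" for p
    using zero_off_closure_support[of "fst p" \<phi>] that(2) by (metis UnI1 mult_zero_right)
  have z2: "f p * \<psi> (fst p) = 0" if "p \<in> V" "fst p \<notin> ?K" for p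
    using zero_off_closure_support[of "fst p" \<psi>] that(2) by (metis UnI2 mult_zero_right)
  have "(LINT x|lborel. f (x, t) * (\<phi> x + \<psi> x)) =
      (LINT x|lborel. f (x, t) * \<phi> x) + (LINT x|lborel. f (x, t) * \<psi> x)" if t: "t \<in> {0<..<T}" for t
  proof -
    have "slice_integral ?K (\<lambda>p. f p * (\<phi> (fst p) + \<psi> (fst p))) t =
      slice_integral ?K (\<lambda>p. f p * \<phi> (fst p) + f p * \<psi> (fst p)) t" by (simp add: algebra_simps)
    also have "\<dots> = slice_integral ?K (\<lambda>p. f p * \<phi> (fst p)) t + slice_integral ?K (\<lambda>p. f p * \<psi> (fst p)) t"
      by (rule slice_integral_add[OF open_V K(1) tp.KV c[OF \<phi>] z1 c[OF \<psi>] z2])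
        (use t tp.T in auto)
    also have "slice_integral ?K (\<lambda>p. f p * (\<phi> (fst p) + \<psi> (fst p))) t = (LINT x|lborel. f (x, t) * (\<phi> x + \<psi> x))"
    proof (rule slice_integral_test[where \<phi> = "\<lambda>x. \<phi> x + \<psi> x"])
      have "{x. \<phi> x + \<psi> x \<noteq> 0} \<subseteq> {x. \<phi> x \<noteq> 0} \<union> {x. \<psi> x \<noteq> 0}" by auto
      from closure_mono[OF this] show "closure {x. \<phi> x + \<psi> x \<noteq> 0} \<subseteq> ?K"
        unfolding closure_Un .
    qed
    finally show ?thesis by (simp add: slice_integral_test)
  qed
  then have "\<forall>\<^sub>F t in at_right 0. (LINT x|lborel. f (x, t) * \<phi> x) + (LINT x|lborel. f (x, t) * \<psi> x)
      = (LINT x|lborel. f (x, t) * (\<phi> x + \<psi> x))"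
    using T unfolding eventually_at_right_field by (intro exI[of _ T]) auto
  from Lim_transform_eventually[OF tendsto_add[OF trace_tendsto[OF \<phi>] trace_tendsto[OF \<psi>]] this]
  show ?thesis unfolding boundary_trace_def[of f "\<lambda>x. \<phi> x + \<psi> x"] by (intro tendsto_Lim) auto
qed

lemma trace_scale:
  assumes \<phi>: "\<phi> \<in> test_functions X"
  shows "boundary_trace f (\<lambda>x. c * \<phi> x) = c * boundary_trace f \<phi>"
proof -
  have eq: "(LINT x|lborel. f (x, t) * (c * \<phi> x)) = c * (LINT x|lborel. f (x, t) * \<phi> x)" for t
    by (subst integral_mult_right_zero[symmetric]) (simp add: ac_simps)
  show ?thesis unfolding boundary_trace_def[of f "\<lambda>x. c * \<phi> x"] eq
    by (intro tendsto_Lim tendsto_mult_left trace_tendsto \<phi>) auto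
qed

lemma has_trace: "has_boundary_trace X f"
  unfolding has_boundary_trace_def distribution_def
  using trace_add trace_scale trace_tendsto trace_bound[unfolded test_seminorm_def] by blast

end

section \<open>Bump functions\<close>

lemma Ck_on_bounded_linear:
  fixes h :: "'a::euclidean_space \<Rightarrow> 'b::real_normed_vector"
  assumes "unique_deriv_set S" "bounded_linear h"
  shows "Ck_on k S h"
proof (cases k)
  case 0
  then show ?thesis by (simp add: linear_continuous_on assms(2))
next
  case (Suc k)
  have d: "(h has_derivative h) (at x within S)" for x
    by (rule bounded_linear_imp_has_derivative[OF assms(2)])
  have "Ck_on k S (dir_deriv S v h) = Ck_on k S (\<lambda>x. h v)" for v
    by (rule Ck_on_cong, rule dir_deriv_eqI[OF assms(1) _ d])
  then show ?thesis using Suc d Ck_on_const[OF assms(1)]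
    by (auto simp: differentiable_on_def differentiable_def)
qed

lemma Ck_on_diff:
  fixes f g :: "'a::euclidean_space \<Rightarrow> 'b::real_normed_vector"
  assumes "unique_deriv_set S" "Ck_on k S f" "Ck_on k S g"
  shows "Ck_on k S (\<lambda>x. f x - g x)"
proof -
  have "Ck_on k S (\<lambda>x. - g x)"
    by (rule Ck_on_linear[OF assms(1) _ assms(3)]) (rule bounded_linear_minus[OF bounded_linear_ident])
  from Ck_on_add[OF assms(1,2) this] show ?thesis by simp
qed

text \<open>
  The family \<open>exp (-1/s) / s\<^sup>k\<close> for \<open>s > 0\<close>, extended by zero, is closed under differentiation up to linear
  combinations. So smoothness of all its members, composed with a smooth function, follows by one
  induction.
\<close>

definition flat :: "nat \<Rightarrow> real \<Rightarrow> real" where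
  "flat k s = (if s > 0 then exp (- (1 / s)) / s ^ k else 0)"

text \<open>
  This is \<open>exp (1/s) \<ge> (1/(s m))\<^sup>m\<close> with \<open>m = k + 2\<close>; the factor \<open>s\<^sup>2\<close> makes the derivative at \<open>0\<close>
  vanish.
\<close>

lemma flat_bound: "\<bar>flat k s\<bar> \<le> real (k + 2) ^ (k + 2) * s\<^sup>2"
proof (cases "s > 0")
  case True
  define m where "m = k + 2"
  have "1 / s / real m \<le> exp (1 / s / real m)" using exp_ge_add_one_self[of "1 / s / real m"] by linarith
  then have "(1 / s / real m) ^ m \<le> exp (1 / s / real m) ^ m" using True by (intro power_mono) auto
  also have "\<dots> = exp (1 / s)" by (subst exp_of_nat_mult[symmetric]) (simp add: m_def)
  finally have "1 / (real m ^ m * s ^ m) \<le> exp (1 / s)"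
    by (simp add: power_divide power_mult_distrib mult.commute)
  moreover have "real m ^ m * s ^ m > 0" using True by (simp add: m_def)
  ultimately have "exp (- (1 / s)) \<le> real m ^ m * s ^ m"
    by (simp add: exp_minus divide_simps ac_simps)
  then have "exp (- (1 / s)) / s ^ k \<le> real m ^ m * s ^ m / s ^ k"
    using True by (intro divide_right_mono) auto
  also have "\<dots> = real m ^ m * s\<^sup>2" using True by (simp add: m_def power_add power2_eq_square)
  finally show ?thesis using True by (simp add: flat_def m_def)
qed (simp add: flat_def)

lemma flat_has_derivative:
  "(flat k has_real_derivative (flat (k + 2) s - of_nat k * flat (k + 1) s)) (at s)"
proof -
  consider "s > 0" | "s < 0" | "s = 0" by linarith
  then show ?thesis
  proof cases
    case 1
    have "((\<lambda>s. exp (- (1 / s)) / s ^ k) has_real_derivative (flat (k + 2) s - of_nat k * flat (k + 1) s)) (at s)"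
    proof -
      have "((\<lambda>s. exp (- (1 / s)) / s ^ k) has_real_derivative
          (exp (- (1 / s)) * (1 / s\<^sup>2) * s ^ k - exp (- (1 / s)) * (of_nat k * s ^ (k - 1))) / (s ^ k * s ^ k)) (at s)"
        using 1 by (auto intro!: derivative_eq_intros simp: power2_eq_square)
      moreover have "(exp (- (1 / s)) * (1 / s\<^sup>2) * s ^ k - exp (- (1 / s)) * (of_nat k * s ^ (k - 1))) / (s ^ k * s ^ k)
          = flat (k + 2) s - of_nat k * flat (k + 1) s"
        using 1 by (cases k) (auto simp: flat_def field_simps power2_eq_square)
      ultimately show ?thesis by simp
    qed
    then show ?thesis
      by (rule has_field_derivative_transform_within_open[where S = "{0<..}"]) (use 1 in \<open>auto simp: flat_def\<close>)
  next
    case 2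
    have "((\<lambda>s. 0) has_real_derivative (flat (k + 2) s - of_nat k * flat (k + 1) s)) (at s)"
      using 2 by (simp add: flat_def)
    then show ?thesis
      by (rule has_field_derivative_transform_within_open[where S = "{..<0}"]) (use 2 in \<open>auto simp: flat_def\<close>)
  next
    case 3
    let ?M = "real (k + 2) ^ (k + 2)"
    have "((\<lambda>h. (flat k (0 + h) - flat k 0) / h) \<longlongrightarrow> 0) (at 0)"
    proof (rule Lim_null_comparison)
      show "\<forall>\<^sub>F h in at 0. norm ((flat k (0 + h) - flat k 0) / h) \<le> ?M * \<bar>h\<bar>"
      proof (rule eventually_at_filter[THEN iffD2], rule always_eventually, intro allI impI)
        fix h :: real assume h: "h \<noteq> 0"
        have "\<bar>flat k h\<bar> / \<bar>h\<bar> \<le> ?M * h\<^sup>2 / \<bar>h\<bar>" by (rule divide_right_mono[OF flat_bound]) simp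
        also have "\<dots> = ?M * (h\<^sup>2 / \<bar>h\<bar>)" by simp
        also have "h\<^sup>2 / \<bar>h\<bar> = \<bar>h\<bar>" using h by (auto simp: power2_eq_square abs_if)
        finally show "norm ((flat k (0 + h) - flat k 0) / h) \<le> ?M * \<bar>h\<bar>"
          by (simp only: flat_def[of k 0] real_norm_def abs_divide) simp
      qed
      show "((\<lambda>h. ?M * \<bar>h\<bar>) \<longlongrightarrow> 0) (at 0)" by (auto intro!: tendsto_eq_intros)
    qed
    then show ?thesis using 3 by (simp add: DERIV_def flat_def[of _ 0])
  qed
qed

lemma Ck_on_flat_compose:
  fixes \<rho> :: "'a::euclidean_space \<Rightarrow> real"
  assumes \<rho>: "smooth_on UNIV \<rho>"
  shows "Ck_on m UNIV (\<lambda>x. flat k (\<rho> x))"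
proof (induction m arbitrary: k)
  have d: "((\<lambda>x. flat k (\<rho> x)) has_derivative
      (\<lambda>v. (flat (k + 2) (\<rho> x) - of_nat k * flat (k + 1) (\<rho> x)) * dir_deriv UNIV v \<rho> x)) (at x)" for k x
  proof -
    have "Ck_on (Suc 0) UNIV \<rho>" using \<rho> by (simp only: smooth_on_def)
    then have "(\<rho> has_derivative (\<lambda>v. dir_deriv UNIV v \<rho> x)) (at x)"
      using has_derivative_dir_deriv[of \<rho> UNIV x] by auto
    from has_derivative_compose[OF this flat_has_derivative[of k "\<rho> x", unfolded has_field_derivative_def]]
    show ?thesis by simp
  qed
  {
    case 0
    have "continuous_on UNIV (\<lambda>x. flat k (\<rho> x))"
      using d has_derivative_continuous by (metis continuous_at_imp_continuous_on)
    then show ?case by simp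
  next
    case (Suc m)
    note u = unique_deriv_set_open[OF open_UNIV]
    have "Ck_on m UNIV (dir_deriv UNIV v (\<lambda>x. flat k (\<rho> x)))" if v: "v \<in> Basis" for v
    proof -
      have "Ck_on m UNIV (dir_deriv UNIV v (\<lambda>x. flat k (\<rho> x))) = Ck_on m UNIV
        (\<lambda>x. (flat (k + 2) (\<rho> x) - of_nat k * flat (k + 1) (\<rho> x)) * dir_deriv UNIV v \<rho> x)"
        by (rule Ck_on_cong, rule dir_deriv_eqI[OF u _ d]) simp
      moreover have "Ck_on (Suc m) UNIV \<rho>" using \<rho> by (simp only: smooth_on_def)
      then have "Ck_on m UNIV (dir_deriv UNIV v \<rho>)" using v by simp
      ultimately show ?thesis by (simp add: Ck_on_mult Ck_on_diff Ck_on_const u Suc.IH)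
    qed
    moreover have "(\<lambda>x. flat k (\<rho> x)) differentiable_on UNIV"
      using d unfolding differentiable_on_def differentiable_def by auto
    ultimately show ?case by simp
  }
qed

lemma exists_bump:
  fixes x0 :: "'a::euclidean_space"
  assumes "0 < e" "cball x0 e \<subseteq> X"
  shows "\<exists>\<phi>\<in>test_functions X. \<phi> x0 \<noteq> 0 \<and> closure {x. \<phi> x \<noteq> 0} \<subseteq> cball x0 e"
proof -
  define \<rho> where "\<rho> x = e\<^sup>2 - (\<Sum>b\<in>Basis. (x \<bullet> b - x0 \<bullet> b)\<^sup>2)" for x :: 'a
  have \<rho>: "\<rho> x = e\<^sup>2 - (dist x x0)\<^sup>2" for x
    unfolding \<rho>_def euclidean_dist_l2[of x x0] L2_set_def by (subst real_sqrt_pow2) (auto simp: sum_nonneg dist_real_def)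
  note u = unique_deriv_set_open[OF open_UNIV]
  have sm: "smooth_on UNIV \<rho>"
    unfolding smooth_on_def \<rho>_def[abs_def]
    by (intro allI Ck_on_diff Ck_on_sum Ck_on_power Ck_on_const u Ck_on_bounded_linear bounded_linear_inner_left)
  define \<phi> where "\<phi> x = complex_of_real (flat 0 (\<rho> x))" for x
  have "{x. \<phi> x \<noteq> 0} \<subseteq> cball x0 e"
  proof
    fix x assume "x \<in> {x. \<phi> x \<noteq> 0}"
    then have "(dist x x0)\<^sup>2 < e\<^sup>2" by (auto simp: \<phi>_def flat_def \<rho> split: if_splits)
    then show "x \<in> cball x0 e" using assms(1) by (simp add: dist_commute power2_less_imp_less less_imp_le)
  qed
  then have s: "closure {x. \<phi> x \<noteq> 0} \<subseteq> cball x0 e" by (rule closure_minimal) simp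
  moreover from s have "compact (closure {x. \<phi> x \<noteq> 0})"
    using compact_Int_closed[OF compact_cball closed_closure] by (metis inf.absorb_iff2)
  moreover have "smooth_on UNIV \<phi>"
    unfolding smooth_on_def \<phi>_def[abs_def]
    by (intro allI Ck_on_linear[OF u bounded_linear_of_real] Ck_on_flat_compose sm)
  moreover have "\<phi> x0 \<noteq> 0" using assms(1) by (simp add: \<phi>_def flat_def \<rho>)
  ultimately show ?thesis using assms(2) by (intro bexI[of _ \<phi>]) (auto simp: test_functions_def)
qed

section \<open>Formal solutions of the homogeneous equation\<close>

lemma Taylor_bound:
  fixes g :: "real \<Rightarrow> complex"
  assumes "\<And>m s. m < n \<Longrightarrow> s \<in> {0..t} \<Longrightarrow> (Dg m has_vector_derivative Dg (Suc m) s) (at s within {0..t})"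
    and "Dg 0 = g" and "\<And>s. s \<in> {0..t} \<Longrightarrow> norm (Dg n s) \<le> C" and t: "0 \<le> t"
  shows "norm (g t - (\<Sum>i<n. of_real (t ^ i / fact i) * Dg i 0)) \<le> C * t ^ n"
proof (cases "n = 0")
  case True
  then show ?thesis using assms by auto
next
  case False
  have C: "0 \<le> C" using order_trans[OF norm_ge_zero assms(3)[of 0]] t by simp
  have bd: "norm (((t - s) ^ (n - 1) / fact (n - 1)) *\<^sub>R Dg n s) \<le> t ^ (n - 1) * C" if s: "s \<in> cbox 0 t" for s
  proof -
    have "(t - s) ^ (n - 1) / fact (n - 1) \<le> (t - s) ^ (n - 1)"
      using divide_left_mono[of 1 "fact (n - 1)" "(t - s) ^ (n - 1)"] s by simp
    also have "\<dots> \<le> t ^ (n - 1)" using s by (intro power_mono) auto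
    finally show ?thesis
      using mult_mono[OF _ assms(3)[of s], of "(t - s) ^ (n - 1) / fact (n - 1)" "t ^ (n - 1)"] s t by simp
  qed
  have "((\<lambda>x. ((t - x) ^ (n - 1) / fact (n - 1)) *\<^sub>R Dg n x) has_integral
      g t - (\<Sum>i<n. ((t - 0) ^ i / fact i) *\<^sub>R Dg i 0)) {0..t}"
    by (rule Taylor_has_integral) (use False assms in auto)
  then have "((\<lambda>x. ((t - x) ^ (n - 1) / fact (n - 1)) *\<^sub>R Dg n x) has_integral
      g t - (\<Sum>i<n. ((t - 0) ^ i / fact i) *\<^sub>R Dg i 0)) (cbox 0 t)" by simp
  from has_integral_bound[OF _ this bd] C t
  have "norm (g t - (\<Sum>i<n. ((t - 0) ^ i / fact i) *\<^sub>R Dg i 0)) \<le> (t ^ (n - 1) * C) * t" by simp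
  also have "\<dots> = C * t ^ n" using t False by (cases n) (auto simp: ac_simps)
  finally show ?thesis by (simp add: scaleR_conv_of_real)
qed

lemma dir_deriv_funpow_linear:
  assumes S: "unique_deriv_set S" and g: "smooth_on S g" and v: "v \<in> Basis" and h: "bounded_linear h"
  shows "smooth_on S ((dir_deriv S v ^^ k) g)"
    and "p \<in> S \<Longrightarrow> (dir_deriv S v ^^ k) (\<lambda>p. h (g p)) p = h ((dir_deriv S v ^^ k) g p)"
proof -
  show sm: "smooth_on S ((dir_deriv S v ^^ k) g)" for k
  proof (induction k)
    case (Suc k)
    then have "Ck_on (Suc m) S ((dir_deriv S v ^^ k) g)" for m by (simp only: smooth_on_def)
    then show ?case using v by (simp add: smooth_on_def)
  qed (use g in simp)
  show "(dir_deriv S v ^^ k) (\<lambda>p. h (g p)) p = h ((dir_deriv S v ^^ k) g p)" if "p \<in> S"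
    using that
  proof (induction k arbitrary: p)
    case (Suc k)
    have "Ck_on (Suc 0) S ((dir_deriv S v ^^ k) g)" using sm[of k] by (simp only: smooth_on_def)
    then have d: "((dir_deriv S v ^^ k) g) differentiable_on S" by simp
    have "dir_deriv S v ((dir_deriv S v ^^ k) (\<lambda>p. h (g p))) p
       = dir_deriv S v (\<lambda>p. h ((dir_deriv S v ^^ k) g p)) p"
      by (rule dir_deriv_cong) (use Suc in auto)
    also have "\<dots> = h (dir_deriv S v ((dir_deriv S v ^^ k) g) p)"
      by (rule dir_deriv_linear[OF S d Suc.prems h])
    finally show ?case by simp
  qed simp
qed

declare sum.cong[fundef_cong]

text \<open>
  If \<open>a\<^sub>j\<close> has the expansion \<open>\<Sum>\<^sub>k \<alpha>\<^sub>k\<^sub>j(x) t\<^sup>k\<close>, then \<open>\<Sum>\<^sub>k c\<^sub>k(x) t\<^sup>k\<close> solves \<open>L Z = 0\<close> formally if and only if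
  \<open>(k+1) c\<^sub>k\<^sub>+\<^sub>1 + \<Sum>\<^sub>m\<^sub>\<le>\<^sub>k \<Sum>\<^sub>j \<alpha>\<^sub>k\<^sub>-\<^sub>m\<^sub>,\<^sub>j \<partial>\<^sub>j c\<^sub>m = 0\<close> for all \<open>k\<close>. The initial value is the coordinate \<open>x\<^sub>i\<close>.
\<close>

fun formal_coeff ::
  "(nat \<Rightarrow> 'n \<Rightarrow> (real^'n \<Rightarrow> complex)) \<Rightarrow> (real^'n) set \<Rightarrow> 'n::finite \<Rightarrow> nat \<Rightarrow> real^'n \<Rightarrow> complex" where
  "formal_coeff \<alpha> X i 0 = (\<lambda>x. of_real (x $ i))"
| "formal_coeff \<alpha> X i (Suc k) = (\<lambda>x. - (1 / of_nat (Suc k)) *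
    (\<Sum>m\<le>k. \<Sum>j\<in>UNIV. \<alpha> (k - m) j x * dir_deriv X (axis j 1) (formal_coeff \<alpha> X i m) x))"

lemma smooth_on_formal_coeff:
  fixes X :: "(real^'n) set"
  assumes X: "open X" and \<alpha>: "\<And>k j. smooth_on X (\<alpha> k j)"
  shows "smooth_on X (formal_coeff \<alpha> X i k)"
proof (induction k rule: less_induct)
  case (less k)
  note u = unique_deriv_set_open[OF X]
  show ?case
  proof (cases k)
    case 0
    have "bounded_linear (\<lambda>x::real^'n. complex_of_real (x $ i))"
      by (rule bounded_linear_compose[OF bounded_linear_of_real bounded_linear_vec_nth])
    from Ck_on_bounded_linear[OF u this] show ?thesis using 0 by (simp add: smooth_on_def)
  next
    case (Suc n)
    have "Ck_on r X (dir_deriv X (axis j 1) (formal_coeff \<alpha> X i m))" if "m \<le> n" for r m j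
    proof -
      have "Ck_on (Suc r) X (formal_coeff \<alpha> X i m)" using less[of m] that Suc by (simp add: smooth_on_def)
      then show ?thesis by (simp add: axis_in_Basis)
    qed
    then show ?thesis using \<alpha> unfolding smooth_on_def Suc formal_coeff.simps
      by (intro allI Ck_on_mult Ck_on_sum Ck_on_const u) auto
  qed
qed

definition formal_solution ::
  "(nat \<Rightarrow> 'n \<Rightarrow> (real^'n \<Rightarrow> complex)) \<Rightarrow> (real^'n) set \<Rightarrow> nat \<Rightarrow> 'n::finite \<Rightarrow> (real^'n) \<times> real \<Rightarrow> complex" where
  "formal_solution \<alpha> X M i p = (\<Sum>k\<le>M. formal_coeff \<alpha> X i k (fst p) * of_real (snd p) ^ k)"

lemma bounded_linear_of_real_snd: "bounded_linear (\<lambda>p. complex_of_real (snd p))"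
  by (rule bounded_linear_compose[OF bounded_linear_of_real bounded_linear_snd])

lemma polynomial_in_time:
  fixes V :: "((real^'n) \<times> real) set" and c :: "nat \<Rightarrow> real^'n \<Rightarrow> complex"
  assumes V: "open V" "fst ` V \<subseteq> X" and X: "open X" and c: "\<And>k. k \<in> I \<Longrightarrow> smooth_on X (c k)"
  shows "smooth_on V (\<lambda>p. \<Sum>k\<in>I. c k (fst p) * of_real (snd p) ^ k)"
    and "p \<in> V \<Longrightarrow> dir_deriv V (0, 1) (\<lambda>p. \<Sum>k\<in>I. c k (fst p) * of_real (snd p) ^ k) p
      = (\<Sum>k\<in>I. c k (fst p) * (of_nat k * of_real (snd p) ^ (k - 1)))"
    and "p \<in> V \<Longrightarrow> dir_deriv V (axis j 1, 0) (\<lambda>p. \<Sum>k\<in>I. c k (fst p) * of_real (snd p) ^ k) p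
      = (\<Sum>k\<in>I. dir_deriv X (axis j 1) (c k) (fst p) * of_real (snd p) ^ k)"
proof -
  note u = unique_deriv_set_open[OF V(1)]
  have cs: "Ck_on r V (\<lambda>p. c k (fst p))" if "k \<in> I" for k r
    by (rule Ck_on_fst[OF u V(2)]) (use c[OF that] in \<open>simp add: smooth_on_def\<close>)
  have ts: "Ck_on r V (\<lambda>p. complex_of_real (snd p) ^ k)" for k r
    by (intro Ck_on_power u Ck_on_bounded_linear bounded_linear_of_real_snd)
  show "smooth_on V (\<lambda>p. \<Sum>k\<in>I. c k (fst p) * of_real (snd p) ^ k)"
    unfolding smooth_on_def by (intro allI Ck_on_sum Ck_on_mult u cs ts)
  have cd: "(\<lambda>p. c k (fst p)) differentiable_on V" if "k \<in> I" for k using cs[OF that, of 1] Ck_on_1I(1) by blast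
  have td: "(\<lambda>p. complex_of_real (snd p) ^ k) differentiable_on V" for k using ts[of 1 k] Ck_on_1I(1) by blast
  have cX: "c k differentiable_on X" if "k \<in> I" for k
    using c[OF that] Ck_on_1I(1)[of X "c k"] by (simp only: smooth_on_def)
  have md: "(\<lambda>p. c k (fst p) * complex_of_real (snd p) ^ k) differentiable_on V" if "k \<in> I" for k
    by (intro differentiable_on_mult cd td that)
  assume p: "p \<in> V"
  have dt: "dir_deriv V v (\<lambda>p. complex_of_real (snd p) ^ k) p
      = of_real (snd v) * (of_nat k * of_real (snd p) ^ (k - 1))" for v k
  proof (rule dir_deriv_eqI[OF u p])
    have "((\<lambda>p::(real^'n) \<times> real. complex_of_real (snd p)) has_derivative (\<lambda>v. of_real (snd v))) (at p within V)"
      by (rule bounded_linear_imp_has_derivative[OF bounded_linear_of_real_snd])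
    from has_derivative_power[OF this, of k]
    show "((\<lambda>p. complex_of_real (snd p) ^ k) has_derivative
        (\<lambda>v. of_real (snd v) * (of_nat k * of_real (snd p) ^ (k - 1)))) (at p within V)"
      by (simp add: ac_simps)
  qed
  have dc: "dir_deriv V v (\<lambda>p. c k (fst p)) p = dir_deriv X (fst v) (c k) (fst p)" if "k \<in> I" for k v
    by (rule dir_deriv_compose_linear(2)[OF u bounded_linear_fst V(2) cX[OF that] p])
  have z: "dir_deriv X 0 (c k) (fst p) = 0" if "k \<in> I" for k
  proof -
    have "fst p \<in> X" using V(2) p by auto
    from linear_0[OF has_derivative_linear[OF has_derivative_dir_deriv[OF cX[OF that] this]]] show ?thesis .
  qed
  have S: "dir_deriv V v (\<lambda>p. \<Sum>k\<in>I. c k (fst p) * of_real (snd p) ^ k) p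
      = (\<Sum>k\<in>I. dir_deriv V v (\<lambda>p. c k (fst p) * of_real (snd p) ^ k) p)" for v
    by (rule dir_deriv_sum[OF u md p])
  show "dir_deriv V (0, 1) (\<lambda>p. \<Sum>k\<in>I. c k (fst p) * of_real (snd p) ^ k) p
      = (\<Sum>k\<in>I. c k (fst p) * (of_nat k * of_real (snd p) ^ (k - 1)))"
    unfolding S
    by (intro sum.cong refl) (simp add: dir_deriv_mult[OF u cd td p] dt dc z)
  show "dir_deriv V (axis j 1, 0) (\<lambda>p. \<Sum>k\<in>I. c k (fst p) * of_real (snd p) ^ k) p
      = (\<Sum>k\<in>I. dir_deriv X (axis j 1) (c k) (fst p) * of_real (snd p) ^ k)"
    unfolding S
    by (intro sum.cong refl) (simp add: dir_deriv_mult[OF u cd td p] dt dc)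
qed

lemma triangle_sum:
  fixes g :: "nat \<Rightarrow> nat \<Rightarrow> 'a::comm_monoid_add"
  shows "(\<Sum>k<M. \<Sum>m\<le>k. g m (k - m)) = (\<Sum>m\<le>M. \<Sum>r<M - m. g m r)"
proof (induction M)
  case (Suc M)
  have "(\<Sum>m\<le>Suc M. \<Sum>r<Suc M - m. g m r) = (\<Sum>m\<le>M. \<Sum>r<Suc (M - m). g m r)"
    by (simp add: Suc_diff_le)
  then show ?case using Suc by (simp add: sum.distrib)
qed simp

text \<open>
  The recursion cancels all powers of \<open>t\<close> below \<open>M\<close>. Grouping the rest by \<open>m\<close> leaves \<open>t\<^sup>m\<close> times the
  Taylor remainder of order \<open>M - m\<close> of \<open>a\<^sub>j\<close>, so that every term is \<open>O(t\<^sup>M)\<close>.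
\<close>

lemma vector_field_L_formal_solution:
  fixes V :: "((real^'n) \<times> real) set"
  assumes V: "open V" "fst ` V \<subseteq> X" and X: "open X" and \<alpha>: "\<And>k j. smooth_on X (\<alpha> k j)" and p: "p \<in> V"
  shows "vector_field_L V a (formal_solution \<alpha> X M i) p =
    (\<Sum>j\<in>UNIV. \<Sum>m\<le>M. of_real (snd p) ^ m * dir_deriv X (axis j 1) (formal_coeff \<alpha> X i m) (fst p) *
      (a p $ j - (\<Sum>r<M - m. of_real (snd p) ^ r * \<alpha> r j (fst p))))"
proof -
  define t where "t = complex_of_real (snd p)"
  define x where "x = fst p"
  define D where "D m j = dir_deriv X (axis j 1) (formal_coeff \<alpha> X i m) x" for m j
  note sm = smooth_on_formal_coeff[where \<alpha> = \<alpha>, OF X \<alpha>]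
  note P = polynomial_in_time(2,3)[OF V X sm p, where I = "{..M}", folded t_def x_def]
  have "(\<Sum>k\<le>M. formal_coeff \<alpha> X i k x * (of_nat k * t ^ (k - 1)))
     = (\<Sum>k<M. formal_coeff \<alpha> X i (Suc k) x * (of_nat (Suc k) * t ^ k))"
    by (subst sum.atMost_shift) (simp del: formal_coeff.simps)
  also have "\<dots> = (\<Sum>k<M. - (\<Sum>m\<le>k. \<Sum>j\<in>UNIV. t ^ m * t ^ (k - m) * \<alpha> (k - m) j x * D m j))"
  proof (intro sum.cong refl)
    fix k
    have cancel: "- (1 / of_nat (Suc k)) * s * (of_nat (Suc k) * t ^ k) = - (t ^ k * s)" for s :: complex
      by (simp add: field_simps del: of_nat_Suc)
    have "formal_coeff \<alpha> X i (Suc k) x * (of_nat (Suc k) * t ^ k)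
      = - (t ^ k * (\<Sum>m\<le>k. \<Sum>j\<in>UNIV. \<alpha> (k - m) j x * D m j))"
      unfolding formal_coeff.simps(2) D_def by (rule cancel)
    also have "\<dots> = - (\<Sum>m\<le>k. \<Sum>j\<in>UNIV. t ^ m * t ^ (k - m) * \<alpha> (k - m) j x * D m j)"
      unfolding sum_distrib_left
      by (intro arg_cong[where f = uminus] sum.cong refl) (simp add: power_add[symmetric] mult.assoc)
    finally show "formal_coeff \<alpha> X i (Suc k) x * (of_nat (Suc k) * t ^ k)
      = - (\<Sum>m\<le>k. \<Sum>j\<in>UNIV. t ^ m * t ^ (k - m) * \<alpha> (k - m) j x * D m j)" .
  qed
  also have "\<dots> = - (\<Sum>m\<le>M. \<Sum>r<M - m. \<Sum>j\<in>UNIV. t ^ m * t ^ r * \<alpha> r j x * D m j)"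
    using triangle_sum[of "\<lambda>m r. \<Sum>j\<in>UNIV. t ^ m * t ^ r * \<alpha> r j x * D m j" M] by (simp add: sum_negf)
  also have "\<dots> = - (\<Sum>j\<in>UNIV. \<Sum>m\<le>M. \<Sum>r<M - m. t ^ m * t ^ r * \<alpha> r j x * D m j)"
  proof -
    have "(\<Sum>m\<le>M. \<Sum>r<M - m. \<Sum>j\<in>UNIV. t ^ m * t ^ r * \<alpha> r j x * D m j)
      = (\<Sum>m\<le>M. \<Sum>j\<in>UNIV. \<Sum>r<M - m. t ^ m * t ^ r * \<alpha> r j x * D m j)"
      by (intro sum.cong refl sum.swap)
    also have "\<dots> = (\<Sum>j\<in>UNIV. \<Sum>m\<le>M. \<Sum>r<M - m. t ^ m * t ^ r * \<alpha> r j x * D m j)" by (rule sum.swap)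
    finally show ?thesis by simp
  qed
  finally have 1: "(\<Sum>k\<le>M. formal_coeff \<alpha> X i k x * (of_nat k * t ^ (k - 1)))
     = - (\<Sum>j\<in>UNIV. \<Sum>m\<le>M. \<Sum>r<M - m. t ^ m * t ^ r * \<alpha> r j x * D m j)" .
  have "vector_field_L V a (formal_solution \<alpha> X M i) p =
      (\<Sum>k\<le>M. formal_coeff \<alpha> X i k x * (of_nat k * t ^ (k - 1))) + (\<Sum>j\<in>UNIV. a p $ j * (\<Sum>k\<le>M. D k j * t ^ k))"
    unfolding vector_field_L_def formal_solution_def[abs_def] P D_def ..
  also have "\<dots> = (\<Sum>j\<in>UNIV. \<Sum>m\<le>M. a p $ j * (D m j * t ^ m) - (\<Sum>r<M - m. t ^ m * t ^ r * \<alpha> r j x * D m j))"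
    unfolding 1 by (simp add: sum_subtractf sum_distrib_left)
  also have "\<dots> = (\<Sum>j\<in>UNIV. \<Sum>m\<le>M. t ^ m * D m j * (a p $ j - (\<Sum>r<M - m. t ^ r * \<alpha> r j x)))"
    by (simp add: sum_distrib_left right_diff_distrib ac_simps)
  finally show ?thesis by (simp add: t_def x_def D_def)
qed

lemma formal_coeff_vanish:
  assumes "\<And>k j x. k < l \<Longrightarrow> x \<in> X \<Longrightarrow> \<alpha> k j x = 0" "x \<in> X" "1 \<le> k" "k \<le> l"
  shows "formal_coeff \<alpha> X i k x = 0"
  using assms by (cases k) auto

text \<open>
  When \<open>a\<close> vanishes to order \<open>l\<close>, only \<open>m = 0\<close> survives in the recursion for the coefficient of \<open>t\<^sup>l\<^sup>+\<^sup>1\<close>, and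
  the gradient of the coordinate \<open>x\<^sub>i\<close> picks out \<open>a\<^sub>i\<close>.
\<close>

lemma formal_coeff_leading:
  fixes X :: "(real^'n) set"
  assumes X: "open X" and z: "\<And>k j x. k < l \<Longrightarrow> x \<in> X \<Longrightarrow> \<alpha> k j x = 0" and x: "x \<in> X"
  shows "formal_coeff \<alpha> X i (Suc l) x = - \<alpha> l i x / of_nat (Suc l)"
proof -
  have d: "dir_deriv X (axis j 1) (\<lambda>x. of_real (x $ i)) x = (if j = i then 1 else (0::complex))" for j
  proof -
    have "bounded_linear (\<lambda>x::real^'n. complex_of_real (x $ i))"
      by (rule bounded_linear_compose[OF bounded_linear_of_real bounded_linear_vec_nth])
    from dir_deriv_eqI[OF unique_deriv_set_open[OF X] x bounded_linear_imp_has_derivative[OF this]]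
    show ?thesis by (simp add: axis_def)
  qed
  have "(\<Sum>m\<le>l. \<Sum>j\<in>UNIV. \<alpha> (l - m) j x * dir_deriv X (axis j 1) (formal_coeff \<alpha> X i m) x)
    = (\<Sum>m\<in>{0}. \<Sum>j\<in>UNIV. \<alpha> (l - m) j x * dir_deriv X (axis j 1) (formal_coeff \<alpha> X i m) x)"
    by (rule sum.mono_neutral_right) (use z x in auto)
  also have "\<dots> = \<alpha> l i x"
    by (simp add: d if_distrib cong: if_cong)
  finally show ?thesis by simp
qed

section \<open>Microlocal decay\<close>

text \<open>
  An exponential \<open>exp (-c s y)\<close> with \<open>s = t\<^sup>d\<close> turns powers of \<open>s\<close> into inverse powers of \<open>1 + y\<close>. As
  \<open>s \<le> 1\<close>, one has \<open>s (1 + y) \<le> 1 + s y\<close>, and powers of \<open>1 + s y\<close> are dominated by \<open>exp (c s y)\<close>. This form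
  treats small and large \<open>y\<close> alike.
\<close>

lemma exp_weight:
  fixes c :: real
  assumes c: "c > 0"
  shows "\<exists>C\<ge>0. \<forall>t y. 0 \<le> t \<longrightarrow> t \<le> 1 \<longrightarrow> 0 \<le> y \<longrightarrow>
    (t ^ d) ^ r * exp (- c * t ^ d * y) \<le> C / (1 + y) ^ r"
proof -
  \<comment> \<open>Chosen so that \<open>1 + u \<le> k (1 + c u / (r + 1))\<close> for \<open>u \<ge> 0\<close>; using \<open>r + 1\<close> avoids division by zero.\<close>
  define k where "k = max 1 (real (Suc r) / c)"
  have k: "k \<ge> 1" "k > 0" by (auto simp: k_def)
  have "(t ^ d) ^ r * exp (- c * t ^ d * y) \<le> k ^ r / (1 + y) ^ r" if t: "0 \<le> t" "t \<le> 1" and y: "0 \<le> y" for t y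
  proof -
    define s where "s = t ^ d"
    have s: "0 \<le> s" "s \<le> 1" using t by (auto simp: s_def power_le_one)
    define v where "v = c * (s * y) / real (Suc r)"
    have v: "v \<ge> 0" using c s y by (simp add: v_def)
    have "s * y = real (Suc r) / c * v" using c by (simp add: v_def del: of_nat_Suc)
    also have "\<dots> \<le> k * v" using v by (intro mult_right_mono) (auto simp: k_def)
    finally have "s * (1 + y) \<le> k * (1 + v)" using s k by (simp add: algebra_simps)
    also have "\<dots> \<le> k * exp v" using k exp_ge_add_one_self[of v] by simp
    finally have "(s * (1 + y)) ^ r \<le> (k * exp v) ^ r" using s y by (intro power_mono) auto
    also have "\<dots> = k ^ r * exp (real r * v)" by (simp add: power_mult_distrib exp_of_nat_mult)
    also have "real r * v \<le> c * s * y"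
    proof -
      have "real r * v \<le> real (Suc r) * v" using v by (intro mult_right_mono) auto
      then show ?thesis by (simp add: v_def del: of_nat_Suc)
    qed
    finally have "(s * (1 + y)) ^ r \<le> k ^ r * exp (c * s * y)" using k by simp
    then show ?thesis using y unfolding s_def[symmetric]
      by (simp add: exp_minus divide_simps power_mult_distrib add_pos_nonneg)
  qed
  then show ?thesis using k by (intro exI[of _ "k ^ r"]) auto
qed

lemma vector_field_L_exp:
  fixes V :: "((real^'n) \<times> real) set"
  assumes V: "open V" and p: "p \<in> V" and g: "\<And>i. i \<in> I \<Longrightarrow> g i differentiable_on V"
  shows "vector_field_L V a (\<lambda>p. exp (\<Sum>i\<in>I. c i * g i p)) p =
    exp (\<Sum>i\<in>I. c i * g i p) * (\<Sum>i\<in>I. c i * vector_field_L V a (g i) p)"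
proof -
  note u = unique_deriv_set_open[OF V]
  have cg: "(\<lambda>p. c i * g i p) differentiable_on V" if "i \<in> I" for i
    by (intro differentiable_on_mult g that) simp
  have s: "(\<lambda>p. \<Sum>i\<in>I. c i * g i p) differentiable_on V"
  proof -
    have "((\<lambda>p. \<Sum>i\<in>I. c i * g i p) has_derivative (\<lambda>v. \<Sum>i\<in>I. dir_deriv V v (\<lambda>p. c i * g i p) x)) (at x within V)"
      if "x \<in> V" for x by (intro has_derivative_sum has_derivative_dir_deriv cg that)
    then show ?thesis unfolding differentiable_on_def differentiable_def by blast
  qed
  have D: "dir_deriv V v (\<lambda>p. exp (\<Sum>i\<in>I. c i * g i p)) p =
      exp (\<Sum>i\<in>I. c i * g i p) * (\<Sum>i\<in>I. c i * dir_deriv V v (g i) p)" for v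
  proof -
    have "dir_deriv V v (\<lambda>p. \<Sum>i\<in>I. c i * g i p) p = (\<Sum>i\<in>I. dir_deriv V v (\<lambda>p. c i * g i p) p)"
      by (rule dir_deriv_sum[OF u cg p])
    also have "\<dots> = (\<Sum>i\<in>I. c i * dir_deriv V v (g i) p)"
      by (intro sum.cong refl dir_deriv_linear[OF u g p bounded_linear_mult_right])
    finally show ?thesis unfolding dir_deriv_exp[OF u s p] by simp
  qed
  have "(\<Sum>j\<in>UNIV. a p $ j * (exp (\<Sum>i\<in>I. c i * g i p) * (\<Sum>i\<in>I. c i * dir_deriv V (axis j 1, 0) (g i) p)))
    = exp (\<Sum>i\<in>I. c i * g i p) * (\<Sum>i\<in>I. c i * (\<Sum>j\<in>UNIV. a p $ j * dir_deriv V (axis j 1, 0) (g i) p))"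
    unfolding sum_distrib_left by (subst sum.swap) (simp add: ac_simps)
  then show ?thesis unfolding vector_field_L_def D
    by (simp add: distrib_left sum.distrib)
qed

lemma slice_integral_time_factor:
  "slice_integral K (\<lambda>p. h (snd p) * g p) t = h t * slice_integral K g t"
  unfolding slice_integral_def set_lebesgue_integral_def
  by (subst integral_mult_right_zero[symmetric]) (simp add: mult_scaleR_right)

lemma smooth_bounded_on_compact:
  assumes "smooth_on X g" "compact K" "K \<subseteq> X"
  shows "\<exists>C\<ge>0. \<forall>x\<in>K. norm (g x) \<le> C"
proof -
  have "Ck_on 0 X g" using assms(1) by (simp only: smooth_on_def)
  then have "bounded (g ` K)"
    using compact_continuous_image[OF continuous_on_subset[OF _ assms(3)] assms(2)] compact_imp_bounded by auto
  then obtain B where "\<And>x. x \<in> K \<Longrightarrow> norm (g x) \<le> B" by (auto simp: bounded_iff)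
  then show ?thesis by (intro exI[of _ "max B 0"]) (auto simp: le_max_iff_disj)
qed

context boundary_problem
begin

definition taylor_coeff :: "nat \<Rightarrow> 'n \<Rightarrow> real^'n \<Rightarrow> complex" where
  "taylor_coeff k j x = of_real (1 / fact k) * (dir_deriv S (0, 1) ^^ k) (\<lambda>p. a p $ j) (x, 0)"

lemma smooth_a_component: "smooth_on S (\<lambda>p. a p $ j)"
  unfolding smooth_on_def using a_component by blast

lemma smooth_taylor_coeff: "smooth_on X (taylor_coeff k j)"
  unfolding smooth_on_def
proof
  fix m
  have "Ck_on m S ((dir_deriv S (0, 1) ^^ k) (\<lambda>p. a p $ j))"
    using dir_deriv_funpow_linear(1)[OF unique_S smooth_a_component time_direction_in_Basis bounded_linear_ident]
    by (simp only: smooth_on_def)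
  then have "Ck_on m X (\<lambda>x. (dir_deriv S (0, 1) ^^ k) (\<lambda>p. a p $ j) (x, 0))"
    by (intro Ck_on_compose_linear[where A = "\<lambda>x. (x, 0)" and S = S] unique_X
        bounded_linear_Pair bounded_linear_ident bounded_linear_zero)
      (auto simp: S_def Basis_prod_def)
  then show "Ck_on m X (taylor_coeff k j)"
    unfolding taylor_coeff_def[abs_def] by (intro Ck_on_mult Ck_on_const unique_X)
qed

lemma taylor_coeff_component:
  assumes "x \<in> X"
  shows "taylor_coeff k j x = of_real (1 / fact k) * (dir_deriv S (0, 1) ^^ k) a (x, 0) $ j"
proof -
  have "smooth_on S a" using a by (simp add: S_def)
  from dir_deriv_funpow_linear(2)[OF unique_S this time_direction_in_Basis bounded_linear_vec_nth, of "(x, 0)"]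
  show ?thesis using assms by (simp add: taylor_coeff_def S_def)
qed

lemma taylor_remainder:
  assumes K: "compact K" "K \<subseteq> X" and Q: "K \<times> {0<..T} \<subseteq> V"
  shows "\<exists>C\<ge>0. \<forall>x\<in>K. \<forall>t\<in>{0<..T}. norm (a (x, t) $ j - (\<Sum>r<n. of_real t ^ r * taylor_coeff r j x)) \<le> C * t ^ n"
proof -
  let ?D = "\<lambda>m. (dir_deriv S (0, 1) ^^ m) (\<lambda>p. a p $ j)"
  have sm: "smooth_on S (?D m)" for m
    by (rule dir_deriv_funpow_linear(1)[OF unique_S smooth_a_component time_direction_in_Basis bounded_linear_ident])
  have KS: "(x, s) \<in> S" if "x \<in> K" "s \<in> {0..T}" for x s
  proof (cases "s = 0")
    case True then show ?thesis using that K by (auto simp: S_def)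
  next
    case False
    then have "(x, s) \<in> V" using Q that by auto
    then show ?thesis using V_subset by auto
  qed
  have "compact (K \<times> {0..T})" "K \<times> {0..T} \<subseteq> S" using K KS by (auto intro: compact_Times)
  from smooth_bounded_on_compact[OF sm this, of n] obtain C where C: "C \<ge> 0"
    "\<And>p. p \<in> K \<times> {0..T} \<Longrightarrow> norm (?D n p) \<le> C" by auto
  have "norm (a (x, t) $ j - (\<Sum>r<n. of_real t ^ r * taylor_coeff r j x)) \<le> C * t ^ n"
    if x: "x \<in> K" and t: "t \<in> {0<..T}" for x t
  proof -
    have "norm (a (x, t) $ j - (\<Sum>i<n. of_real (t ^ i / fact i) * ?D i (x, 0))) \<le> C * t ^ n"
    proof (rule Taylor_bound[where g = "\<lambda>t. a (x, t) $ j" and Dg = "\<lambda>m s. ?D m (x, s)"])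
      fix m s assume s: "s \<in> {0..t}"
      have "Ck_on 1 S (?D m)" using sm[of m] by (simp only: smooth_on_def)
      then have d: "?D m differentiable_on S" by (rule Ck_on_1I)
      have "(x, s) \<in> S" using KS x s t by auto
      from has_derivative_dir_deriv[OF d this]
      have 1: "(?D m has_derivative (\<lambda>v. dir_deriv S v (?D m) (x, s))) (at (x, s) within (Pair x) ` {0..t})"
        by (rule has_derivative_subset) (use KS x t in auto)
      have "(Pair x has_derivative (\<lambda>r. (0, r))) (at s within {0..t})"
        by (auto intro!: derivative_eq_intros)
      from has_derivative_in_compose[OF this 1]
      have "((\<lambda>s. ?D m (x, s)) has_derivative (\<lambda>r. dir_deriv S (0, r) (?D m) (x, s))) (at s within {0..t})" .
      moreover have "(\<lambda>r. dir_deriv S (0, r) (?D m) (x, s)) = (\<lambda>r. r *\<^sub>R dir_deriv S (0, 1) (?D m) (x, s))"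
      proof
        fix r :: real
        show "dir_deriv S (0, r) (?D m) (x, s) = r *\<^sub>R dir_deriv S (0, 1) (?D m) (x, s)"
          using linear_scale[OF has_derivative_linear[OF has_derivative_dir_deriv[OF d \<open>(x, s) \<in> S\<close>]], of r "(0, 1)"] by simp
      qed
      ultimately show "((\<lambda>s. ?D m (x, s)) has_vector_derivative ?D (Suc m) (x, s)) (at s within {0..t})"
        by (simp add: has_vector_derivative_def)
    qed (use t x C in auto)
    moreover have "(\<Sum>i<n. of_real (t ^ i / fact i) * ?D i (x, 0)) = (\<Sum>r<n. of_real t ^ r * taylor_coeff r j x)"
      by (simp add: taylor_coeff_def)
    ultimately show ?thesis by simp
  qed
  then show ?thesis using C(1) by blast
qed

abbreviation Z :: "nat \<Rightarrow> 'n \<Rightarrow> (real^'n) \<times> real \<Rightarrow> complex" where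
  "Z M \<equiv> formal_solution taylor_coeff X M"

lemmas smooth_coeff = smooth_on_formal_coeff[where \<alpha> = taylor_coeff, OF X smooth_taylor_coeff]

lemma smooth_coeff_deriv: "smooth_on X (dir_deriv X (axis j 1) (formal_coeff taylor_coeff X i k))"
proof -
  have "Ck_on (Suc r) X (formal_coeff taylor_coeff X i k)" for r
    using smooth_coeff by (simp only: smooth_on_def)
  then show ?thesis by (simp add: smooth_on_def axis_in_Basis)
qed

lemma fst_V: "fst ` V \<subseteq> X" using V_subset(3) by auto

lemma Z_smooth: "smooth_on V (Z M i)"
  unfolding formal_solution_def[abs_def]
  by (rule polynomial_in_time(1)[OF open_V fst_V X smooth_coeff])

lemma L_Z_bound:
  assumes K: "compact K" "K \<subseteq> X" and Q: "K \<times> {0<..T} \<subseteq> V"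
  shows "\<exists>C\<ge>0. \<forall>i. \<forall>p\<in>K \<times> {0<..T}. norm (vector_field_L V a (Z M i) p) \<le> C * snd p ^ M"
proof -
  have "\<forall>j m. \<exists>A. A \<ge> 0 \<and> (\<forall>x\<in>K. \<forall>t\<in>{0<..T}.
      norm (a (x, t) $ j - (\<Sum>r<M - m. of_real t ^ r * taylor_coeff r j x)) \<le> A * t ^ (M - m))"
    using taylor_remainder[OF K Q] by blast
  then obtain A where A: "\<And>j m. A j m \<ge> 0" "\<And>j m x t. x \<in> K \<Longrightarrow> t \<in> {0<..T} \<Longrightarrow>
      norm (a (x, t) $ j - (\<Sum>r<M - m. of_real t ^ r * taylor_coeff r j x)) \<le> A j m * t ^ (M - m)"
    unfolding choice_iff by blast
  have "\<forall>i m j. \<exists>B. B \<ge> 0 \<and> (\<forall>x\<in>K. norm (dir_deriv X (axis j 1) (formal_coeff taylor_coeff X i m) x) \<le> B)"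
    using smooth_bounded_on_compact[OF smooth_coeff_deriv K] by blast
  then obtain B where B: "\<And>i m j. B i m j \<ge> 0"
    "\<And>i m j x. x \<in> K \<Longrightarrow> norm (dir_deriv X (axis j 1) (formal_coeff taylor_coeff X i m) x) \<le> B i m j"
    unfolding choice_iff by blast
  define C where "C i = (\<Sum>j\<in>UNIV. \<Sum>m\<le>M. B i m j * A j m)" for i
  have C0: "C i \<ge> 0" for i unfolding C_def by (intro sum_nonneg mult_nonneg_nonneg A B)
  have "norm (vector_field_L V a (Z M i) p) \<le> (\<Sum>i\<in>UNIV. C i) * snd p ^ M" if p: "p \<in> K \<times> {0<..T}" for i p
  proof -
    obtain x t where xt: "p = (x, t)" "x \<in> K" "t \<in> {0<..T}" using p by auto
    have pV: "p \<in> V" using Q p by auto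
    have "norm (vector_field_L V a (Z M i) p) \<le> (\<Sum>j\<in>UNIV. \<Sum>m\<le>M. B i m j * A j m * t ^ M)"
      unfolding vector_field_L_formal_solution[where \<alpha> = taylor_coeff, OF open_V fst_V X smooth_taylor_coeff pV]
    proof (intro sum_norm_le)
      fix j m assume m: "m \<in> {..M}"
      have "norm (of_real t ^ m * dir_deriv X (axis j 1) (formal_coeff taylor_coeff X i m) x *
          (a (x, t) $ j - (\<Sum>r<M - m. of_real t ^ r * taylor_coeff r j x)))
        \<le> (t ^ m * B i m j) * (A j m * t ^ (M - m))"
        unfolding norm_mult using xt A B by (intro mult_mono) (auto simp: norm_power)
      also have "\<dots> = B i m j * A j m * (t ^ m * t ^ (M - m))" by simp
      also have "t ^ m * t ^ (M - m) = t ^ M" using m by (simp add: power_add[symmetric])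
      finally show "norm (of_real (snd p) ^ m * dir_deriv X (axis j 1) (formal_coeff taylor_coeff X i m) (fst p) *
          (a p $ j - (\<Sum>r<M - m. of_real (snd p) ^ r * taylor_coeff r j (fst p))))
        \<le> B i m j * A j m * t ^ M" using xt by simp
    qed
    also have "\<dots> = C i * t ^ M" by (simp add: C_def sum_distrib_right)
    also have "\<dots> \<le> (\<Sum>i\<in>UNIV. C i) * t ^ M"
      using C0 xt by (intro mult_right_mono member_le_sum) auto
    finally show ?thesis using xt by simp
  qed
  then show ?thesis using C0 by (intro exI[of _ "\<Sum>i\<in>UNIV. C i"]) (auto intro: sum_nonneg)
qed

text \<open>
  The coefficient of \<open>t\<^sup>0\<close> is the real number \<open>x\<^sub>i\<close> and those of \<open>t, ..., t\<^sup>l\<close> vanish, so the imaginary part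
  starts with \<open>t\<^sup>l\<^sup>+\<^sup>1\<close>.
\<close>

lemma Im_Z_bound:
  assumes K: "compact K" "K \<subseteq> X" and l: "\<And>k j x. k < l \<Longrightarrow> x \<in> X \<Longrightarrow> taylor_coeff k j x = 0"
    and M: "Suc l \<le> M"
  shows "\<exists>C\<ge>0. \<forall>i. \<forall>x\<in>K. \<forall>t\<in>{0..1}.
    \<bar>Im (Z M i (x, t)) + t ^ Suc l * (Im (taylor_coeff l i x) / of_nat (Suc l))\<bar> \<le> C * t ^ (l + 2)"
proof -
  let ?c = "\<lambda>i k. formal_coeff taylor_coeff X i k"
  have "\<forall>i k. \<exists>B. B \<ge> 0 \<and> (\<forall>x\<in>K. norm (?c i k x) \<le> B)"
    using smooth_bounded_on_compact[OF smooth_coeff K] by blast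
  then obtain B where B: "\<And>i k. B i k \<ge> 0" "\<And>i k x. x \<in> K \<Longrightarrow> norm (?c i k x) \<le> B i k"
    unfolding choice_iff by blast
  define C where "C = (\<Sum>i\<in>UNIV. \<Sum>k\<in>{l+2..M}. B i k)"
  have C0: "C \<ge> 0" unfolding C_def by (intro sum_nonneg B)
  have "\<bar>Im (Z M i (x, t)) + t ^ Suc l * (Im (taylor_coeff l i x) / of_nat (Suc l))\<bar> \<le> C * t ^ (l + 2)"
    if x: "x \<in> K" and t: "t \<in> {0..1}" for i x t
  proof -
    have xX: "x \<in> X" using x K by auto
    let ?g = "\<lambda>k. ?c i k x * of_real t ^ k"
    have "Z M i (x, t) = (\<Sum>k\<le>M. ?g k)" by (simp add: formal_solution_def)
    also have "{..M} = {0..l} \<union> ({Suc l} \<union> {l+2..M})" using M by auto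
    also have "(\<Sum>k\<in>\<dots>. ?g k) = (\<Sum>k\<in>{0..l}. ?g k) + (?g (Suc l) + (\<Sum>k\<in>{l+2..M}. ?g k))"
      by (subst sum.union_disjoint; (subst sum.union_disjoint)?) auto
    also have "(\<Sum>k\<in>{0..l}. ?g k) = (\<Sum>k\<in>{0}. ?g k)"
      by (rule sum.mono_neutral_right)
        (use formal_coeff_vanish[of l X taylor_coeff x, OF l xX] in auto)
    also have "(\<Sum>k\<in>{0}. ?g k) = of_real (x $ i)" by simp
    also have "?g (Suc l) = - of_real (t ^ Suc l) * taylor_coeff l i x / of_nat (Suc l)"
      by (simp add: formal_coeff_leading[where \<alpha> = taylor_coeff, OF X l xX] del: formal_coeff.simps)
    finally have "Im (Z M i (x, t)) = - (t ^ Suc l * (Im (taylor_coeff l i x) / of_nat (Suc l))) + Im (\<Sum>k\<in>{l+2..M}. ?g k)"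
      by (simp del: formal_coeff.simps of_nat_Suc power_Suc add: Im_divide_of_nat mult.assoc)
    then have "\<bar>Im (Z M i (x, t)) + t ^ Suc l * (Im (taylor_coeff l i x) / of_nat (Suc l))\<bar> \<le> norm (\<Sum>k\<in>{l+2..M}. ?g k)"
      using abs_Im_le_cmod[of "\<Sum>k\<in>{l+2..M}. ?g k"] by simp
    also have "\<dots> \<le> (\<Sum>k\<in>{l+2..M}. B i k * t ^ (l + 2))"
    proof (rule sum_norm_le)
      fix k assume k: "k \<in> {l+2..M}"
      have "t ^ k \<le> t ^ (l + 2)" using t k by (intro power_decreasing) auto
      then show "norm (?g k) \<le> B i k * t ^ (l + 2)"
        unfolding norm_mult using B x t by (intro mult_mono) (auto simp: norm_power)
    qed
    also have "\<dots> = (\<Sum>k\<in>{l+2..M}. B i k) * t ^ (l + 2)" by (simp only: sum_distrib_right)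
    also have "\<dots> \<le> C * t ^ (l + 2)"
    proof (rule mult_right_mono)
      show "(\<Sum>k\<in>{l+2..M}. B i k) \<le> C" unfolding C_def
        by (rule member_le_sum) (auto intro: sum_nonneg B)
    qed (use t in simp)
    finally show ?thesis .
  qed
  then show ?thesis using C0 by blast
qed

text \<open>
  The oscillating factor \<open>exp (-i \<xi> \<cdot> Z)\<close>, a deformation of \<open>exp (-i \<xi> \<cdot> x)\<close> along which \<open>L\<close> is small.
\<close>

definition oscillation :: "nat \<Rightarrow> real^'n \<Rightarrow> (real^'n) \<times> real \<Rightarrow> complex" where
  "oscillation M \<xi> p = exp (\<Sum>i\<in>UNIV. - (\<i> * of_real (\<xi> $ i)) * Z M i p)"

lemma Ck_on_oscillation: "Ck_on k V (oscillation M \<xi>)"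
  unfolding oscillation_def[abs_def] using Z_smooth
  by (intro Ck_on_exp Ck_on_sum Ck_on_mult Ck_on_const unique_V) (simp_all add: smooth_on_def)

lemma norm_oscillation: "norm (oscillation M \<xi> p) = exp (\<Sum>i\<in>UNIV. \<xi> $ i * Im (Z M i p))"
  by (simp add: oscillation_def norm_exp_eq_Re Re_sum)

lemma vector_field_L_oscillation:
  assumes "p \<in> V"
  shows "vector_field_L V a (oscillation M \<xi>) p = oscillation M \<xi> p * (\<Sum>i\<in>UNIV. - (\<i> * of_real (\<xi> $ i)) * vector_field_L V a (Z M i) p)"
proof -
  have "Ck_on 1 V (Z M i)" for i using Z_smooth by (simp only: smooth_on_def)
  then have "Z M i differentiable_on V" for i by (rule Ck_on_1I)
  then show ?thesis unfolding oscillation_def[abs_def] by (rule vector_field_L_exp[OF open_V assms])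
qed

lemma modulated_test_function:
  assumes "\<phi> \<in> test_functions X"
  shows "(\<lambda>x. \<phi> x * exp (- (\<i> * of_real (x \<bullet> \<xi>)))) \<in> test_functions X"
    and "closure {x. \<phi> x * exp (- (\<i> * of_real (x \<bullet> \<xi>))) \<noteq> 0} = closure {x. \<phi> x \<noteq> 0}"
proof -
  note u = unique_deriv_set_open[OF open_UNIV]
  have "bounded_linear (\<lambda>x. - (\<i> * complex_of_real (x \<bullet> \<xi>)))"
    by (intro bounded_linear_minus bounded_linear_compose[OF bounded_linear_mult_right]
       bounded_linear_compose[OF bounded_linear_of_real] bounded_linear_inner_left)
  then have "Ck_on k UNIV (\<lambda>x. exp (- (\<i> * complex_of_real (x \<bullet> \<xi>))))" for k
    by (intro Ck_on_exp Ck_on_bounded_linear u)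
  then have "smooth_on UNIV (\<lambda>x. \<phi> x * exp (- (\<i> * of_real (x \<bullet> \<xi>))))"
    using assms by (auto simp: smooth_on_def test_functions_def intro!: Ck_on_mult u)
  then show "(\<lambda>x. \<phi> x * exp (- (\<i> * of_real (x \<bullet> \<xi>)))) \<in> test_functions X"
    using assms by (simp add: test_functions_def)
  show "closure {x. \<phi> x * exp (- (\<i> * of_real (x \<bullet> \<xi>))) \<noteq> 0} = closure {x. \<phi> x \<noteq> 0}" by simp
qed

text \<open>
  As \<open>f\<close> may grow like \<open>t\<^sup>-\<^sup>N\<close>, convergence of \<open>E\<close> to \<open>exp (-i x \<cdot> \<xi>)\<close> is not sufficient by itself. Write
  \<open>E = exp (-i x \<cdot> \<xi>) exp (t w)\<close> and expand the second factor up to order \<open>N\<close>. The term of order \<open>k\<close> is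
  \<open>t\<^sup>k\<close> times a pairing with a smooth function, which is bounded by \<open>smooth_pairing\<close>, and the remainder
  \<open>O(t\<^sup>N\<^sup>+\<^sup>1)\<close> beats the growth of \<open>f\<close>. Only \<open>k = 0\<close> contributes to the limit.
\<close>

lemma oscillation_pairing_tendsto:
  assumes \<phi>: "\<phi> \<in> test_functions X"
  defines "K \<equiv> closure {x. \<phi> x \<noteq> 0}"
  shows "(slice_integral K (\<lambda>p. f p * \<phi> (fst p) * oscillation M \<xi> p) \<longlongrightarrow>
    boundary_trace f (\<lambda>x. \<phi> x * exp (- (\<i> * of_real (x \<bullet> \<xi>))))) (at_right 0)"
proof -
  have K: "compact K" "K \<subseteq> X" using \<phi> by (auto simp: K_def test_functions_def)
  have \<phi>0: "\<phi> x = 0" if "x \<notin> K" for x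
    using zero_off_closure_support that unfolding K_def .
  define e where "e x = exp (- (\<i> * complex_of_real (x \<bullet> \<xi>)))" for x
  define \<eta> where "\<eta> x = \<phi> x * e x" for x
  have \<eta>: "\<eta> \<in> test_functions X" and s\<eta>: "closure {x. \<eta> x \<noteq> 0} \<subseteq> K"
    using modulated_test_function[OF \<phi>] by (simp_all add: \<eta>_def[abs_def] e_def K_def)
  have \<eta>0: "\<eta> x = 0" if "x \<notin> K" for x using \<phi>0[OF that] by (simp add: \<eta>_def)
  define w where "w p = (\<Sum>i\<in>UNIV. - (\<i> * of_real (\<xi> $ i)) *
     (\<Sum>k<M. formal_coeff taylor_coeff X i (Suc k) (fst p) * of_real (snd p) ^ k))" for p :: "(real^'n) \<times> real"
  have oX: "open (X \<times> (UNIV::real set))" using X by (simp add: open_Times)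
  note uX = unique_deriv_set_open[OF oX]
  have "smooth_on (X \<times> UNIV) (\<lambda>p. \<Sum>k<M. formal_coeff taylor_coeff X i (Suc k) (fst p) * of_real (snd p) ^ k)" for i
    by (rule polynomial_in_time(1)[OF oX _ X smooth_coeff]) auto
  then have q: "Ck_on r (X \<times> UNIV) (\<lambda>p. \<Sum>k<M. formal_coeff taylor_coeff X i (Suc k) (fst p) * of_real (snd p) ^ k)" for i r
    by (simp only: smooth_on_def)
  have wS: "Ck_on k (X \<times> UNIV) w" for k
    unfolding w_def[abs_def] by (rule Ck_on_sum[OF uX Ck_on_mult[OF uX Ck_on_const[OF uX] q]])
  have E: "oscillation M \<xi> p = e (fst p) * exp (of_real (snd p) * w p)" for p
  proof -
    have Zp: "Z M i p = of_real (fst p $ i) + of_real (snd p) *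
        (\<Sum>k<M. formal_coeff taylor_coeff X i (Suc k) (fst p) * of_real (snd p) ^ k)" for i
      unfolding formal_solution_def
      by (subst sum.atMost_shift) (simp add: sum_distrib_left ac_simps del: formal_coeff.simps(2))
    have "(\<Sum>i\<in>UNIV. - (\<i> * of_real (\<xi> $ i)) * Z M i p) = - (\<i> * of_real (fst p \<bullet> \<xi>)) + of_real (snd p) * w p"
      unfolding Zp w_def inner_vec_def
      by (simp add: distrib_left sum.distrib sum_distrib_left sum_negf sum_subtractf ac_simps del: formal_coeff.simps)
    then show ?thesis unfolding oscillation_def e_def by (simp only: exp_add)
  qed
  define h where "h k p = \<eta> (fst p) * w p ^ k" for k p
  have hS: "smooth_on (X \<times> UNIV) (h k)" for k
    using test_function_smooth_fst[OF \<eta>] wS unfolding h_def[abs_def] smooth_on_def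
    by (intro allI Ck_on_mult Ck_on_power uX) auto
  obtain T0 T D where tp: "transport_problem V K T0 T a f"
    and fb: "\<And>p. p \<in> K \<times> {0<..T} \<Longrightarrow> norm (f p) \<le> D / snd p ^ N"
    and Q: "K \<times> {0<..T} \<subseteq> V" and T: "0 < T" and D: "0 \<le> D"
    by (rule plain_pairing_bounded[OF K]) blast
  interpret tp: transport_problem V K T0 T a f by (rule tp)
  have "compact (K \<times> {0..1::real})" "K \<times> {0..1::real} \<subseteq> X \<times> UNIV" using K by (auto intro: compact_Times)
  from smooth_bounded_on_compact[OF _ this, of w] obtain W where W: "W \<ge> 0" "\<And>p. p \<in> K \<times> {0..1} \<Longrightarrow> norm (w p) \<le> W"
    using wS by (auto simp: smooth_on_def)
  obtain B where B: "B \<ge> 0" "\<And>x. x \<in> K \<Longrightarrow> norm (\<eta> x) \<le> B"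
    using smooth_bounded_on_compact[of UNIV \<eta> K] \<eta> K by (auto simp: test_functions_def)
  define G where "G k p = (of_real (snd p) ^ k / fact k) * (f p * h k p)" for k p
  define R where "R p = f p * \<phi> (fst p) * oscillation M \<xi> p - (\<Sum>k\<le>N. G k p)" for p
  have R: "R p = f p * \<eta> (fst p) * (exp (of_real (snd p) * w p) - (\<Sum>k\<le>N. (of_real (snd p) * w p) ^ k / fact k))" for p
    by (simp add: R_def E G_def h_def \<eta>_def right_diff_distrib sum_distrib_left power_mult_distrib ac_simps)
  have cf: "continuous_on V f" by (rule Ck_on_1I(2)[OF tp.f])
  have c\<phi>: "continuous_on V (\<lambda>p. \<phi> (fst p))"
    by (rule Ck_on_imp_continuous_on[of 0], rule Ck_on_subset[OF unique_V V_subset(3)])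
      (use test_function_smooth_fst[OF \<phi>] in \<open>simp only: smooth_on_def\<close>)
  have ch: "continuous_on V (h k)" for k
    by (rule Ck_on_imp_continuous_on[of 0], rule Ck_on_subset[OF unique_V V_subset(3)])
      (use hS in \<open>simp only: smooth_on_def\<close>)
  have cG: "continuous_on V (G k)" for k
    unfolding G_def[abs_def] by (intro continuous_intros cf ch) auto
  have cR: "continuous_on V R"
    unfolding R_def[abs_def]
    by (intro continuous_on_diff continuous_on_mult continuous_on_sum cf cG c\<phi> Ck_on_imp_continuous_on[OF Ck_on_oscillation[of 0]])
  have G_slice: "slice_integral K (G k) t = of_real t ^ k / fact k * slice_integral K (\<lambda>p. f p * h k p) t" for k t
    unfolding G_def[abs_def] by (rule slice_integral_time_factor[where h = "\<lambda>s. of_real s ^ k / fact k"])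
  have split: "slice_integral K (\<lambda>p. f p * \<phi> (fst p) * oscillation M \<xi> p) t =
      (\<Sum>k\<le>N. of_real t ^ k / fact k * slice_integral K (\<lambda>p. f p * h k p) t) + slice_integral K R t"
    if t: "t \<in> {0<..<T0}" for t
  proof -
    have "slice_integral K (\<lambda>p. f p * \<phi> (fst p) * oscillation M \<xi> p) t = slice_integral K (\<lambda>p. (\<Sum>k\<le>N. G k p) + R p) t"
      by (simp add: R_def)
    also have "\<dots> = slice_integral K (\<lambda>p. \<Sum>k\<le>N. G k p) t + slice_integral K R t"
      by (rule slice_integral_add[OF open_V K(1) tp.KV continuous_on_sum[OF cG] _ cR _ t])
        (simp_all add: G_def h_def \<eta>0 R)
    also have "slice_integral K (\<lambda>p. \<Sum>k\<le>N. G k p) t = (\<Sum>k\<le>N. slice_integral K (G k) t)"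
      by (rule slice_integral_sum[OF open_V K(1) tp.KV cG _ t]) (simp add: G_def h_def \<eta>0)
    finally show ?thesis unfolding G_slice .
  qed
  have "(slice_integral K R \<longlongrightarrow> 0) (at_right 0)"
  proof (rule Lim_null_comparison)
    define A where "A = D * B * (exp W * W ^ Suc N / fact N)"
    have A: "A \<ge> 0" using D B W by (simp add: A_def)
    have "norm (slice_integral K R t) \<le> A * t * measure lborel K" if t: "0 < t" "t < T" for t
    proof (rule slice_integral_norm_le[OF K(1)])
      fix x assume x: "x \<in> K"
      have tw: "norm (of_real t * w (x, t)) \<le> t * W" and tW: "t * W \<le> W"
        using W x t tp.T by (auto simp: norm_mult mult_left_le_one_le intro!: mult_left_mono)
      have "norm (exp (of_real t * w (x, t)) - (\<Sum>k\<le>N. (of_real t * w (x, t)) ^ k / fact k))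
         \<le> exp (norm (of_real t * w (x, t))) * norm (of_real t * w (x, t)) ^ Suc N / fact N"
        by (rule Taylor_exp_field)
      also have "\<dots> \<le> exp W * (t * W) ^ Suc N / fact N"
        using tw tW by (intro divide_right_mono mult_mono power_mono) (auto intro: order_trans)
      finally have 1: "norm (exp (of_real t * w (x, t)) - (\<Sum>k\<le>N. (of_real t * w (x, t)) ^ k / fact k))
         \<le> exp W * (t * W) ^ Suc N / fact N" .
      have 2: "norm (f (x, t)) \<le> D / t ^ N" using fb[of "(x, t)"] x t by auto
      have "norm (R (x, t)) \<le> D / t ^ N * B * (exp W * (t * W) ^ Suc N / fact N)"
        unfolding R norm_mult fst_conv snd_conv using 1 2 B x D W t
        by (intro mult_mono) (auto intro: mult_nonneg_nonneg)
      also have "\<dots> = A * t" using t by (simp add: A_def power_mult_distrib)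
      finally show "norm (R (x, t)) \<le> A * t" .
    qed (use A t in simp)
    then show "\<forall>\<^sub>F t in at_right 0. norm (slice_integral K R t) \<le> A * t * measure lborel K"
      using T unfolding eventually_at_right_field by blast
    show "((\<lambda>t. A * t * measure lborel K) \<longlongrightarrow> 0) (at_right 0)" by (auto intro!: tendsto_eq_intros)
  qed
  moreover have "((\<lambda>t. of_real t ^ Suc k / fact (Suc k) * slice_integral K (\<lambda>p. f p * h (Suc k) p) t) \<longlongrightarrow> 0) (at_right 0)" for k
  proof -
    have "\<exists>D T. 0 < T \<and> (\<forall>t\<in>{0<..T}. norm (slice_integral K (\<lambda>p. f p * h (Suc k) p) t) \<le> D)"
      by (rule smooth_pairing(1)[OF K hS]) (simp add: h_def \<eta>0)
    then obtain D T where DT: "0 < T" "\<And>t. t \<in> {0<..T} \<Longrightarrow> norm (slice_integral K (\<lambda>p. f p * h (Suc k) p) t) \<le> D" by blast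
    show ?thesis
    proof (rule Lim_null_comparison)
      have "norm (of_real t ^ Suc k / fact (Suc k) * slice_integral K (\<lambda>p. f p * h (Suc k) p) t) \<le> t ^ Suc k / fact (Suc k) * D"
        if "0 < t" "t < T" for t
        unfolding norm_mult using DT(2)[of t] that
        by (intro mult_mono) (auto simp: norm_divide norm_power norm_mult simp del: fact_Suc power_Suc)
      then show "\<forall>\<^sub>F t in at_right 0. norm (of_real t ^ Suc k / fact (Suc k) * slice_integral K (\<lambda>p. f p * h (Suc k) p) t)
          \<le> t ^ Suc k / fact (Suc k) * D"
        using DT(1) unfolding eventually_at_right_field by blast
      show "((\<lambda>t. t ^ Suc k / fact (Suc k) * D) \<longlongrightarrow> 0) (at_right 0)"
        by (auto intro!: tendsto_eq_intros simp del: fact_Suc)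
    qed
  qed
  moreover have "((\<lambda>t. slice_integral K (\<lambda>p. f p * h 0 p) t) \<longlongrightarrow> boundary_trace f \<eta>) (at_right 0)"
    using trace_tendsto[OF \<eta>] by (simp add: h_def slice_integral_test[OF s\<eta>])
  ultimately have "((\<lambda>t. (slice_integral K (\<lambda>p. f p * h 0 p) t +
      (\<Sum>k<N. of_real t ^ Suc k / fact (Suc k) * slice_integral K (\<lambda>p. f p * h (Suc k) p) t)) + slice_integral K R t)
      \<longlongrightarrow> (boundary_trace f \<eta> + (\<Sum>k<N. 0)) + 0) (at_right 0)"
    by (intro tendsto_add tendsto_sum)
  moreover have "\<forall>\<^sub>F t in at_right 0. (slice_integral K (\<lambda>p. f p * h 0 p) t +
      (\<Sum>k<N. of_real t ^ Suc k / fact (Suc k) * slice_integral K (\<lambda>p. f p * h (Suc k) p) t)) + slice_integral K R t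
      = slice_integral K (\<lambda>p. f p * \<phi> (fst p) * oscillation M \<xi> p) t"
  proof -
    have "(slice_integral K (\<lambda>p. f p * h 0 p) t +
      (\<Sum>k<N. of_real t ^ Suc k / fact (Suc k) * slice_integral K (\<lambda>p. f p * h (Suc k) p) t)) + slice_integral K R t
      = slice_integral K (\<lambda>p. f p * \<phi> (fst p) * oscillation M \<xi> p) t" if "0 < t" "t < T0" for t
      unfolding split[of t, simplified, OF conjI[OF that]] by (subst sum.atMost_shift) simp
    then show ?thesis using T tp.T unfolding eventually_at_right_field by (intro exI[of _ T0]) auto
  qed
  ultimately show ?thesis unfolding \<eta>_def[abs_def] e_def
    by (auto intro: Lim_transform_eventually)
qed

text \<open>
  For each \<open>r\<close> a separate \<open>Z\<close>, of degree \<open>M\<close> depending on \<open>r\<close>, gives the decay \<open>(1 + \<bar>\<xi>\<bar>)\<^sup>-\<^sup>r\<close>. The cone and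
  the cutoff do not depend on \<open>r\<close>, but the height of the slab may.
\<close>

lemma fourier_decay:
  assumes \<phi>: "\<phi> \<in> test_functions X" and l: "\<And>k j x. k < l \<Longrightarrow> x \<in> X \<Longrightarrow> taylor_coeff k j x = 0"
    and c: "c > 0" and pos: "\<And>x \<xi>. x \<in> closure {x. \<phi> x \<noteq> 0} \<Longrightarrow> \<xi> \<in> \<Gamma> \<Longrightarrow>
      (\<Sum>i\<in>UNIV. \<xi> $ i * (Im (taylor_coeff l i x) / of_nat (Suc l))) \<ge> 2 * c * norm \<xi>"
  shows "rapidly_decreasing_on \<Gamma> (localized_fourier (boundary_trace f) \<phi>)"
  unfolding rapidly_decreasing_on_def
proof
  fix r :: nat
  define K where "K = closure {x. \<phi> x \<noteq> 0}"
  have K: "compact K" "K \<subseteq> X" using \<phi> by (auto simp: K_def test_functions_def)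
  define d where "d = Suc l"
  \<comment> \<open>\<open>L E\<close> contributes \<open>\<bar>\<xi>\<bar> t\<^sup>M\<close> and \<open>f\<close> contributes \<open>t\<^sup>-\<^sup>N\<close>; the remaining \<open>t\<close> to the power \<open>d (r + 1)\<close> pays for \<open>r\<close> and for the factor \<open>\<bar>\<xi>\<bar>\<close>.\<close>
  define M where "M = N + d * Suc r"
  have Ml: "Suc l \<le> M" by (simp add: M_def d_def)
  let ?n = "real CARD('n)"
  obtain T0 T1 Cf where T1: "0 < T1" and Cf: "0 \<le> Cf"
    and tp: "\<And>T. T \<in> {0<..T1} \<Longrightarrow> transport_problem V K T0 T a f"
    and fb: "\<And>p. p \<in> K \<times> {0<..T1} \<Longrightarrow> norm (f p) \<le> Cf / snd p ^ N"
    and Lfb: "\<And>p. p \<in> K \<times> {0<..T1} \<Longrightarrow> norm (vector_field_L V a f p) \<le> Cf * snd p ^ (d * r + 1)"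
    and T11: "T1 \<le> 1" and Q1: "K \<times> {0<..T1} \<subseteq> V"
    by (rule local_bounds[OF K, of "d * r + 1"]) auto
  obtain CZ where CZ: "CZ \<ge> 0" "\<And>i p. p \<in> K \<times> {0<..T1} \<Longrightarrow> norm (vector_field_L V a (Z M i) p) \<le> CZ * snd p ^ M"
    using L_Z_bound[OF K Q1, of M] by blast
  obtain CI where CI: "CI \<ge> 0" "\<And>i x t. x \<in> K \<Longrightarrow> t \<in> {0..1} \<Longrightarrow>
    \<bar>Im (Z M i (x, t)) + t ^ Suc l * (Im (taylor_coeff l i x) / of_nat (Suc l))\<bar> \<le> CI * t ^ (l + 2)"
    using Im_Z_bound[OF K l Ml] by blast
  \<comment> \<open>Below this height the terms of order at least \<open>l + 2\<close> in \<open>Im Z\<close> use up at most half of the leading term.\<close>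
  define T where "T = min T1 (c / (?n * CI + 1))"
  have nC: "?n * CI + 1 > 0" using CI by (simp add: add_nonneg_pos)
  have T: "0 < T" "T \<le> T1" "T \<le> 1" "T \<le> c / (?n * CI + 1)" using T1 T11 c nC by (auto simp: T_def)
  have Q: "K \<times> {0<..T} \<subseteq> V" using Q1 T by auto
  interpret tp: transport_problem V K T0 T a f by (rule tp) (use T in auto)
  have oscillation_le: "norm (oscillation M \<xi> (x, t)) \<le> exp (- c * t ^ d * norm \<xi>)"
    if \<xi>: "\<xi> \<in> \<Gamma>" and x: "x \<in> K" and t: "t \<in> {0<..T}" for \<xi> x t
  proof -
    let ?b = "\<lambda>i. Im (taylor_coeff l i x) / of_nat (Suc l)"
    have "(\<Sum>i\<in>UNIV. \<xi> $ i * Im (Z M i (x, t))) = (\<Sum>i\<in>UNIV. \<xi> $ i * (Im (Z M i (x, t)) + t ^ d * ?b i))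
        - t ^ d * (\<Sum>i\<in>UNIV. \<xi> $ i * ?b i)"
      by (simp add: distrib_left sum.distrib sum_distrib_left ac_simps)
    also have "(\<Sum>i\<in>UNIV. \<xi> $ i * (Im (Z M i (x, t)) + t ^ d * ?b i)) \<le> (\<Sum>i\<in>(UNIV::'n set). norm \<xi> * (CI * t ^ (l + 2)))"
    proof (rule sum_mono)
      fix i
      have "\<xi> $ i * (Im (Z M i (x, t)) + t ^ d * ?b i) \<le> \<bar>\<xi> $ i\<bar> * \<bar>Im (Z M i (x, t)) + t ^ d * ?b i\<bar>"
        by (metis abs_ge_self abs_mult)
      also have "\<dots> \<le> norm \<xi> * (CI * t ^ (l + 2))"
        using CI(2)[OF x, of t i] t T unfolding d_def
        by (intro mult_mono component_le_norm_cart) auto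
      finally show "\<xi> $ i * (Im (Z M i (x, t)) + t ^ d * ?b i) \<le> norm \<xi> * (CI * t ^ (l + 2))" .
    qed
    also have "\<dots> = t ^ d * norm \<xi> * (?n * CI * t)" by (simp add: d_def)
    also have "\<dots> \<le> t ^ d * norm \<xi> * c"
    proof (rule mult_left_mono)
      have "?n * CI * t \<le> (?n * CI + 1) * T" using t CI by (intro mult_mono) auto
      also have "\<dots> \<le> c" using T(4) nC by (simp add: pos_le_divide_eq mult.commute)
      finally show "?n * CI * t \<le> c" .
    qed (use t in simp)
    finally have "(\<Sum>i\<in>UNIV. \<xi> $ i * Im (Z M i (x, t))) \<le> t ^ d * norm \<xi> * c - t ^ d * (\<Sum>i\<in>UNIV. \<xi> $ i * ?b i)" by simp
    moreover have "t ^ d * (2 * c * norm \<xi>) \<le> t ^ d * (\<Sum>i\<in>UNIV. \<xi> $ i * ?b i)"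
      using pos[of x \<xi>] x \<xi> t unfolding K_def by (intro mult_left_mono) auto
    ultimately show ?thesis unfolding norm_oscillation by (simp add: algebra_simps)
  qed
  obtain Cr where Cr: "Cr \<ge> 0" "\<And>t y. 0 \<le> t \<Longrightarrow> t \<le> 1 \<Longrightarrow> 0 \<le> y \<Longrightarrow>
      (t ^ d) ^ r * exp (- c * t ^ d * y) \<le> Cr / (1 + y) ^ r"
    using exp_weight[OF c, of d r] by blast
  obtain Cs where Cs: "Cs \<ge> 0" "\<And>t y. 0 \<le> t \<Longrightarrow> t \<le> 1 \<Longrightarrow> 0 \<le> y \<Longrightarrow>
      (t ^ d) ^ Suc r * exp (- c * t ^ d * y) \<le> Cs / (1 + y) ^ Suc r"
    using exp_weight[OF c, of d "Suc r"] by blast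
  define w where "w \<xi> = 1 / (1 + norm \<xi>) ^ r" for \<xi> :: "real^'n"
  have w: "w \<xi> \<ge> 0" for \<xi> by (simp add: w_def)
  \<comment> \<open>Pulling the decay \<open>w\<close> out of \<open>E\<close> costs \<open>d r\<close> powers of \<open>t\<close> on top of the growth of \<open>f\<close>.\<close>
  define m where "m = N + d * r"
  define C0 where "C0 = Cf * Cr + Cf * (?n * CZ) * Cs"
  have C0: "Cf * Cr \<le> C0" "Cf * (?n * CZ) * Cs \<le> C0" "0 \<le> C0"
    using Cf Cr CZ Cs by (auto simp: C0_def)
  have decay: "t ^ (d * r) * norm (oscillation M \<xi> (x, t)) \<le> Cr * w \<xi>" if "\<xi> \<in> \<Gamma>" "x \<in> K" "t \<in> {0<..T}" for \<xi> x t
  proof -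
    have "t ^ (d * r) * norm (oscillation M \<xi> (x, t)) \<le> (t ^ d) ^ r * exp (- c * t ^ d * norm \<xi>)"
      using oscillation_le[OF that] that by (simp add: power_mult)
    also have "\<dots> \<le> Cr * w \<xi>" using Cr(2)[of t "norm \<xi>"] that T by (simp add: w_def)
    finally show ?thesis .
  qed
  have "\<exists>C\<ge>0. \<forall>\<xi>\<in>\<Gamma>. \<forall>\<psi> B. \<forall>t\<in>{0<..T}. Ck_on (Suc m) V \<psi> \<longrightarrow> tp.supported \<psi> \<longrightarrow> 0 \<le> B \<longrightarrow>
    derivs_le (Suc m) V (K \<times> {0<..T}) \<psi> B \<longrightarrow>
    norm (slice_integral K (\<lambda>p. f p * \<psi> p * oscillation M \<xi> p) t) \<le> C * w \<xi> * B"
  proof (rule tp.pairing_gain[where ?C0.0 = C0])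
    fix \<xi> p assume \<xi>: "\<xi> \<in> \<Gamma>" and p: "p \<in> K \<times> {0<..T}"
    obtain x t where xt: "p = (x, t)" "x \<in> K" "t \<in> {0<..T}" using p by auto
    have t: "0 < t" "t \<le> 1" using xt T by auto
    have p1: "p \<in> K \<times> {0<..T1}" using p T by auto
    have pV: "p \<in> V" using p Q by auto
    note dec = decay[OF \<xi> xt(2,3)]
    have "norm (f p * oscillation M \<xi> p) \<le> Cf / t ^ N * norm (oscillation M \<xi> p)"
      unfolding norm_mult using fb[OF p1] xt by (intro mult_right_mono) auto
    also have "\<dots> = Cf / t ^ m * (t ^ (d * r) * norm (oscillation M \<xi> p))" using t by (simp add: m_def power_add)
    also have "\<dots> \<le> Cf / t ^ m * (Cr * w \<xi>)" using dec xt(1) t Cf by (intro mult_left_mono) auto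
    also have "\<dots> = (Cf * Cr) * w \<xi> * (1 / t ^ m)" by simp
    also have "\<dots> \<le> C0 * w \<xi> * t powr (- (m + 1/2))"
    proof (intro mult_mono)
      have "1 / t ^ m = t powr (- real m)" using t by (simp add: powr_minus powr_realpow divide_inverse)
      also have "\<dots> \<le> t powr (- (m + 1/2))" using t by (intro powr_mono') auto
      finally show "1 / t ^ m \<le> t powr (- (m + 1/2))" .
    qed (use C0 w t in auto)
    finally show "norm (f p * oscillation M \<xi> p) \<le> C0 * w \<xi> * snd p powr (- (m + 1/2))" using xt by simp
    have "norm (vector_field_L V a f p * oscillation M \<xi> p) \<le> Cf * t ^ (d * r + 1) * norm (oscillation M \<xi> p)"
      unfolding norm_mult using Lfb[OF p1] xt by (intro mult_right_mono) auto
    also have "\<dots> = Cf * t * (t ^ (d * r) * norm (oscillation M \<xi> p))" by simp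
    also have "\<dots> \<le> Cf * 1 * (Cr * w \<xi>)" using mult_mono[OF mult_left_mono[OF t(2) Cf] dec] xt(1) t Cf Cr w by simp
    also have "\<dots> \<le> C0 * w \<xi>" using mult_right_mono[OF C0(1) w[of \<xi>]] by simp
    finally show "norm (vector_field_L V a f p * oscillation M \<xi> p) \<le> C0 * w \<xi>" .
    have LE_le: "norm (\<Sum>i\<in>UNIV. - (\<i> * of_real (\<xi> $ i)) * vector_field_L V a (Z M i) p) \<le> (1 + norm \<xi>) * (?n * CZ) * t ^ M"
    proof -
      have "norm (\<Sum>i\<in>UNIV. - (\<i> * of_real (\<xi> $ i)) * vector_field_L V a (Z M i) p) \<le> (\<Sum>i\<in>(UNIV::'n set). (1 + norm \<xi>) * (CZ * t ^ M))"
      proof (rule sum_norm_le)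
        fix i
        have "\<bar>\<xi> $ i\<bar> \<le> 1 + norm \<xi>" using component_le_norm_cart[of \<xi> i] by simp
        then show "norm (- (\<i> * of_real (\<xi> $ i)) * vector_field_L V a (Z M i) p) \<le> (1 + norm \<xi>) * (CZ * t ^ M)"
          unfolding norm_mult using CZ(2)[OF p1, of i] xt by (intro mult_mono) (auto simp: norm_mult)
      qed
      then show ?thesis by (simp add: ac_simps)
    qed
    have "norm (f p * vector_field_L V a (oscillation M \<xi>) p) = norm (f p) * (norm (oscillation M \<xi> p) *
        norm (\<Sum>i\<in>UNIV. - (\<i> * of_real (\<xi> $ i)) * vector_field_L V a (Z M i) p))"
      by (simp only: vector_field_L_oscillation[OF pV] norm_mult)
    also have "\<dots> \<le> Cf / t ^ N * (exp (- c * t ^ d * norm \<xi>) * ((1 + norm \<xi>) * (?n * CZ) * t ^ M))"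
      using fb[OF p1] xt oscillation_le[OF \<xi> xt(2,3)] LE_le t Cf by (intro mult_mono) auto
    also have "\<dots> = Cf * (?n * CZ) * (1 + norm \<xi>) * ((t ^ d) ^ Suc r * exp (- c * t ^ d * norm \<xi>))"
      using t by (simp add: M_def power_add power_mult[symmetric] del: power_Suc)
    also have "\<dots> \<le> Cf * (?n * CZ) * (1 + norm \<xi>) * (Cs / (1 + norm \<xi>) ^ Suc r)"
      using Cs(2)[of t "norm \<xi>"] t Cf CZ by (intro mult_left_mono) auto
    also have "\<dots> = Cf * (?n * CZ) * Cs * w \<xi>"
    proof -
      have "1 + norm \<xi> \<noteq> 0" using norm_ge_zero[of \<xi>] by linarith
      then show ?thesis by (simp add: w_def)
    qed
    also have "\<dots> \<le> C0 * w \<xi>" by (rule mult_right_mono[OF C0(2) w])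
    finally show "norm (f p * vector_field_L V a (oscillation M \<xi>) p) \<le> C0 * w \<xi>" .
  qed (use C0 w Ck_on_oscillation in auto)
  then obtain C where C: "C \<ge> 0" "\<And>\<xi> \<psi> B t. \<xi> \<in> \<Gamma> \<Longrightarrow> t \<in> {0<..T} \<Longrightarrow> Ck_on (Suc m) V \<psi> \<Longrightarrow> tp.supported \<psi> \<Longrightarrow> 0 \<le> B \<Longrightarrow>
    derivs_le (Suc m) V (K \<times> {0<..T}) \<psi> B \<Longrightarrow>
    norm (slice_integral K (\<lambda>p. f p * \<psi> p * oscillation M \<xi> p) t) \<le> C * w \<xi> * B" by blast
  let ?\<psi> = "\<lambda>p::(real^'n) \<times> real. \<phi> (fst p)"
  have sm: "Ck_on k UNIV \<phi>" for k using \<phi> by (simp add: test_functions_def smooth_on_def)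
  have \<psi>: "Ck_on (Suc m) V ?\<psi>" by (rule Ck_on_fst[OF unique_V subset_UNIV sm])
  have sup: "tp.supported ?\<psi>"
    unfolding tp.supported_def by (intro ballI impI, rule zero_off_closure_support, unfold K_def)
  let ?B = "test_seminorm (Suc m) \<phi>"
  have B: "?B \<ge> 0" using deriv_le_test_seminorm[OF \<phi>, of "[]" "Suc m" 0] order_trans[OF norm_ge_zero] by simp
  have \<psi>B: "derivs_le (Suc m) V (K \<times> {0<..T}) ?\<psi> ?B"
    by (rule derivs_le_fst[OF open_V Q sm B]) (rule deriv_le_test_seminorm[OF \<phi>])
  have "norm (localized_fourier (boundary_trace f) \<phi> \<xi>) \<le> C * ?B / (1 + norm \<xi>) ^ r" if \<xi>: "\<xi> \<in> \<Gamma>" for \<xi>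
  proof -
    have "\<forall>\<^sub>F t in at_right 0. norm (slice_integral K (\<lambda>p. f p * \<phi> (fst p) * oscillation M \<xi> p) t) \<le> C * w \<xi> * ?B"
      using C(2)[OF \<xi> _ \<psi> sup B \<psi>B] T unfolding eventually_at_right_field by (intro exI[of _ T]) auto
    then have "norm (boundary_trace f (\<lambda>x. \<phi> x * exp (- (\<i> * of_real (x \<bullet> \<xi>))))) \<le> C * w \<xi> * ?B"
      by (intro tendsto_upperbound[OF tendsto_norm[OF oscillation_pairing_tendsto[OF \<phi>, folded K_def]]]) auto
    then show ?thesis by (simp add: localized_fourier_def w_def ac_simps)
  qed
  then show "\<exists>C. \<forall>\<xi>\<in>\<Gamma>. norm (localized_fourier (boundary_trace f) \<phi> \<xi>) \<le> C / (1 + norm \<xi>) ^ r" by blast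
qed

lemma not_in_wave_front_set:
  assumes l: "\<And>j x. j < l \<Longrightarrow> x \<in> X \<Longrightarrow> (dir_deriv S (0, 1) ^^ j) a (x, 0) = 0"
    and x0: "x0 \<in> X"
    and pos: "(dir_deriv S (0, 1) ^^ l) (\<lambda>p. \<chi> i. Im (a p $ i)) (x0, 0) \<bullet> \<xi>0 > 0"
  shows "(x0, \<xi>0) \<notin> wave_front_set X (boundary_trace f)"
proof -
  define \<beta> where "\<beta> x = (\<chi> i. Im (taylor_coeff l i x) / of_nat (Suc l))" for x
  have tl: "taylor_coeff k j x = 0" if "k < l" "x \<in> X" for k j x
    using taylor_coeff_component[OF that(2), of k j] l[OF that] by simp
  have "bounded_linear (\<lambda>v::complex^'n. (\<chi> i. Im (v $ i)))"
    unfolding linear_conv_bounded_linear[symmetric] by (intro linearI) (auto simp: vec_eq_iff)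
  moreover have "smooth_on S a" using a by (simp add: S_def)
  ultimately have "(dir_deriv S (0, 1) ^^ l) (\<lambda>p. \<chi> i. Im (a p $ i)) (x0, 0) = (\<chi> i. Im ((dir_deriv S (0, 1) ^^ l) a (x0, 0) $ i))"
    using dir_deriv_funpow_linear(2)[OF unique_S _ time_direction_in_Basis, of a "\<lambda>v. \<chi> i. Im (v $ i)" "(x0, 0)" l] x0
    by (simp add: S_def)
  also have "\<dots> = (fact l * of_nat (Suc l)) *\<^sub>R \<beta> x0"
  proof -
    have "Im (of_real q * z) = q * Im z" for q z by simp
    then have im: "Im (of_real (1 / fact l) * z) = 1 / fact l * Im z" for z by blast
    show ?thesis unfolding \<beta>_def taylor_coeff_component[OF x0] im
      by (simp add: vec_eq_iff del: of_nat_Suc)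
  qed
  finally have "(fact l * real (Suc l)) * (\<beta> x0 \<bullet> \<xi>0) > 0" using pos by simp
  then have b0: "\<beta> x0 \<bullet> \<xi>0 > 0" by (rule zero_less_mult_pos) simp
  then have \<xi>0: "\<xi>0 \<noteq> 0" by auto
  \<comment> \<open>The inner product \<open>\<beta> x \<bullet> \<xi>\<close> is \<open>8 c \<bar>\<xi>\<bar>\<close> at \<open>(x0, \<xi>0)\<close>. The cone asks for more than \<open>4 c \<bar>\<xi>\<bar>\<close> at \<open>x0\<close>, which leaves at least \<open>2 c \<bar>\<xi>\<bar>\<close> for \<open>x\<close> near \<open>x0\<close>.\<close>
  define c where "c = (\<beta> x0 \<bullet> \<xi>0) / (8 * norm \<xi>0)"
  have c: "c > 0" using b0 \<xi>0 by (simp add: c_def)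
  define \<Gamma> where "\<Gamma> = {\<xi>. 4 * c * norm \<xi> < \<beta> x0 \<bullet> \<xi>}"
  have \<Gamma>: "open_cone \<Gamma>" unfolding open_cone_def
  proof (intro conjI ballI allI impI)
    show "open \<Gamma>" unfolding \<Gamma>_def by (intro open_Collect_less continuous_intros)
    show "r *\<^sub>R \<xi> \<in> \<Gamma>" if "\<xi> \<in> \<Gamma>" "0 < r" for \<xi> r using that by (simp add: \<Gamma>_def)
  qed
  have \<xi>\<Gamma>: "\<xi>0 \<in> \<Gamma>" using b0 \<xi>0 by (simp add: \<Gamma>_def c_def)
  have "Ck_on 0 X (taylor_coeff l i)" for i using smooth_taylor_coeff by (simp only: smooth_on_def)
  then have "continuous_on X \<beta>" unfolding \<beta>_def[abs_def]
    by (intro continuous_on_vec_lambda continuous_intros) auto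
  then have "open (X \<inter> \<beta> -` ball (\<beta> x0) (2 * c))" using X by (simp add: continuous_open_preimage)
  moreover have "x0 \<in> X \<inter> \<beta> -` ball (\<beta> x0) (2 * c)" using x0 c by simp
  ultimately obtain e where e: "e > 0" "cball x0 e \<subseteq> X \<inter> \<beta> -` ball (\<beta> x0) (2 * c)"
    using open_contains_cball by metis
  obtain \<phi> where \<phi>: "\<phi> \<in> test_functions X" "\<phi> x0 \<noteq> 0" "closure {x. \<phi> x \<noteq> 0} \<subseteq> cball x0 e"
    using exists_bump[of e x0 X] e by auto
  have "rapidly_decreasing_on \<Gamma> (localized_fourier (boundary_trace f) \<phi>)"
  proof (rule fourier_decay[OF \<phi>(1) tl c])
    fix x \<xi> assume x: "x \<in> closure {x. \<phi> x \<noteq> 0}" and \<xi>: "\<xi> \<in> \<Gamma>"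
    have "norm (\<beta> x0 - \<beta> x) \<le> 2 * c" using e(2) \<phi>(3) x by (auto simp: dist_norm)
    then have "(\<beta> x0 - \<beta> x) \<bullet> \<xi> \<le> 2 * c * norm \<xi>"
      using norm_cauchy_schwarz[of "\<beta> x0 - \<beta> x" \<xi>] mult_right_mono[of _ "2 * c" "norm \<xi>"] by fastforce
    then have "2 * c * norm \<xi> \<le> \<beta> x \<bullet> \<xi>" using \<xi> by (simp add: \<Gamma>_def inner_diff_left)
    also have "\<beta> x \<bullet> \<xi> = (\<Sum>i\<in>UNIV. \<xi> $ i * (Im (taylor_coeff l i x) / of_nat (Suc l)))"
      by (simp add: inner_vec_def \<beta>_def mult.commute)
    finally show "2 * c * norm \<xi> \<le> (\<Sum>i\<in>UNIV. \<xi> $ i * (Im (taylor_coeff l i x) / of_nat (Suc l)))" .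
  qed
  then show ?thesis using \<phi> \<Gamma> \<xi>\<Gamma> unfolding wave_front_set_def by blast
qed

end

theorem theorem2p1:
  fixes X :: "(real^'n) set"
    and U :: "((real^'n) \<times> real) set"
    and a :: "(real^'n) \<times> real \<Rightarrow> complex^'n"
    and f :: "(real^'n) \<times> real \<Rightarrow> complex"
    and l :: nat and x0 \<xi>0 :: "real^'n"
  assumes "open X" and "open U" and "X \<times> {0} \<subseteq> U"
    and "smooth_on (X \<times> {0} \<union> upper_part U) a"
    and "Ck_on 1 (upper_part U) f"
    and "\<exists>N::nat. bigo_locally_uniformly X f (\<lambda>t. 1 / t ^ N)"
    and "\<forall>k::nat\<ge>1. bigo_locally_uniformly X (vector_field_L (upper_part U) a f) (\<lambda>t. t ^ k)"
    and "\<forall>j<l. \<forall>x\<in>X. (dir_deriv (X \<times> {0} \<union> upper_part U) (0, 1) ^^ j) a (x, 0) = 0"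
    and "x0 \<in> X"
    and "(dir_deriv (X \<times> {0} \<union> upper_part U) (0, 1) ^^ l) (\<lambda>p. \<chi> i. Im (a p $ i)) (x0, 0) \<bullet> \<xi>0 > 0"
  shows "has_boundary_trace X f \<and> (x0, \<xi>0) \<notin> wave_front_set X (boundary_trace f)"
proof -
  obtain N where "bigo_locally_uniformly X f (\<lambda>t. 1 / t ^ N)" using assms(6) by blast
  then interpret boundary_problem X U a f N
    by unfold_locales (use assms in auto)
  show ?thesis
    using has_trace not_in_wave_front_set[of l x0 \<xi>0] assms(8-10) unfolding S_def by blast
qed

end
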